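(* There exists a constant $p_0>0$ such that the following holds. Let $p=p(n)\in[0,1]$, $k=k(n)\in\mathbb{N}$ and $r=r(n)\in\mathbb{N}$ satisfy, for all sufficiently large even $n\in\mathbb{N}$, \[ 200\frac{(\log\log n)^{2/3}}{(\log n)^{1/3}} \le p \le p_0, \qquad \frac{1000}{p}\log(1/p) \le k \le \frac{p^2\log n}{3000\log(1/p)}, \qquad 1\le r \le \frac{pk}{20}. \] Then the $r$-majority bootstrap percolation process $\mathcal{M}_r(\mathcal{L}^*(n,k,r);p)$ on the $(4k+r+2)$-regular random graph $\mathcal{L}^*(n,k,r)$ disseminates asymptotically almost surely (as $n\to\infty$ along even $n$).
   Context: All logarithms are natural. For a graph $G=(V,E)$, an integer $r$ and a set $A\subseteq V$, the $r$-majority bootstrap percolation process $\mathcal{M}_r(G;A)$ starts with the vertices of $A$ active and all others inactive; at each round, every inactive vertex whose number of active neighbours minus number of inactive neighbours is at least $r$ becomes active (active vertices stay active). The process runs until no further vertex becomes active. It disseminates if all vertices are active in the final state. $\mathcal{M}_r(G;p)$ denotes the same process where each vertex is initially active independently with probability $p$. An event holds asymptotically almost surely (a.a.s.) if its probability tends to $1$ as $n\to\infty$. The graph $\mathcal{L}(n,k)$ (for $2k+1\le n$) has vertex set the torus $[n]^2$ (coordinates modulo $n$), and each vertex $v$ is joined to $v+w$ for all $w\in\{-k,\dots,k\}\times\{-1,1\}$; it is $(4k+2)$-regular. For even $n$, the random graph $\mathcal{L}^*(n,k,r)$ is obtained by adding to $\mathcal{L}(n,k)$ the edges of an $r$-tuple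 of perfect matchings of $[n]^2$ chosen uniformly at random among all $r$-tuples of perfect matchings that are pairwise edge-disjoint and use no edge of $\mathcal{L}(n,k)$ (so no multiple edges are created); it is $(4k+r+2)$-regular. *)

theory Defs
  imports "HOL-Probability.Probability" "HOL-Probability.Product_PMF"
begin

text \<open>Vertex set and edge set; edges are two-element sets.\<close>

type_synonym 'a graph = "'a set \<times> 'a set set"

definition verts :: "'a graph \<Rightarrow> 'a set" where
  "verts G = fst G"

definition edges :: "'a graph \<Rightarrow> 'a set set" where
  "edges G = snd G"

definition nbrs :: "'a graph \<Rightarrow> 'a \<Rightarrow> 'a set" where
  "nbrs G v = {u \<in> verts G. {u, v} \<in> edges G}"

definition maj_step :: "int \<Rightarrow> 'a graph \<Rightarrow> 'a set \<Rightarrow> 'a set" where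
  "maj_step r G A =
     A \<union> {v \<in> verts G. int (card (nbrs G v \<inter> A)) - int (card (nbrs G v - A)) \<ge> r}"

definition maj_final :: "int \<Rightarrow> 'a graph \<Rightarrow> 'a set \<Rightarrow> 'a set" where
  "maj_final r G A = (\<Union>t. (maj_step r G ^^ t) A)"

definition disseminates :: "int \<Rightarrow> 'a graph \<Rightarrow> 'a set \<Rightarrow> bool" where
  "disseminates r G A \<longleftrightarrow> maj_final r G A = verts G"

definition random_subset :: "'a set \<Rightarrow> real \<Rightarrow> 'a set pmf" where
  "random_subset V p =
     map_pmf (\<lambda>f. {v \<in> V. f v}) (Pi_pmf V False (\<lambda>_. bernoulli_pmf p))"

definition torus :: "nat \<Rightarrow> (int \<times> int) set" where
  "torus n = {0..<int n} \<times> {0..<int n}"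

definition L_edges :: "nat \<Rightarrow> nat \<Rightarrow> (int \<times> int) set set" where
  "L_edges n k =
     {{(x, y), ((x + a) mod int n, (y + b) mod int n)} | x y a b.
        (x, y) \<in> torus n \<and> a \<in> {- int k..int k} \<and> b \<in> {-1, 1}}"

definition perfect_matching :: "'a set \<Rightarrow> 'a set set \<Rightarrow> bool" where
  "perfect_matching V M \<longleftrightarrow>
     (\<forall>e\<in>M. e \<subseteq> V \<and> card e = 2) \<and> (\<forall>v\<in>V. \<exists>!e. e \<in> M \<and> v \<in> e)"

definition matching_tuples :: "nat \<Rightarrow> nat \<Rightarrow> nat \<Rightarrow> (int \<times> int) set set list set" where
  "matching_tuples n k r =
     {Ms. length Ms = r \<and>
          (\<forall>i<r. perfect_matching (torus n) (Ms ! i) \<and> Ms ! i \<inter> L_edges n k = {}) \<and>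
          (\<forall>i<r. \<forall>j<r. i \<noteq> j \<longrightarrow> Ms ! i \<inter> Ms ! j = {})}"

text \<open>
  \<^const>\<open>pmf_of_set\<close> is the uniform distribution only on a finite nonempty set; \<^const>\<open>matching_tuples\<close>
  is finite, and it is nonempty for large even \<open>n\<close> as long as \<open>k\<close> and \<open>r\<close> are small compared to \<open>n\<close>.
\<close>

definition L_star :: "nat \<Rightarrow> nat \<Rightarrow> nat \<Rightarrow> (int \<times> int) graph pmf" where
  "L_star n k r =
     map_pmf (\<lambda>Ms. (torus n, L_edges n k \<union> \<Union> (set Ms))) (pmf_of_set (matching_tuples n k r))"

definition dissemination_prob :: "nat \<Rightarrow> nat \<Rightarrow> nat \<Rightarrow> real \<Rightarrow> real" where
  "dissemination_prob n k r p =
     measure_pmf.prob (pair_pmf (L_star n k r) (random_subset (torus n) p))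
       {(G, A). disseminates (int r) G A}"

end

theory Submission
  imports Defs "HOL-Real_Asymp.Real_Asymp"
begin

text \<open>
  A vertex becomes active as soon as \<open>2k + 1 + r\<close> of its neighbours are active.  Write the initial set as
  a union of independent sets \<open>A1\<close> and \<open>A2\<close> of densities about \<open>p / 2\<close>.  A site is good if each half of its
  two neighbouring rows contains enough sites of \<open>A1\<close>.  An active droplet with a suitable convex
  profile, of size about \<open>k / p\<close> times \<open>1 / p\<close>, moves by one step in every direction as long as all sites nearby
  are good.  Sites that are not good are so rare that the open sites (those around which everything is good)
  have a giant cluster on the triangular lattice whose complement consists of small islands; along a
  closed cluster one finds a chain of well separated, hence independent, closed sites, which bounds the fourth moment
  of the island sizes.  As \<open>k\<close> is at most \<open>p\<^sup>2 log n / (3000 log (1/p))\<close>, the set \<open>A2\<close> contains a whole droplet on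
  the giant cluster, which therefore activates everything outside of the islands.

  Finally let \<open>U\<close> be the set of the remaining inactive vertices.  An extreme point of the part of \<open>U\<close> in an island
  has at most \<open>2k + 1\<close> inactive neighbours in the lattice, hence an inactive neighbour in one of the matchings.  This part of \<open>U\<close>
  is not collinear, so it has three extreme points.  Hence \<open>s\<close> islands that meet \<open>U\<close> span at least \<open>3s/2\<close> matching edges, which is
  unlikely for small islands by a union bound, where a switching argument bounds the probability that
  given edges occur in the matchings.
\<close>

section \<open>Site percolation on the triangular lattice\<close>

text \<open>Write t = p k. At the edge of a droplet at most 2e + 1 + r active neighbours are
  missing; with r and e at most t/20 this is about 3t/20, whereas a half row contains about t/2
  sites of \<open>A1\<close>. Failure has probability exp(-3t/20) up to a constant, and t >= 1000
  log(1/p) makes this beat every power of 1/p that occurs. A droplet has O(k/p^2) sites, so the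
  upper bound on k makes a seed as likely as 1/n, against n^2/polylog(n) disjoint positions. The
  initial set is split because the giant cluster must be fixed before a seed is sought on it: given
  \<open>A1\<close>, the cluster and the islands are determined, while \<open>A2\<close> and the
  matchings are still random. The obstacle is the last step. Choosing s islands costs about (N/s)^s
  with N = n^2. If the j-th moment of the island sizes is controlled, a matching edge between the
  islands gains about (s/N)^(1 - 1/j). Hence s edges never suffice, so two special points per island
  would be too few; with three, 3s/2 edges gain more than the cost as soon as (3/2)(1 - 1/j) > 1.
  This forces j > 3, and j = 4 leaves the exponent 9/8 - 1 = 1/8, which is the origin of the eighth
  roots.\<close>

type_synonym point = "int \<times> int"

text \<open>The square lattice with one diagonal direction added. All faces are triangles, so the
  boundary of a set is connected for the same adjacency that defines clusters, and open and closed
  sites can be treated alike.\<close>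

definition tadj :: "point \<Rightarrow> point \<Rightarrow> bool" where
  "tadj u v \<longleftrightarrow> v - u \<in> {(1,0), (0,1), (1,1), (-1,0), (0,-1), (-1,-1)}"

text \<open>The closure tests only the targets of steps; requiring \<open>u \<in> S\<close> as well
  makes \<open>reach S\<close> an equivalence relation on \<open>S\<close>.\<close>

definition reach :: "point set \<Rightarrow> point \<Rightarrow> point \<Rightarrow> bool" where
  "reach S u v \<longleftrightarrow> u \<in> S \<and> (\<lambda>a b. b \<in> S \<and> tadj a b)\<^sup>*\<^sup>* u v"

definition sup_dist :: "point \<Rightarrow> point \<Rightarrow> int" where
  "sup_dist u v = max \<bar>fst u - fst v\<bar> \<bar>snd u - snd v\<bar>"

definition sball :: "point \<Rightarrow> int \<Rightarrow> point set" where
  "sball c m = {z. sup_dist c z \<le> m}"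

lemma tadj_sym: "tadj u v \<Longrightarrow> tadj v u"
  by (cases u; cases v) (auto simp: tadj_def)

lemma tadj_iff:
  "tadj (x, y) (x', y') \<longleftrightarrow>
     (x' - x, y' - y) \<in> {(1,0), (0,1), (1,1), (-1,0), (0,-1), (-1,-1)}"
  by (simp add: tadj_def)

lemma tadj_translate: "tadj (a + u) (a + v) \<longleftrightarrow> tadj u v"
  by (simp add: tadj_def)

lemma reach_refl: "u \<in> S \<Longrightarrow> reach S u u"
  by (simp add: reach_def)

lemma reach_in: assumes "reach S u v" shows "u \<in> S" "v \<in> S"
proof -
  show "u \<in> S" using assms by (simp add: reach_def)
  from assms have "(\<lambda>a b. b \<in> S \<and> tadj a b)\<^sup>*\<^sup>* u v" by (simp add: reach_def)
  then show "v \<in> S" using \<open>u \<in> S\<close> by (induction) auto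
qed

lemma reach_step: "reach S u v \<Longrightarrow> tadj v w \<Longrightarrow> w \<in> S \<Longrightarrow> reach S u w"
  unfolding reach_def by (auto intro: rtranclp.rtrancl_into_rtrancl)

lemma reach_trans: "reach S u v \<Longrightarrow> reach S v w \<Longrightarrow> reach S u w"
  unfolding reach_def by auto

lemma reach_edge: "u \<in> S \<Longrightarrow> v \<in> S \<Longrightarrow> tadj u v \<Longrightarrow> reach S u v"
  using reach_refl reach_step by blast

lemma reach_induct [consumes 1, case_names refl step]:
  assumes "reach S u v" "u \<in> S \<Longrightarrow> P u"
    "\<And>v w. reach S u v \<Longrightarrow> P v \<Longrightarrow> w \<in> S \<Longrightarrow> tadj v w \<Longrightarrow> P w"
  shows "P v"
proof -
  from assms(1) have u: "u \<in> S" and r: "(\<lambda>a b. b \<in> S \<and> tadj a b)\<^sup>*\<^sup>* u v"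
    by (auto simp: reach_def)
  from r have "P v \<and> reach S u v"
  proof induction
    case base then show ?case using u assms(2) reach_refl by blast
  next
    case (step y z) then show ?case using assms(3) reach_step by blast
  qed
  then show ?thesis ..
qed

lemma reach_sym: assumes "reach S u v" shows "reach S v u"
  using assms
proof (induction rule: reach_induct)
  case refl then show ?case by (rule reach_refl)
next
  case (step v w)
  then show ?case by (meson reach_edge reach_in(1) reach_trans tadj_sym)
qed

lemma reach_mono: assumes "reach S u v" "S \<subseteq> S'" shows "reach S' u v"
  using assms(1)
proof (induction rule: reach_induct)
  case refl then show ?case using assms(2) by (auto intro: reach_refl)
next
  case (step v w) then show ?case using assms(2) by (auto intro: reach_step)
qed

lemma reach_component: assumes "reach S u v" shows "reach {w. reach S u w} u v"
  using assms
proof (induction rule: reach_induct)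
  case refl then show ?case by (auto intro: reach_refl)
next
  case (step v w) then show ?case by (auto intro: reach_step)
qed

lemma component_connected:
  assumes "reach S u v" "reach S u w" shows "reach {w. reach S u w} v w"
  using assms by (meson reach_component reach_sym reach_trans)

lemma reach_translate:
  assumes "reach S u v" "\<And>z. z \<in> S \<Longrightarrow> a + z \<in> S'" shows "reach S' (a + u) (a + v)"
  using assms(1)
proof (induction rule: reach_induct)
  case refl then show ?case using assms(2) by (metis reach_refl)
next
  case (step v w) then show ?case using assms(2) by (metis reach_step tadj_translate)
qed

lemma reach_horizontal:
  assumes "\<And>i. min x x' \<le> i \<Longrightarrow> i \<le> max x x' \<Longrightarrow> (i, y) \<in> S"
  shows "reach S (x, y) (x', y)"
proof -
  have *: "reach S (a, y) (b, y)" if "a \<le> b" "\<And>i. a \<le> i \<Longrightarrow> i \<le> b \<Longrightarrow> (i, y) \<in> S" for a b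
    using that
  proof (induction b rule: int_ge_induct)
    case base then show ?case by (auto intro: reach_refl)
  next
    case (step i)
    have "reach S (a, y) (i, y)" by (rule step.IH, rule step.prems) auto
    moreover have "(i + 1, y) \<in> S" by (rule step.prems) (use step.hyps in auto)
    ultimately show ?case using reach_step[of S "(a, y)" "(i, y)" "(i + 1, y)"] by (simp add: tadj_iff)
  qed
  show ?thesis
  proof (cases "x \<le> x'")
    case True then show ?thesis using * assms by simp
  next
    case False then show ?thesis using * assms by (intro reach_sym[of S "(x', y)"]) simp
  qed
qed

lemma reach_vertical:
  assumes "\<And>i. min y y' \<le> i \<Longrightarrow> i \<le> max y y' \<Longrightarrow> (x, i) \<in> S"
  shows "reach S (x, y) (x, y')"
proof -
  have *: "reach S (x, a) (x, b)" if "a \<le> b" "\<And>i. a \<le> i \<Longrightarrow> i \<le> b \<Longrightarrow> (x, i) \<in> S" for a b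
    using that
  proof (induction b rule: int_ge_induct)
    case base then show ?case by (auto intro: reach_refl)
  next
    case (step i)
    have "reach S (x, a) (x, i)" by (rule step.IH, rule step.prems) auto
    moreover have "(x, i + 1) \<in> S" by (rule step.prems) (use step.hyps in auto)
    ultimately show ?case using reach_step[of S "(x, a)" "(x, i)" "(x, i + 1)"] by (simp add: tadj_iff)
  qed
  show ?thesis
  proof (cases "y \<le> y'")
    case True then show ?thesis using * assms by simp
  next
    case False then show ?thesis using * assms by (intro reach_sym[of S "(x, y')"]) simp
  qed
qed

lemma reach_UNIV: "reach UNIV u v"
proof -
  have "reach UNIV (fst u, snd u) (fst v, snd u)" by (rule reach_horizontal) simp
  moreover have "reach UNIV (fst v, snd u) (fst v, snd v)" by (rule reach_vertical) simp
  ultimately show ?thesis using reach_trans by fastforce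
qed

lemma sup_dist_refl [simp]: "sup_dist u u = 0" by (simp add: sup_dist_def)
lemma sup_dist_nonneg: "0 \<le> sup_dist u v" by (simp add: sup_dist_def)
lemma sup_dist_sym: "sup_dist u v = sup_dist v u" by (simp add: sup_dist_def abs_minus_commute)
lemma sup_dist_triangle: "sup_dist u w \<le> sup_dist u v + sup_dist v w"
  unfolding sup_dist_def by linarith
lemma tadj_sup_dist: "tadj u v \<Longrightarrow> sup_dist u v = 1"
  by (cases u; cases v) (auto simp: tadj_def sup_dist_def)

lemma reach_sball: assumes "v \<in> sball c m" shows "reach (sball c m) c v"
proof -
  obtain cx cy x y where e: "c = (cx, cy)" "v = (x, y)" by (cases c; cases v)
  have "reach (sball c m) (cx, cy) (x, cy)"
    by (rule reach_horizontal) (use assms in \<open>auto simp: e sball_def sup_dist_def\<close>)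
  moreover have "reach (sball c m) (x, cy) (x, y)"
    by (rule reach_vertical) (use assms in \<open>auto simp: e sball_def sup_dist_def\<close>)
  ultimately show ?thesis unfolding e by (rule reach_trans)
qed

lemma reach_sball_complement:
  assumes "u \<notin> sball c m" "v \<notin> sball c m"
  shows "reach (- sball c m) u v"
proof -
  obtain cx cy where c: "c = (cx, cy)" by (cases c)
  let ?B = "- sball c m"
  let ?p = "(cx + m + 1, cy + m + 1)"
  have inB: "(a, b) \<in> ?B" if "a > cx + m \<or> b > cy + m \<or> a < cx - m \<or> b < cy - m" for a b
    using that by (auto simp: c sball_def sup_dist_def)
  have *: "reach ?B w ?p" if "w \<notin> sball c m" for w
  proof -
    obtain x y where w: "w = (x, y)" by (cases w)
    have "x > cx + m \<or> y > cy + m \<or> x < cx - m \<or> y < cy - m"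
      using that by (auto simp: w c sball_def sup_dist_def)
    then consider "x > cx + m \<or> x < cx - m" | "y > cy + m \<or> y < cy - m" by blast
    then show ?thesis
    proof cases
      case 1
      have "reach ?B (x, y) (x, cy + m + 1)" by (rule reach_vertical, rule inB) (use 1 in auto)
      moreover have "reach ?B (x, cy + m + 1) ?p" by (rule reach_horizontal, rule inB) auto
      ultimately show ?thesis unfolding w by (rule reach_trans)
    next
      case 2
      have "reach ?B (x, y) (cx + m + 1, y)" by (rule reach_horizontal, rule inB) (use 2 in auto)
      moreover have "reach ?B (cx + m + 1, y) ?p" by (rule reach_vertical, rule inB) auto
      ultimately show ?thesis unfolding w by (rule reach_trans)
    qed
  qed
  show ?thesis using *[OF assms(1)] *[OF assms(2)] reach_sym reach_trans by blast
qed

lemma finite_sball: "finite (sball c m)"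
proof (rule finite_subset)
  show "sball c m \<subseteq> {fst c - m..fst c + m} \<times> {snd c - m..snd c + m}"
    by (auto simp: sball_def sup_dist_def)
qed simp

lemma sball_eq: "sball c m = {fst c - m..fst c + m} \<times> {snd c - m..snd c + m}"
  by (auto simp: sball_def sup_dist_def)

lemma card_sball: "m \<ge> 0 \<Longrightarrow> card (sball c m) = (2 * nat m + 1)\<^sup>2"
  by (simp add: sball_eq card_cartesian_product power2_eq_square nat_add_distrib nat_mult_distrib)

section \<open>Closed functions modulo 2 on the edges of the triangular lattice\<close>

lemma bool_antiderivative:
  fixes f :: "int \<Rightarrow> bool"
  shows "\<exists>F. \<forall>i. F (i + 1) = (F i \<noteq> f i)"
proof (intro exI allI)
  \<comment> \<open>The parity of the number of \<open>j\<close> between 0 and \<open>i\<close> with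
    \<open>f j\<close>; depending on the sign of \<open>i\<close>, one of the two intervals is
    empty.\<close>
  define F where "F i \<longleftrightarrow> odd (card {j\<in>{0..<i}. f j} + card {j\<in>{i..<0}. f j})" for i :: int
  fix i :: int
  show "F (i + 1) = (F i \<noteq> f i)"
  proof (cases "i \<ge> 0")
    case True
    then have e: "{i..<0} = {}" "{i + 1..<0} = {}" "{0..<i + 1} = insert i {0..<i}" by auto
    have "{j\<in>insert i {0..<i}. f j} = (if f i then insert i {j\<in>{0..<i}. f j} else {j\<in>{0..<i}. f j})"
      by auto
    moreover have "card (insert i {j\<in>{0..<i}. f j}) = Suc (card {j\<in>{0..<i}. f j})"
      by (rule card_insert_disjoint, rule finite_subset[of _ "{0..<i}"]) auto
    ultimately show ?thesis unfolding F_def e by (cases "f i") (simp_all only: if_True if_False, simp_all)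
  next
    case False
    then have e: "{0..<i} = {}" "{0..<i + 1} = {}" "{i..<0} = insert i {i + 1..<0}" by auto
    have "{j\<in>insert i {i + 1..<0}. f j} = (if f i then insert i {j\<in>{i + 1..<0}. f j} else {j\<in>{i + 1..<0}. f j})"
      by auto
    moreover have "card (insert i {j\<in>{i + 1..<0}. f j}) = Suc (card {j\<in>{i + 1..<0}. f j})"
      by (rule card_insert_disjoint, rule finite_subset[of _ "{i + 1..<0}"]) auto
    ultimately show ?thesis unfolding F_def e by (cases "f i") (simp_all only: if_True if_False, simp_all)
  qed
qed

text \<open>The plane is simply connected: a function on edges with values modulo 2 whose sum around
  every triangle vanishes is the difference of a potential, found by integrating along the
  horizontal axis and then along columns.\<close>

lemma closed_form_exact:
  fixes \<phi> :: "point \<Rightarrow> point \<Rightarrow> bool"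
  assumes sym: "\<And>u v. \<phi> u v = \<phi> v u"
    and tri: "\<And>a b c. tadj a b \<Longrightarrow> tadj b c \<Longrightarrow> tadj a c \<Longrightarrow> \<phi> a c = (\<phi> a b \<noteq> \<phi> b c)"
  shows "\<exists>\<psi> :: point \<Rightarrow> bool. \<forall>u v. tadj u v \<longrightarrow> \<phi> u v = (\<psi> u \<noteq> \<psi> v)"
proof -
  obtain H where H: "\<And>i. H (i + 1) = (H i \<noteq> \<phi> (i, 0) (i + 1, 0))"
    using bool_antiderivative[of "\<lambda>i. \<phi> (i, 0) (i + 1, 0)"] by auto
  have "\<exists>V. \<forall>i. V (i + 1) = (V i \<noteq> \<phi> (x, i) (x, i + 1))" for x
    using bool_antiderivative[of "\<lambda>i. \<phi> (x, i) (x, i + 1)"] by simp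
  then obtain V where V: "\<And>x i. V x (i + 1) = (V x i \<noteq> \<phi> (x, i) (x, i + 1))" by metis
  \<comment> \<open>Each \<open>V x\<close> is a potential of its column only up to a constant,
    which \<open>V x 0\<close> removes.\<close>
  define \<psi> where "\<psi> = (\<lambda>(x, y). H x \<noteq> (V x y \<noteq> V x 0))"
  have vert: "\<phi> (x, y) (x, y + 1) = (\<psi> (x, y) \<noteq> \<psi> (x, y + 1))" for x y
    using V[of x y] by (auto simp: \<psi>_def)
  \<comment> \<open>The two triangles of a unit square share the diagonal. Eliminating it relates
    opposite sides and transports the claim for horizontal edges from the axis to all rows.\<close>
  have sq: "(\<phi> (x, y) (x + 1, y) \<noteq> \<phi> (x + 1, y) (x + 1, y + 1)) =
            (\<phi> (x, y) (x, y + 1) \<noteq> \<phi> (x, y + 1) (x + 1, y + 1))" for x y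
    using tri[of "(x, y)" "(x + 1, y)" "(x + 1, y + 1)"] tri[of "(x, y)" "(x, y + 1)" "(x + 1, y + 1)"]
    by (auto simp: tadj_iff)
  have hor: "\<phi> (x, y) (x + 1, y) = (\<psi> (x, y) \<noteq> \<psi> (x + 1, y))" for x y
  proof (induction y rule: int_induct[where k = 0])
    case base then show ?case using H[of x] by (auto simp: \<psi>_def)
  next
    case (step1 i) then show ?case using sq[of x i] vert[of x i] vert[of "x + 1" i] by auto
  next
    case (step2 i) then show ?case using sq[of x "i - 1"] vert[of x "i - 1"] vert[of "x + 1" "i - 1"] by auto
  qed
  have diag: "\<phi> (x, y) (x + 1, y + 1) = (\<psi> (x, y) \<noteq> \<psi> (x + 1, y + 1))" for x y
    using tri[of "(x, y)" "(x + 1, y)" "(x + 1, y + 1)"] hor[of x y] vert[of "x + 1" y] by (auto simp: tadj_iff)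
  show ?thesis
  proof (intro exI[of _ \<psi>] allI impI)
    fix u v :: point assume "tadj u v"
    obtain x y x' y' where e: "u = (x, y)" "v = (x', y')" by (cases u; cases v)
    from \<open>tadj u v\<close> have "(x' - x = 1 \<and> y' - y = 0) \<or> (x' - x = 0 \<and> y' - y = 1) \<or> (x' - x = 1 \<and> y' - y = 1) \<or>
        (x' - x = -1 \<and> y' - y = 0) \<or> (x' - x = 0 \<and> y' - y = -1) \<or> (x' - x = -1 \<and> y' - y = -1)"
      unfolding e tadj_iff by simp
    then consider "x' = x + 1 \<and> y' = y" | "x' = x \<and> y' = y + 1" | "x' = x + 1 \<and> y' = y + 1"
      | "x = x' + 1 \<and> y' = y" | "x' = x \<and> y = y' + 1" | "x = x' + 1 \<and> y = y' + 1"
      by (elim disjE) simp_all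
    then show "\<phi> u v = (\<psi> u \<noteq> \<psi> v)"
      unfolding e
      by cases (use hor[of x y] vert[of x y] diag[of x y] hor[of x' y] vert[of x y'] diag[of x' y']
          sym[of "(x, y)" "(x', y')"] in auto)
  qed
qed

text \<open>Modulo 2, the indicator function of the boundary edges with property \<open>Q\<close> is closed on all triangles, hence exact,
  hence constant on the boundary.\<close>

lemma boundary_connected:
  assumes conn: "\<And>u v. u \<in> T \<Longrightarrow> v \<in> T \<Longrightarrow> reach T u v"
    and conn': "\<And>u v. u \<notin> T \<Longrightarrow> v \<notin> T \<Longrightarrow> reach (- T) u v"
    and moveT: "\<And>t t' s. t \<in> T \<Longrightarrow> t' \<in> T \<Longrightarrow> s \<notin> T \<Longrightarrow> tadj t s \<Longrightarrow> tadj t' s \<Longrightarrow> tadj t t' \<Longrightarrow> Q t s \<Longrightarrow> Q t' s"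
    and moveS: "\<And>t s s'. t \<in> T \<Longrightarrow> s \<notin> T \<Longrightarrow> s' \<notin> T \<Longrightarrow> tadj t s \<Longrightarrow> tadj t s' \<Longrightarrow> tadj s s' \<Longrightarrow> Q t s \<Longrightarrow> Q t s'"
    and start: "t0 \<in> T" "s0 \<notin> T" "tadj t0 s0" "Q t0 s0"
    and ts: "t \<in> T" "s \<notin> T" "tadj t s"
  shows "Q t s"
proof -
  define \<phi> where "\<phi> u v \<longleftrightarrow> (u \<in> T \<and> v \<notin> T \<and> Q u v) \<or> (v \<in> T \<and> u \<notin> T \<and> Q v u)" for u v
  have eqT: "Q t s = Q t' s" if "t \<in> T" "t' \<in> T" "s \<notin> T" "tadj t s" "tadj t' s" "tadj t t'" for t t' s
    using that moveT tadj_sym by blast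
  have eqS: "Q t s = Q t s'" if "t \<in> T" "s \<notin> T" "s' \<notin> T" "tadj t s" "tadj t s'" "tadj s s'" for t s s'
    using that moveS tadj_sym by blast
  \<comment> \<open>A triangle has no boundary edge or exactly two, which meet in the vertex that is
    alone on its side. The two moves say that \<open>Q\<close> agrees on them, so the sum of
    \<open>\<phi>\<close> is even.\<close>
  have tri: "\<phi> a c = (\<phi> a b \<noteq> \<phi> b c)" if abc: "tadj a b" "tadj b c" "tadj a c" for a b c
  proof -
    note adj = abc abc[THEN tadj_sym]
    show ?thesis
      by (cases "a \<in> T"; cases "b \<in> T"; cases "c \<in> T")
        (use adj eqT[of a b c] eqT[of a c b] eqT[of b c a] eqS[of a b c] eqS[of b a c] eqS[of c a b] in
          \<open>auto simp: \<phi>_def\<close>)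
  qed
  have sym: "\<phi> u v = \<phi> v u" for u v by (auto simp: \<phi>_def)
  have "\<exists>\<psi> :: point \<Rightarrow> bool. \<forall>u v. tadj u v \<longrightarrow> \<phi> u v = (\<psi> u \<noteq> \<psi> v)"
    by (rule closed_form_exact) (fact sym, fact tri)
  then obtain \<psi> :: "point \<Rightarrow> bool" where \<psi>0: "\<forall>u v. tadj u v \<longrightarrow> \<phi> u v = (\<psi> u \<noteq> \<psi> v)"
    by (elim exE)
  have \<psi>: "\<phi> u v = (\<psi> u \<noteq> \<psi> v)" if "tadj u v" for u v using \<psi>0 that by blast
  have T: "\<psi> u = \<psi> v" if "reach T u v" for u v
    using that
  proof (induction rule: reach_induct)
    case (step v w)
    then show ?case using \<psi>[of v w] reach_in(2)[OF step(1)] by (auto simp: \<phi>_def)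
  qed simp
  have T': "\<psi> u = \<psi> v" if "reach (- T) u v" for u v
    using that
  proof (induction rule: reach_induct)
    case (step v w)
    then show ?case using \<psi>[of v w] reach_in(2)[OF step(1)] by (auto simp: \<phi>_def)
  qed simp
  \<comment> \<open>As \<open>\<phi>\<close> vanishes off the boundary, \<open>\<psi>\<close> is
    constant on \<open>T\<close> and on its complement. The starting edge shows that the two
    constants differ, so \<open>\<phi>\<close> holds on every boundary edge.\<close>
  have "\<psi> t = \<psi> t0" "\<psi> s = \<psi> s0" using T conn T' conn' start ts by blast+
  moreover have "\<psi> t0 \<noteq> \<psi> s0" using \<psi>[OF start(3)] start by (auto simp: \<phi>_def)
  ultimately have "\<phi> t s" using \<psi>[OF ts(3)] by simp
  then show ?thesis using ts by (auto simp: \<phi>_def)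
qed

section \<open>Components, islands and separated chains\<close>

definition sbounded :: "point set \<Rightarrow> bool" where
  "sbounded X \<longleftrightarrow> (\<exists>c m. X \<subseteq> sball c m)"

definition sconnected :: "point set \<Rightarrow> bool" where
  "sconnected S \<longleftrightarrow> (\<forall>u\<in>S. \<forall>v\<in>S. reach S u v)"

lemma sconnected_component: "sconnected {v. reach S u v}"
  unfolding sconnected_def using component_connected by blast

lemma sball_mono: assumes "m + sup_dist c c' \<le> m'" shows "sball c m \<subseteq> sball c' m'"
proof
  fix z assume "z \<in> sball c m"
  then show "z \<in> sball c' m'"
    using sup_dist_triangle[of c' z c] sup_dist_sym[of c c'] assms by (simp add: sball_def)
qed

lemma exit_edge:
  assumes "reach A u v" "u \<in> B" "v \<notin> B"
  shows "\<exists>a b. a \<in> A \<and> b \<in> A \<and> a \<in> B \<and> b \<notin> B \<and> tadj a b"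
proof (rule ccontr)
  assume no: "\<not> ?thesis"
  from assms(1) have "v \<in> B"
  proof (induction rule: reach_induct)
    case refl show ?case by fact
  next
    case (step v w) then show ?case using no reach_in(2)[OF step(1)] by blast
  qed
  then show False using assms by blast
qed

text \<open>The complement of \<open>T\<close> consists of the connected set \<open>S\<close> and
  the other components of \<open>- S\<close>, each of which is adjacent to \<open>S\<close> because
  the whole lattice is connected. Both sides of the boundary of \<open>T\<close> being connected is
  what the cohomological argument requires.\<close>

lemma component_of_complement:
  assumes S: "S \<noteq> {}" "sconnected S"
    and T: "T = {v. reach (- S) w v}" and w: "w \<notin> S"
  shows "sconnected T" and "sconnected (- T)"
    and "\<And>t s. t \<in> T \<Longrightarrow> s \<notin> T \<Longrightarrow> tadj t s \<Longrightarrow> s \<in> S"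
    and "S \<inter> T = {}" and "w \<in> T"
proof -
  show ST: "S \<inter> T = {}" using T reach_in(2) by fastforce
  show "w \<in> T" using T w reach_refl by simp
  show "sconnected T" unfolding T by (rule sconnected_component)
  have S2: "reach S u v" if "u \<in> S" "v \<in> S" for u v using S(2) that by (simp add: sconnected_def)
  show bd: "s \<in> S" if "t \<in> T" "s \<notin> T" "tadj t s" for t s
    using that reach_step[of "- S" w t s] unfolding T by auto
  obtain s0 where s0: "s0 \<in> S" using S by blast
  have to: "reach (- T) u s0" if u: "u \<notin> T" for u
  proof (cases "u \<in> S")
    case True
    then show ?thesis using S2[OF True s0] ST by (auto intro: reach_mono)
  next
    case False
    let ?K = "{v. reach (- S) u v}"
    have KT: "?K \<inter> T = {}" using u unfolding T by (auto dest: reach_sym reach_trans)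
    have "u \<in> ?K" using False by (simp add: reach_refl)
    have "s0 \<notin> ?K" using s0 reach_in(2)[of "- S" u s0] by blast
    obtain a b where ab: "a \<in> ?K" "b \<notin> ?K" "tadj a b"
      using exit_edge[OF reach_UNIV \<open>u \<in> ?K\<close> \<open>s0 \<notin> ?K\<close>] by blast
    have "b \<in> S" using ab reach_step by blast
    have "reach (- T) u a" using reach_component[of "- S" u a] ab(1) KT by (auto elim: reach_mono)
    then have "reach (- T) u b" using reach_step ab(3) \<open>b \<in> S\<close> ST by blast
    moreover have "reach (- T) b s0" using S2[OF \<open>b \<in> S\<close> s0] ST by (auto intro: reach_mono)
    ultimately show ?thesis by (rule reach_trans)
  qed
  show "sconnected (- T)"
    unfolding sconnected_def using to reach_sym reach_trans by blast
qed

text \<open>\<open>boundary_connected\<close> with the property that the endpoint in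
  \<open>T\<close> can be reached from \<open>t0\<close> inside of \<open>C\<close>. This ignores
  the outer endpoint, so one of the two moves is trivial, and the other is a single step in
  \<open>C\<close>.\<close>

lemma outer_boundary_connected:
  assumes S: "S \<noteq> {}" "sconnected S"
    and T: "T = {v. reach (- S) w v}" and w: "w \<notin> S"
    and C: "\<forall>t s. t \<notin> S \<longrightarrow> s \<in> S \<longrightarrow> tadj t s \<longrightarrow> t \<in> C"
  shows "\<exists>t0. t0 \<in> T \<inter> C \<and> (\<forall>t s. t \<in> T \<longrightarrow> s \<notin> T \<longrightarrow> tadj t s \<longrightarrow> reach C t0 t)"
proof -
  note TT = component_of_complement[OF S T w]
  obtain s where "s \<in> S" using S by blast
  then obtain t0 s0 where ts: "t0 \<in> T" "s0 \<notin> T" "tadj t0 s0"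
    using exit_edge[OF reach_UNIV, of w T s] TT by blast
  have bdC: "t \<in> C" if "t \<in> T" "s \<notin> T" "tadj t s" for t s
    using C that TT(3)[OF that] TT(4) by blast
  have "reach C t0 t" if "t \<in> T" "s \<notin> T" "tadj t s" for t s
  proof (rule boundary_connected[where T = T and Q = "\<lambda>t s. reach C t0 t"])
    show "reach C t0 t0" using bdC ts reach_refl by blast
    show "reach C t0 t'" if "t \<in> T" "t' \<in> T" "s \<notin> T" "tadj t s" "tadj t' s" "tadj t t'" "reach C t0 t"
      for t t' s using that bdC reach_step by blast
  qed (use ts that TT(1,2) in \<open>auto simp: sconnected_def\<close>)
  then show ?thesis using ts bdC by blast
qed

text \<open>The outside of the ball is connected and contains no boundary of \<open>T\<close>, so it
  lies entirely in \<open>T\<close> or entirely in its complement.\<close>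

lemma component_bounded_or_cobounded:
  assumes bd: "\<And>t s. t \<in> T \<Longrightarrow> s \<notin> T \<Longrightarrow> tadj t s \<Longrightarrow> t \<in> sball c m"
  shows "T \<subseteq> sball c m \<or> - T \<subseteq> sball c m"
proof (rule ccontr)
  assume "\<not> ?thesis"
  then obtain u v where "u \<in> T" "u \<notin> sball c m" "v \<notin> T" "v \<notin> sball c m" by blast
  then show False using exit_edge[OF reach_sball_complement, of u c m v T] bd by blast
qed

locale closed_sites =
  fixes C :: "point set" and l :: int
  assumes cluster_radius: "\<And>c t. reach C c t \<Longrightarrow> sup_dist c t \<le> l" and l_nonneg: "l \<ge> 0"
begin

lemma open_component_outer:
  assumes "S = {v. reach (- C) s v}"
  shows "\<forall>t u. t \<notin> S \<longrightarrow> u \<in> S \<longrightarrow> tadj t u \<longrightarrow> t \<in> C"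
  using assms reach_step tadj_sym by blast

text \<open>The boundary of an island is part of a single closed cluster, so the island lies in a
  ball around any of its boundary points that covers this cluster. The point \<open>t\<close> is a
  farthest one: the radius is thereby realised by a path of closed sites, along which a chain can be
  placed later.\<close>

lemma island:
  assumes S: "S = {v. reach (- C) s v}" "\<not> sbounded S" and w: "w \<notin> S"
  obtains t0 t where "reach (- S) w t0" "reach C t0 t" "{v. reach (- S) w v} \<subseteq> sball t0 (sup_dist t0 t)"
proof -
  define T where "T = {v. reach (- S) w v}"
  have S1: "S \<noteq> {}" using S(2) unfolding sbounded_def by blast
  have S2: "sconnected S" unfolding S by (rule sconnected_component)
  note TT = component_of_complement[OF S1 S2 T_def w]
  obtain t0 where t0: "t0 \<in> T" "t0 \<in> C" and bd: "\<And>t s. t \<in> T \<Longrightarrow> s \<notin> T \<Longrightarrow> tadj t s \<Longrightarrow> reach C t0 t"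
    using outer_boundary_connected[OF S1 S2 T_def w open_component_outer[OF S(1)]] by blast
  let ?D = "sup_dist t0 ` {t. reach C t0 t}"
  have "?D \<subseteq> {0..l}" using cluster_radius[of t0] sup_dist_nonneg[of t0] by auto
  then have fin: "finite ?D" using finite_subset by blast
  have "Max ?D \<in> ?D" using fin reach_refl[OF t0(2)] by (intro Max_in) blast+
  then obtain t where t: "reach C t0 t" "sup_dist t0 t = Max ?D" by auto
  have far: "sup_dist t0 v \<le> sup_dist t0 t" if "reach C t0 v" for v
    using fin that t(2) by simp
  have "T \<subseteq> sball t0 (sup_dist t0 t) \<or> - T \<subseteq> sball t0 (sup_dist t0 t)"
    by (rule component_bounded_or_cobounded) (use bd far in \<open>auto simp: sball_def\<close>)
  \<comment> \<open>The complement of the island contains the unbounded set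
    \<open>S\<close>.\<close>
  moreover have "\<not> - T \<subseteq> sball t0 (sup_dist t0 t)"
    using S(2) TT(4) unfolding sbounded_def by blast
  ultimately show ?thesis using that t0 t unfolding T_def by blast
qed

lemma island_radius:
  assumes S: "S = {v. reach (- C) s v}" "\<not> sbounded S" and w: "w \<notin> S"
  obtains c where "{v. reach (- S) w v} \<subseteq> sball c l"
proof -
  obtain t0 t where "reach C t0 t" "{v. reach (- S) w v} \<subseteq> sball t0 (sup_dist t0 t)"
    using island[OF S w] by blast
  moreover have "sball t0 (sup_dist t0 t) \<subseteq> sball t0 l"
    using cluster_radius[of t0 t] calculation(1) by (auto simp: sball_def)
  ultimately show ?thesis using that by blast
qed

text \<open>A second unbounded component would avoid \<open>S\<close> and be connected, so it would
  lie in one island of \<open>S\<close>, and islands are bounded.\<close>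

lemma unbounded_component_unique:
  assumes S: "S = {v. reach (- C) s v}" "\<not> sbounded S"
    and S': "S' = {v. reach (- C) s' v}" "\<not> sbounded S'"
  shows "S' = S"
proof (rule ccontr)
  assume "S' \<noteq> S"
  have "S \<inter> S' = {}"
  proof (rule ccontr)
    assume "S \<inter> S' \<noteq> {}"
    then have "reach (- C) s s'" unfolding S S' using reach_sym reach_trans by blast
    then have "S' = S" unfolding S S' using reach_sym reach_trans by blast
    then show False using \<open>S' \<noteq> S\<close> by simp
  qed
  have "S' \<noteq> {}" using S'(2) unfolding sbounded_def by blast
  then obtain w where w: "w \<in> S'" by blast
  then have "w \<notin> S" using \<open>S \<inter> S' = {}\<close> by blast
  then obtain c where c: "{v. reach (- S) w v} \<subseteq> sball c l" using island_radius[OF S] by blast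
  have "S' \<subseteq> {v. reach (- S) w v}"
  proof
    fix v assume "v \<in> S'"
    then have "reach S' w v" using w component_connected unfolding S' by blast
    then show "v \<in> {v. reach (- S) w v}" using reach_mono \<open>S \<inter> S' = {}\<close> by blast
  qed
  then show False using c S'(2) unfolding sbounded_def by blast
qed

text \<open>A ball that avoids \<open>S\<close> is connected and so belongs to one island. Its
  diameter 2(l + 1) exceeds the diameter 2l that an island can have.\<close>

lemma unbounded_component_dense:
  assumes S: "S = {v. reach (- C) s v}" "\<not> sbounded S"
  obtains v where "v \<in> S" "v \<in> sball z (l + 1)"
proof -
  have "\<exists>v. v \<in> S \<and> v \<in> sball z (l + 1)"
  proof (rule ccontr)
    assume no: "\<not> ?thesis"
    then have sub: "sball z (l + 1) \<subseteq> - S" by blast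
    have "z \<in> sball z (l + 1)" using l_nonneg by (simp add: sball_def)
    then have "z \<notin> S" using sub by blast
    then obtain c where c: "{v. reach (- S) z v} \<subseteq> sball c l" using island_radius[OF S] by blast
    have in_ball: "v \<in> sball c l" if "v \<in> sball z (l + 1)" for v
      using reach_mono[OF reach_sball[OF that] sub] c by blast
    have "z + (l + 1, 0) \<in> sball z (l + 1)" "z - (l + 1, 0) \<in> sball z (l + 1)"
      using l_nonneg by (auto simp: sball_def sup_dist_def)
    then have "z + (l + 1, 0) \<in> sball c l" "z - (l + 1, 0) \<in> sball c l" using in_ball by blast+
    then show False using l_nonneg by (auto simp: sball_def sup_dist_def)
  qed
  then show ?thesis using that by blast
qed

end

section \<open>Hulls of bounded clusters and existence of an unbounded open component\<close>

lemma unbounded_complement_component: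
  assumes "X \<subseteq> sball c m"
  obtains z T where "z \<notin> X" "T = {v. reach (- X) z v}" "- T \<subseteq> sball c m" "\<not> sbounded T"
proof -
  define z where "z = c + (max m 0 + 1, 0)"
  have z: "z \<notin> sball c m" by (auto simp: z_def sball_def sup_dist_def)
  define T where "T = {v. reach (- X) z v}"
  have sub: "- sball c m \<subseteq> T"
  proof
    fix v assume "v \<in> - sball c m"
    then have "reach (- sball c m) z v" using z reach_sball_complement by blast
    then show "v \<in> T" unfolding T_def using assms reach_mono by blast
  qed
  have "\<not> sbounded T"
  proof
    assume "sbounded T"
    then obtain c' m' where "T \<subseteq> sball c' m'" by (auto simp: sbounded_def)
    then have "UNIV \<subseteq> sball c m \<union> sball c' m'" using sub by blast
    then have "finite (UNIV :: point set)" using finite_sball finite_subset by blast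
    then show False using infinite_UNIV_int finite_prod by blast
  qed
  then show ?thesis using that[of z T] sub z assms T_def by blast
qed

text \<open>Here \<open>- T\<close> is the hull of \<open>X\<close>, that is \<open>X\<close> with
  its holes filled in. Points outside of the ball can be joined there to the unbounded set
  \<open>T\<close>, so the hull stays in any ball containing \<open>X\<close>.\<close>

lemma unbounded_component_hull:
  assumes X: "X \<subseteq> sball c m" and T: "T = {v. reach (- X) z v}" "\<not> sbounded T"
  shows "- T \<subseteq> sball c m"
proof
  fix v assume "v \<in> - T"
  show "v \<in> sball c m"
  proof (rule ccontr)
    assume v: "v \<notin> sball c m"
    obtain u where u: "u \<in> T" "u \<notin> sball c m" using T(2) unfolding sbounded_def by blast
    have "reach (- X) u v" using reach_sball_complement[OF u(2) v] X reach_mono by blast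
    then show False using u(1) \<open>v \<in> - T\<close> unfolding T(1) using reach_trans by blast
  qed
qed

text \<open>The outer boundary of the hull of a bounded cluster lies in a single cluster of the opposite colour,
  and the hull of the latter is larger.\<close>

lemma next_hull:
  assumes X: "X = {v. reach A x v}" "x \<in> A" "sbounded X"
    and T: "T = {v. reach (- X) z v}" "z \<notin> X" "\<not> sbounded T"
  obtains x2 where "x2 \<notin> A"
    "\<And>T2 z2. T2 = {v. reach (- {v. reach (- A) x2 v}) z2 v} \<Longrightarrow> \<not> sbounded T2 \<Longrightarrow> - T \<subset> - T2"
proof -
  have X1: "X \<noteq> {}" using X reach_refl by blast
  have X2: "sconnected X" unfolding X(1) by (rule sconnected_component)
  have X3: "\<forall>t s. t \<notin> X \<longrightarrow> s \<in> X \<longrightarrow> tadj t s \<longrightarrow> t \<in> - A"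
    using reach_step[of A x] tadj_sym unfolding X(1) by blast
  note TT = component_of_complement[OF X1 X2 T(1,2)]
  obtain x2 where x2: "x2 \<in> T" "x2 \<in> - A"
    and bd: "\<And>t s. t \<in> T \<Longrightarrow> s \<notin> T \<Longrightarrow> tadj t s \<Longrightarrow> reach (- A) x2 t"
    using outer_boundary_connected[OF X1 X2 T(1,2) X3] by blast
  have "- T \<subset> - T2" if T2: "T2 = {v. reach (- {v. reach (- A) x2 v}) z2 v}" "\<not> sbounded T2" for T2 z2
  proof -
    let ?X2 = "{v. reach (- A) x2 v}"
    have T2X2: "T2 \<inter> ?X2 = {}" unfolding T2(1) using reach_in(2) by fastforce
    have "x2 \<notin> T2" using T2X2 x2(2) reach_refl by blast
    \<comment> \<open>A path in \<open>T2\<close> from far away into the hull \<open>- T\<close>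
      would cross the outer boundary of the hull. That boundary belongs to the cluster of
      \<open>x2\<close>, which \<open>T2\<close> avoids.\<close>
    moreover have "- T \<inter> T2 = {}"
    proof (rule ccontr)
      assume "- T \<inter> T2 \<noteq> {}"
      then obtain h where h: "h \<in> T2" "h \<notin> T" by blast
      obtain c m where "X \<subseteq> sball c m" using X(3) by (auto simp: sbounded_def)
      then have "- T \<subseteq> sball c m" using unbounded_component_hull T by blast
      then obtain u where u: "u \<in> T2" "u \<in> T" using T2(2) unfolding sbounded_def by blast
      have "reach T2 u h" using u h component_connected unfolding T2(1) by blast
      then obtain a b where "a \<in> T2" "b \<in> T2" "a \<in> T" "b \<notin> T" "tadj a b" using exit_edge[of T2 u h T] u h by blast
      then have "a \<in> ?X2" using bd by blast
      then show False using T2X2 \<open>a \<in> T2\<close> by blast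
    qed
    ultimately show ?thesis using x2(1) by blast
  qed
  then show ?thesis using that x2 by blast
qed

text \<open>If all open components were bounded, the hull of a closed cluster would be surrounded by
  the hull of an open one, this by the hull of another closed cluster, and so on. These hulls grow
  strictly and contain a common point \<open>z0\<close>, but the hull of a closed cluster has radius
  at most \<open>l\<close>, so all hulls of closed clusters lie in one finite ball.\<close>

lemma (in closed_sites) unbounded_component_exists:
  obtains s S where "S = {v. reach (- C) s v}" "\<not> sbounded S"
proof (cases "\<exists>s. \<not> sbounded {v. reach (- C) s v}")
  case True then show ?thesis using that by blast
next
  case False
  then have bdd: "sbounded {v. reach (- C) s v}" for s by blast
  have "C \<noteq> {}"
  proof
    assume "C = {}"
    then have "{v. reach (- C) (0,0) v} = UNIV" using reach_UNIV by auto
    then have "sbounded UNIV" using bdd by metis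
    then show False using finite_sball finite_subset infinite_UNIV_int finite_prod unfolding sbounded_def by blast
  qed
  then obtain z0 where z0: "z0 \<in> C" by blast
  \<comment> \<open>\<open>H\<close> is the hull of the closed cluster of \<open>x\<close>, written
    through its complement, and it contains the common point \<open>z0\<close>.\<close>
  define ishull where "ishull x H \<longleftrightarrow> x \<in> C \<and> z0 \<in> H \<and>
    (\<exists>z. z \<notin> {v. reach C x v} \<and> - H = {v. reach (- {v. reach C x v}) z v} \<and> \<not> sbounded (- H))" for x H
  have clus: "{v. reach C x v} \<subseteq> sball x l" for x using cluster_radius[of x] by (auto simp: sball_def)
  have hull_sub: "H \<subseteq> sball z0 (2 * l)" if "ishull x H" for x H
  proof -
    obtain z where "- H = {v. reach (- {v. reach C x v}) z v}" "\<not> sbounded (- H)"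
      using \<open>ishull x H\<close> unfolding ishull_def by blast
    then have "- (- H) \<subseteq> sball x l" by (rule unbounded_component_hull[OF clus])
    then have "H \<subseteq> sball x l" by simp
    moreover have "z0 \<in> H" using that by (simp add: ishull_def)
    ultimately show ?thesis using sball_mono[of l x z0 "2 * l"] by (auto simp: sball_def)
  qed
  have ex: "\<exists>x H. ishull x H"
  proof -
    obtain z T where zT: "z \<notin> {v. reach C z0 v}" "T = {v. reach (- {v. reach C z0 v}) z v}" "\<not> sbounded T"
      by (rule unbounded_complement_component[OF clus[of z0]]) (rule that)
    have "z0 \<notin> T"
    proof
      assume "z0 \<in> T"
      then have "reach (- {v. reach C z0 v}) z z0" unfolding zT(2) by simp
      from reach_in(2)[OF this] show False using reach_refl[OF z0] by simp
    qed
    then have "z0 \<in> - T" by simp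
    moreover have "- (- T) = {v. reach (- {v. reach C z0 v}) z v}" "\<not> sbounded (- (- T))" using zT by simp_all
    ultimately have "ishull z0 (- T)" using z0 zT(1) unfolding ishull_def by blast
    then show ?thesis by blast
  qed
  \<comment> \<open>Two applications of \<open>next_hull\<close>, once with the closed and once with
    the open sites in the role of \<open>A\<close>, lead back to a closed cluster.\<close>
  have grow: "\<exists>x' H'. ishull x' H' \<and> card H < card H'" if "ishull x H" for x H
  proof -
    obtain z where z: "x \<in> C" "z \<notin> {v. reach C x v}" "- H = {v. reach (- {v. reach C x v}) z v}" "\<not> sbounded (- H)"
      using \<open>ishull x H\<close> unfolding ishull_def by blast
    have bd: "sbounded {v. reach C x v}" using clus unfolding sbounded_def by blast
    obtain x2 where x2: "x2 \<notin> C"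
      "\<And>T2 z2. T2 = {v. reach (- {v. reach (- C) x2 v}) z2 v} \<Longrightarrow> \<not> sbounded T2 \<Longrightarrow> - (- H) \<subset> - T2"
      by (rule next_hull[OF refl z(1) bd z(3,2,4)]) (rule that)
    obtain c m where cm: "{v. reach (- C) x2 v} \<subseteq> sball c m" using bdd unfolding sbounded_def by blast
    obtain z2 T2 where T2: "z2 \<notin> {v. reach (- C) x2 v}" "T2 = {v. reach (- {v. reach (- C) x2 v}) z2 v}" "\<not> sbounded T2"
      by (rule unbounded_complement_component[OF cm]) (rule that)
    have H2: "H \<subset> - T2" using x2(2)[OF T2(2,3)] by simp
    obtain x3 where x3: "x3 \<notin> - C"
      "\<And>T3 z3. T3 = {v. reach (- {v. reach (- (- C)) x3 v}) z3 v} \<Longrightarrow> \<not> sbounded T3 \<Longrightarrow> - T2 \<subset> - T3"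
      by (rule next_hull[OF refl _ bdd T2(2,1,3)]) (use x2(1) that in auto)
    obtain z3 T3 where T3: "z3 \<notin> {v. reach C x3 v}" "T3 = {v. reach (- {v. reach C x3 v}) z3 v}" "\<not> sbounded T3"
      by (rule unbounded_complement_component[OF clus[of x3]]) (rule that)
    have H3: "- T2 \<subset> - T3" using x3(2)[of T3 z3] T3 by simp
    have "- (- T3) = {v. reach (- {v. reach C x3 v}) z3 v}" "\<not> sbounded (- (- T3))" using T3 by simp_all
    moreover have "z0 \<in> - T3" using H2 H3 \<open>ishull x H\<close> unfolding ishull_def by blast
    moreover have "x3 \<in> C" using x3(1) by simp
    ultimately have hull3: "ishull x3 (- T3)" using T3(1) unfolding ishull_def by blast
    moreover have "card H < card (- T3)"
      by (rule psubset_card_mono[OF finite_subset[OF hull_sub[OF hull3] finite_sball]]) (use H2 H3 in blast)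
    ultimately show ?thesis by blast
  qed
  have "\<exists>x H. ishull x H \<and> card H \<ge> j" for j
  proof (induction j)
    case 0 then show ?case using ex by auto
  next
    case (Suc j) then show ?case using grow by (meson Suc_leI le_less_trans)
  qed
  then obtain x H where "ishull x H" "card H \<ge> Suc (card (sball z0 (2 * l)))" by blast
  moreover have "card H \<le> card (sball z0 (2 * l))" using hull_sub[OF \<open>ishull x H\<close>] finite_sball card_mono by blast
  ultimately show ?thesis by simp
qed

section \<open>Separated chains along clusters\<close>

lemma last_exit:
  assumes "reach A a z" "z \<notin> B"
  shows "reach (A - B) a z \<or> (\<exists>w u. w \<in> B \<and> tadj w u \<and> reach (A - B) u z)"
proof -
  \<comment> \<open>Induction along the reversed path: the first visit to \<open>B\<close> seen from
    \<open>z\<close> is the last one seen from \<open>a\<close>.\<close>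
  from assms(1) have "reach A z a" by (rule reach_sym)
  then show ?thesis
  proof (induction rule: reach_induct)
    case refl then show ?case using assms(2) reach_refl by blast
  next
    case (step v w)
    from step.IH show ?case
    proof
      assume v: "reach (A - B) v z"
      show ?thesis
      proof (cases "w \<in> B")
        case True then show ?thesis using v step.hyps(3) tadj_sym by blast
      next
        case False
        then have "reach (A - B) w v" using reach_edge[of w "A - B" v] reach_in(1)[OF v] step.hyps(2,3) tadj_sym by blast
        then show ?thesis using v reach_trans by blast
      qed
    qed blast
  qed
qed

text \<open>The bound on consecutive distances keeps the number of chains exponential in the length.
  The bound on all pairs will make the sites of a chain independent.\<close>

definition separated_chain :: "int \<Rightarrow> point set \<Rightarrow> point list \<Rightarrow> bool" where
  "separated_chain R C vs \<longleftrightarrow> set vs \<subseteq> C \<and>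
     successively (\<lambda>u v. sup_dist u v \<le> R + 1) vs \<and> sorted_wrt (\<lambda>u v. sup_dist u v > R) vs"

text \<open>Greedy choice: where the path leaves the ball of radius \<open>R\<close> around
  \<open>u\<close> for the last time, it enters a site \<open>v\<close> at distance at most
  \<open>R + 1\<close>. The rest of the path avoids the ball, so the recursion runs in
  \<open>C - sball u R\<close> and all later points stay away from \<open>u\<close>. Each link uses
  up at most \<open>R + 1\<close> of the distance.\<close>

lemma separated_chain_exists:
  assumes "reach C u z" "sup_dist u z \<ge> int m * (R + 1)" "R \<ge> 0"
  shows "\<exists>vs. length vs = m \<and> separated_chain R C (u # vs)"
  using assms(1,2)
proof (induction m arbitrary: C u)
  case 0
  then show ?case using reach_in by (auto simp: separated_chain_def)
next
  case (Suc m)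
  have "int (Suc m) * (R + 1) \<ge> R + 1" using assms(3) by (simp add: algebra_simps)
  then have "z \<notin> sball u R" using Suc.prems(2) by (simp add: sball_def)
  moreover have "\<not> reach (C - sball u R) u z" using reach_in(1) assms(3) by (fastforce simp: sball_def)
  ultimately obtain w v where v: "w \<in> sball u R" "tadj w v" "reach (C - sball u R) v z"
    using last_exit[OF Suc.prems(1)] by blast
  have uv: "sup_dist u v \<le> R + 1"
    using v sup_dist_triangle[of u v w] tadj_sup_dist[of w v] by (simp add: sball_def)
  have "sup_dist v z \<ge> int m * (R + 1)"
    using Suc.prems(2) uv sup_dist_triangle[of u z v] by (simp add: algebra_simps)
  then obtain vs where vs: "length vs = m" "separated_chain R (C - sball u R) (v # vs)"
    using Suc.IH v(3) by blast
  have "separated_chain R C (u # v # vs)"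
    using vs uv reach_in(1)[OF Suc.prems(1)] unfolding separated_chain_def
    by (auto simp: sball_def)
  then show ?case using vs(1) by (intro exI[of _ "v # vs"]) simp
qed

section \<open>Growth of droplets\<close>

definition nbhd :: "nat \<Rightarrow> point set" where
  "nbhd k = {- int k..int k} \<times> {-1, 1}"

lemma finite_nbhd [simp]: "finite (nbhd k)" by (simp add: nbhd_def)

lemma card_nbhd: "card (nbhd k) = 4 * k + 2"
  by (simp add: nbhd_def card_cartesian_product)

text \<open>How much narrower the row at height \<open>m\<close> of a droplet is than the equator.
  The slope grows by \<open>e\<close> per row, which is the curvature, and is capped at
  \<open>k\<close>, the horizontal range of the neighbourhood.\<close>

definition prof :: "nat \<Rightarrow> nat \<Rightarrow> nat \<Rightarrow> int" where
  "prof k e m = (\<Sum>i=1..m. min (int k) (int e * int i))"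

lemma prof_0 [simp]: "prof k e 0 = 0" by (simp add: prof_def)
lemma prof_Suc: "prof k e (Suc m) = prof k e m + min (int k) (int e * int (Suc m))"
  by (simp add: prof_def)

lemma prof_mono: "m \<le> m' \<Longrightarrow> prof k e m \<le> prof k e m'"
  unfolding prof_def by (rule sum_mono2) auto

lemma prof_le: "prof k e m \<le> int k * int m"
proof -
  have "prof k e m \<le> (\<Sum>i=1..m. int k)" unfolding prof_def by (rule sum_mono) simp
  then show ?thesis by (simp add: mult.commute)
qed

lemma prof_nonneg: "0 \<le> prof k e m" using prof_mono[of 0 m] by simp

definition droplet :: "nat \<Rightarrow> nat \<Rightarrow> int \<Rightarrow> point set" where
  "droplet k e W = {(x, y). \<bar>x\<bar> + prof k e (nat \<bar>y\<bar>) \<le> W}"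

definition good_site :: "nat \<Rightarrow> nat \<Rightarrow> point set \<Rightarrow> point \<Rightarrow> bool" where
  "good_site k N A z \<longleftrightarrow> (\<forall>s\<in>{-1,1}. \<forall>t\<in>{-1,1}.
     card {a\<in>{1..int k}. (fst z + s * a, snd z + t) \<in> A} \<ge> N)"

text \<open>The profile has second differences at most \<open>e\<close> (twice that at the equator), so a site just outside
  of the droplet sees at least \<open>2k - 2e\<close> active sites of the droplet; a good site finds the
  remaining ones in the outer row.\<close>

lemma droplet_grows:
  assumes F: "\<And>z. card {w\<in>nbhd k. z + w \<in> F} \<ge> 2 * k + 1 + r \<Longrightarrow> z \<in> F"
    and A: "A \<subseteq> F" and e: "1 \<le> e" "e \<le> k"
    and W: "W \<ge> prof k e (k div e + 1) + int k"
    and D: "\<And>z. z \<in> droplet k e W \<Longrightarrow> c + z \<in> F"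
    and G: "\<And>z. z \<in> droplet k e (W + 1) \<Longrightarrow> good_site k (r + 2 * e + 2) A (c + z)"
    and z: "z \<in> droplet k e (W + 1)"
  shows "c + z \<in> F"
proof (cases "z \<in> droplet k e W")
  case True then show ?thesis by (rule D)
next
  case False
  obtain x y where xy: "z = (x, y)" by (cases z)
  define m where "m = nat \<bar>y\<bar>"
  define w where "w = W - prof k e m"
  have xw: "\<bar>x\<bar> = w + 1" using z False by (auto simp: xy droplet_def w_def m_def)
  \<comment> \<open>Signs pointing away from the centre: \<open>s * a\<close> with
    \<open>a > 0\<close> leads outward along the row, and \<open>y + t\<close> is a row farther from
    the equator.\<close>
  define s :: int where "s = (if x \<ge> 0 then 1 else -1)"
  define t :: int where "t = (if y \<ge> 0 then 1 else -1)"
  have s: "s \<in> {-1,1}" "x = s * \<bar>x\<bar>" and t: "t \<in> {-1,1}" "y = t * \<bar>y\<bar>"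
    by (auto simp: s_def t_def)
  have out: "nat \<bar>y + t\<bar> = Suc m" using t by (auto simp: m_def)
  have inn: "nat \<bar>y - t\<bar> = (if m = 0 then 1 else m - 1)" using t by (auto simp: m_def)
  have absx: "\<bar>x + s * a\<bar> = \<bar>w + 1 + a\<bar>" for a
    using s xw by auto
  define d1 where "d1 = prof k e m - prof k e (nat \<bar>y - t\<bar>)"
  define d2 where "d2 = prof k e (Suc m) - prof k e m"
  have d2: "d2 = min (int k) (int e * int (Suc m))" by (simp add: d2_def prof_Suc)
  \<comment> \<open>At the equator both neighbouring rows are outer rows, whence the value
    \<open>- int e\<close>. It is there that \<open>d2 - d1\<close> may reach
    \<open>2 * e\<close>.\<close>
  have d1: "d1 = (if m = 0 then - int e else min (int k) (int e * int m))"
    using e unfolding d1_def inn by (cases m) (simp_all add: prof_Suc)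
  have d12: "d2 - d1 \<le> 2 * int e" using e unfolding d1 d2 by (auto simp: algebra_simps min_def)
  define R where "R = {a\<in>{1..int k}. (fst (c + z) + s * a, snd (c + z) + t) \<in> A}"
  have R: "card R \<ge> r + 2 * e + 2" using G[OF z] s(1) t(1) unfolding good_site_def R_def by blast
  have finR: "finite R" unfolding R_def by (rule finite_subset[of _ "{1..int k}"]) auto
  have inj: "inj_on (\<lambda>a. (s * a, u)) B" for u :: int and B using s(1) by (auto simp: inj_on_def)
  have nb: "(s * a, u) \<in> nbhd k" if "- int k \<le> a" "a \<le> int k" "u = t \<or> u = - t" for a u
    using that s(1) t(1) by (auto simp: nbhd_def)
  have inner: "c + z + (s * a, - t) \<in> F" if "\<bar>w + 1 + a\<bar> \<le> w + d1" for a
  proof -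
    have "z + (s * a, - t) \<in> droplet k e W"
      using that absx[of a] by (simp add: xy droplet_def d1_def w_def)
    then show ?thesis using D by (metis add.assoc)
  qed
  have outer: "c + z + (s * a, t) \<in> F" if "\<bar>w + 1 + a\<bar> \<le> w - d2" for a
  proof -
    have "z + (s * a, t) \<in> droplet k e W"
      using that absx[of a] by (simp add: xy droplet_def d2_def w_def out)
    then show ?thesis using D by (metis add.assoc)
  qed
  have rand: "c + z + (s * a, t) \<in> F" if "a \<in> R" for a
  proof -
    have "c + z + (s * a, t) = (fst (c + z) + s * a, snd (c + z) + t)" by (simp add: prod_eq_iff)
    then show ?thesis using that A unfolding R_def by auto
  qed
  have count: "c + z \<in> F" if I: "\<And>a. a \<in> I \<Longrightarrow> - int k \<le> a \<and> a \<le> int k \<and> \<bar>w + 1 + a\<bar> \<le> w + d1"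
    and J: "\<And>a. a \<in> J \<Longrightarrow> - int k \<le> a \<and> a < 0 \<and> \<bar>w + 1 + a\<bar> \<le> w - d2"
    and c: "card I + card J + card R \<ge> 2 * k + 1 + r" for I J
  proof -
    have finI: "finite I" using I by (intro finite_subset[of I "{- int k..int k}"]) auto
    have finJ: "finite J" using J by (intro finite_subset[of J "{- int k..0}"]) (auto simp: less_imp_le)
    let ?I = "(\<lambda>a. (s * a, - t)) ` I" and ?O = "(\<lambda>a. (s * a, t)) ` (J \<union> R)"
    have "J \<inter> R = {}" using J by (fastforce simp: R_def)
    then have "card ?O = card J + card R" using finJ finR by (simp add: card_image[OF inj] card_Un_disjoint)
    moreover have "card ?I = card I" by (simp add: card_image[OF inj])
    moreover have "?I \<inter> ?O = {}" using t(1) by auto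
    ultimately have "card (?I \<union> ?O) \<ge> 2 * k + 1 + r" using c finI finJ finR by (simp add: card_Un_disjoint)
    moreover have "?I \<union> ?O \<subseteq> {v\<in>nbhd k. c + z + v \<in> F}"
    proof
      fix v assume "v \<in> ?I \<union> ?O"
      then consider a where "a \<in> I" "v = (s * a, - t)" | a where "a \<in> J" "v = (s * a, t)" | a where "a \<in> R" "v = (s * a, t)"
        by blast
      then show "v \<in> {v\<in>nbhd k. c + z + v \<in> F}"
      proof cases
        case 1 then show ?thesis using I nb inner by simp
      next
        case 2 then show ?thesis using J[of a] nb outer by simp
      next
        case 3
        then have "1 \<le> a" "a \<le> int k" by (auto simp: R_def)
        then show ?thesis using 3 nb rand by simp
      qed
    qed
    then have "card (?I \<union> ?O) \<le> card {v\<in>nbhd k. c + z + v \<in> F}" by (intro card_mono) auto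
    ultimately show ?thesis by (intro F) linarith
  qed
  show ?thesis
  proof (cases "m \<le> k div e")
    \<comment> \<open>The row is so long that only its near end matters: \<open>k + d1\<close> sites
      are active in the inner row and \<open>k - d2\<close> in the outer one, at least
      \<open>2 * k - 2 * e\<close> together. The sites of \<open>R\<close> have \<open>a > 0\<close>
      and are thus disjoint from them.\<close>
    case True
    then have "prof k e m \<le> prof k e (k div e + 1)" by (intro prof_mono) simp
    then have wk: "w \<ge> int k" using W by (simp add: w_def)
    have "- int k \<le> 0" "0 \<le> int e * int m" by simp_all
    then have "- int k \<le> int e * int m" by (rule order_trans)
    then have d1b: "- int k \<le> d1" "d1 \<le> int k" using e unfolding d1 by auto
    have d2b: "0 \<le> d2" "d2 \<le> int k" unfolding d2 by auto
    show ?thesis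
    proof (rule count[of "{- int k..d1 - 1}" "{- int k..- d2 - 1}"])
      show "2 * k + 1 + r \<le> card {- int k..d1 - 1} + card {- int k..- d2 - 1} + card R"
        using R d1b d2b d12 by simp
    qed (use wk d1b d2b in auto)
  next
    \<comment> \<open>Near the tip \<open>w\<close> can be as small as -1, so a row may be short;
      but there the slope is already \<open>k\<close>, and the inner row alone provides
      \<open>2 * k - 1\<close> sites.\<close>
    case False
    then have "Suc (k div e) \<le> m" by simp
    then have "e * Suc (k div e) \<le> e * m" by (rule mult_le_mono2)
    moreover have "k < e * Suc (k div e)" using e by (simp add: dividend_less_times_div)
    ultimately have "k \<le> e * m" by simp
    then have "int k \<le> int e * int m" by (metis of_nat_le_iff of_nat_mult)
    then have d1k: "d1 = int k" using False unfolding d1 by auto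
    show ?thesis
    proof (rule count[of "{- int k + 1..int k - 1}" "{}"])
      show "2 * k + 1 + r \<le> card {- int k + 1..int k - 1} + card {} + card R"
        using R e by simp
    qed (use d1k xw in auto)
  qed
qed

text \<open>The droplet around \<open>c'\<close> is contained in the droplet around \<open>c\<close>
  enlarged by \<open>k + 1\<close> layers: one for the horizontal shift and \<open>k\<close> for the
  vertical one, as a row costs at most \<open>k\<close>. The layers are activated one by one, and
  all sites involved lie in the ball where \<open>G\<close> provides good sites.\<close>

lemma droplet_spreads:
  assumes F: "\<And>z. card {w\<in>nbhd k. z + w \<in> F} \<ge> 2 * k + 1 + r \<Longrightarrow> z \<in> F"
    and A: "A \<subseteq> F" and e: "1 \<le> e" "e \<le> k" and k: "2 \<le> k"
    and W: "W = prof k e (k div e + 1) + int k"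
    and D: "\<And>z. z \<in> droplet k e W \<Longrightarrow> c + z \<in> F"
    and G: "\<And>z. z \<in> sball c (int (k * (k div e + 4))) \<Longrightarrow> good_site k (r + 2 * e + 2) A z"
    and adj: "tadj c c'" and z: "z \<in> droplet k e W"
  shows "c' + z \<in> F"
proof -
  define j where "j = k div e + 1"
  \<comment> \<open>From row \<open>j\<close> on the slope equals \<open>k\<close>. Three further
    rows cost \<open>3 * k\<close>, more than the \<open>2 * k + 1\<close> that remain, so the
    enlarged droplet ends at height \<open>j + 2\<close> at the latest.\<close>
  have profj: "prof k e (j + 3) = prof k e j + 3 * int k"
  proof -
    have "k < e * Suc (k div e)" using e by (simp add: dividend_less_times_div)
    then have "k \<le> e * j" unfolding j_def by simp
    then have "int k \<le> int e * int i" if "j \<le> i" for i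
      using that by (metis le_trans mult_le_mono2 of_nat_le_iff of_nat_mult)
    from this[of "Suc j"] this[of "Suc (Suc j)"] this[of "Suc (Suc (Suc j))"]
    show ?thesis by (simp add: prof_Suc numeral_3_eq_3 min_absorb1)
  qed
  have inball: "c + v \<in> sball c (int (k * (k div e + 4)))" if v: "v \<in> droplet k e (W + int k + 1)" for v
  proof -
    obtain x y where xy: "v = (x, y)" by (cases v)
    have b: "\<bar>x\<bar> + prof k e (nat \<bar>y\<bar>) \<le> prof k e j + 2 * int k + 1"
      using v by (simp add: xy droplet_def W j_def)
    have "\<bar>x\<bar> \<le> int k * int j + 2 * int k + 1" using b prof_le[of k e j] prof_nonneg[of k e "nat \<bar>y\<bar>"] by linarith
    also have "\<dots> \<le> int k * int j + 3 * int k" using k by simp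
    finally have x: "\<bar>x\<bar> \<le> int (k * (k div e + 4))" by (simp add: j_def algebra_simps)
    have "nat \<bar>y\<bar> \<le> j + 2"
    proof (rule ccontr)
      assume "\<not> nat \<bar>y\<bar> \<le> j + 2"
      then have "prof k e (j + 3) \<le> prof k e (nat \<bar>y\<bar>)" by (intro prof_mono) simp
      then show False using b profj k by linarith
    qed
    then have "nat \<bar>y\<bar> \<le> 1 * (k div e + 4)" by (simp add: j_def)
    also have "\<dots> \<le> k * (k div e + 4)" using k by (intro mult_right_mono) auto
    finally have y: "\<bar>y\<bar> \<le> int (k * (k div e + 4))" by linarith
    show ?thesis using x y by (simp add: sball_def sup_dist_def xy)
  qed
  have grow: "c + v \<in> F" if "i \<le> Suc k" "v \<in> droplet k e (W + int i)" for i v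
    using that
  proof (induction i arbitrary: v)
    case 0 then show ?case using D by simp
  next
    case (Suc i)
    have sub: "droplet k e (W + int i + 1) \<subseteq> droplet k e (W + int k + 1)"
      using Suc.prems(1) by (auto simp: droplet_def)
    have 1: "W + int i \<ge> prof k e (k div e + 1) + int k" using W by simp
    have 2: "\<And>u. u \<in> droplet k e (W + int i) \<Longrightarrow> c + u \<in> F" using Suc.IH Suc.prems(1) by simp
    have 3: "\<And>u. u \<in> droplet k e (W + int i + 1) \<Longrightarrow> good_site k (r + 2 * e + 2) A (c + u)"
      using G inball sub by blast
    have "W + int (Suc i) = W + int i + 1" by simp
    then have 4: "v \<in> droplet k e (W + int i + 1)" using Suc.prems(2) by metis
    show ?case by (rule droplet_grows[OF F A e 1 2 3 4])
  qed
  define d where "d = c' - c"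
  have d: "\<bar>fst d\<bar> \<le> 1" "\<bar>snd d\<bar> \<le> 1" using tadj_sup_dist[OF adj] by (auto simp: d_def sup_dist_def)
  have "nat \<bar>snd d + snd z\<bar> \<le> Suc (nat \<bar>snd z\<bar>)" using d by linarith
  then have "prof k e (nat \<bar>snd d + snd z\<bar>) \<le> prof k e (nat \<bar>snd z\<bar>) + int k"
    using prof_mono[of "nat \<bar>snd d + snd z\<bar>" "Suc (nat \<bar>snd z\<bar>)" k e] unfolding prof_Suc by linarith
  moreover have "\<bar>fst z\<bar> + prof k e (nat \<bar>snd z\<bar>) \<le> W" using z by (auto simp: droplet_def)
  ultimately have "\<bar>fst d + fst z\<bar> + prof k e (nat \<bar>snd d + snd z\<bar>) \<le> W + int (Suc k)" using d by linarith
  then have "d + z \<in> droplet k e (W + int (Suc k))" by (simp add: droplet_def case_prod_unfold)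
  then have "c + (d + z) \<in> F" by (intro grow[of "Suc k"]) auto
  then show ?thesis by (simp add: d_def)
qed

text \<open>Counts rows as in \<open>droplet_spreads\<close>, without the additional layers: beyond
  row \<open>k div e + 1\<close> every row costs \<open>k\<close>, so at most one more row is
  nonempty. The cardinality is the number of initially active sites that a seed requires.\<close>

lemma droplet_finite_card:
  assumes e: "1 \<le> e" "e \<le> k" and k: "2 \<le> k"
  shows "finite (droplet k e (prof k e (k div e + 1) + int k))"
    and "card (droplet k e (prof k e (k div e + 1) + int k)) \<le> (2 * k * (k div e + 2) + 1) * (2 * (k div e + 2) + 1)"
    and "droplet k e (prof k e (k div e + 1) + int k) \<subseteq> sball (0, 0) (int (k * (k div e + 4)))"
proof -
  define j where "j = k div e + 1"
  have "k < e * Suc (k div e)" using e by (simp add: dividend_less_times_div)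
  then have "k \<le> e * j" unfolding j_def by simp
  then have ke: "int k \<le> int e * int i" if "j \<le> i" for i
    using that by (metis le_trans mult_le_mono2 of_nat_le_iff of_nat_mult)
  have profj: "prof k e (j + 2) = prof k e j + 2 * int k"
    using ke[of "Suc j"] ke[of "Suc (Suc j)"] by (simp add: prof_Suc numeral_2_eq_2 min_absorb1)
  let ?D = "droplet k e (prof k e (k div e + 1) + int k)"
  have xy: "\<bar>x\<bar> \<le> int (k * (j + 1)) \<and> \<bar>y\<bar> \<le> int (j + 1)" if "(x, y) \<in> ?D" for x y
  proof -
    have b: "\<bar>x\<bar> + prof k e (nat \<bar>y\<bar>) \<le> prof k e j + int k" using that by (simp add: droplet_def j_def)
    have "\<bar>x\<bar> \<le> int k * int j + int k" using b prof_le[of k e j] prof_nonneg[of k e "nat \<bar>y\<bar>"] by linarith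
    moreover have "nat \<bar>y\<bar> \<le> j + 1"
    proof (rule ccontr)
      assume "\<not> nat \<bar>y\<bar> \<le> j + 1"
      then have "prof k e (j + 2) \<le> prof k e (nat \<bar>y\<bar>)" by (intro prof_mono) simp
      then show False using b profj k by linarith
    qed
    ultimately show ?thesis by (simp add: algebra_simps)
  qed
  let ?B = "{- int (k * (j + 1))..int (k * (j + 1))} \<times> {- int (j + 1)..int (j + 1)}"
  have sub: "?D \<subseteq> ?B"
  proof
    fix v assume v: "v \<in> ?D"
    obtain x y where "v = (x, y)" by (cases v)
    then show "v \<in> ?B" using xy v by fastforce
  qed
  then show "finite ?D" by (rule finite_subset) simp
  have "card ?D \<le> card ?B" using sub by (intro card_mono) auto
  also have "\<dots> = (2 * (k * (j + 1)) + 1) * (2 * (j + 1) + 1)"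
  proof -
    have "card {- int a..int a} = 2 * a + 1" for a by simp
    then show ?thesis by (simp only: card_cartesian_product)
  qed
  finally show "card ?D \<le> (2 * k * (k div e + 2) + 1) * (2 * (k div e + 2) + 1)"
    by (simp add: j_def algebra_simps)
  have "j + 1 \<le> k * (k div e + 4)"
  proof -
    have "j + 1 \<le> 1 * (k div e + 4)" by (simp add: j_def)
    also have "\<dots> \<le> k * (k div e + 4)" using k by (intro mult_right_mono) auto
    finally show ?thesis .
  qed
  moreover have "k * (j + 1) \<le> k * (k div e + 4)" unfolding j_def by (rule mult_le_mono2) simp
  ultimately have b: "int (j + 1) \<le> int (k * (k div e + 4))" "int (k * (j + 1)) \<le> int (k * (k div e + 4))"
    by (simp_all only: of_nat_le_iff)
  show "?D \<subseteq> sball (0, 0) (int (k * (k div e + 4)))"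
  proof
    fix v assume v: "v \<in> ?D"
    obtain x y where xyv: "v = (x, y)" by (cases v)
    then show "v \<in> sball (0, 0) (int (k * (k div e + 4)))"
      using xy[of x y] v b unfolding sball_def sup_dist_def xyv mem_Collect_eq fst_conv snd_conv by linarith
  qed
qed

section \<open>Extreme points of finite sets of inactive sites\<close>

lemma extreme_point_nbrs:
  fixes \<alpha> \<beta> :: int
  assumes "\<And>w. w \<in> nbhd k \<Longrightarrow> \<alpha> * fst w + \<beta> * snd w \<noteq> 0"
    and "\<And>z'. z' \<in> X \<Longrightarrow> \<alpha> * fst z' + \<beta> * snd z' \<le> \<alpha> * fst z + \<beta> * snd z"
  shows "card {w\<in>nbhd k. z + w \<in> X} \<le> 2 * k + 1"
proof -
  let ?f = "\<lambda>w. \<alpha> * fst w + \<beta> * snd w"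
  let ?N = "{w\<in>nbhd k. ?f w < 0}" and ?P = "{w\<in>nbhd k. ?f w > 0}"
  \<comment> \<open>The neighbourhood is symmetric and the functional has no zero on it, so it is
    negative on exactly half of the neighbours. A maximiser has its neighbours in \<open>X\<close>
    only in that half.\<close>
  have "bij_betw uminus ?N ?P"
    by (rule bij_betw_byWitness[of _ uminus]) (auto simp: nbhd_def)
  then have "card ?N = card ?P" by (rule bij_betw_same_card)
  moreover have "card (?N \<union> ?P) = card ?N + card ?P" by (rule card_Un_disjoint) auto
  moreover have "?N \<union> ?P = nbhd k" using assms(1) by (auto simp: neq_iff)
  ultimately have "card ?N = 2 * k + 1" using card_nbhd[of k] by simp
  moreover have "{w\<in>nbhd k. z + w \<in> X} \<subseteq> ?N"
  proof
    fix w assume w: "w \<in> {w\<in>nbhd k. z + w \<in> X}"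
    then have "?f (z + w) \<le> ?f z" using assms(2) by blast
    then have "?f w \<le> 0" by (simp add: algebra_simps)
    then show "w \<in> ?N" using w assms(1)[of w] by simp
  qed
  then have "card {w\<in>nbhd k. z + w \<in> X} \<le> card ?N" by (intro card_mono) auto
  ultimately show ?thesis by simp
qed

text \<open>A maximiser \<open>a\<close> and a minimiser \<open>b\<close> of one generic functional,
  and then a maximiser of a functional for which \<open>a\<close> and \<open>b\<close> are almost
  level, oriented towards a point of \<open>X\<close> off the line through them. Such a point exists
  because on a line a site has at most two neighbours.\<close>

lemma three_extreme_points:
  assumes X: "finite X" "X \<noteq> {}" and nbrs: "\<And>z. z \<in> X \<Longrightarrow> card {w\<in>nbhd k. z + w \<in> X} \<ge> 3"
  obtains Y where "Y \<subseteq> X" "card Y = 3" "\<And>z. z \<in> Y \<Longrightarrow> card {w\<in>nbhd k. z + w \<in> X} \<le> 2 * k + 1"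
proof -
  have argmax: "\<exists>z\<in>X. \<forall>z'\<in>X. f z' \<le> (f z :: int)" for f
  proof -
    have "Max (f ` X) \<in> f ` X" using X by (intro Max_in) auto
    then obtain z where "z \<in> X" "f z = Max (f ` X)" by auto
    then show ?thesis using X(1) by (metis Max_ge finite_imageI imageI)
  qed
  \<comment> \<open>Has no zero on \<open>nbhd k\<close>, since the second coordinate is 1 or -1 and
    the first is at most \<open>k\<close> in absolute value.\<close>
  define f where "f z = fst z + (int k + 1) * snd z" for z :: point
  obtain a where a: "a \<in> X" "\<And>z'. z' \<in> X \<Longrightarrow> f z' \<le> f a" using argmax[of f] by blast
  obtain b where b: "b \<in> X" "\<And>z'. z' \<in> X \<Longrightarrow> f b \<le> f z'" using argmax[of "\<lambda>z. - f z"] by auto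
  have fw: "f w \<noteq> 0" "\<bar>f w\<bar> \<le> 2 * int k + 1" if "w \<in> nbhd k" for w using that by (auto simp: f_def nbhd_def)
  have ca: "card {w\<in>nbhd k. a + w \<in> X} \<le> 2 * k + 1"
    by (rule extreme_point_nbrs[of k 1 "int k + 1"]) (use fw(1) a in \<open>auto simp: f_def\<close>)
  have cb: "card {w\<in>nbhd k. b + w \<in> X} \<le> 2 * k + 1"
  proof (rule extreme_point_nbrs[of k "- 1" "- (int k + 1)"])
    have neg: "- 1 * fst w + - (int k + 1) * snd w = - f w" for w by (simp add: f_def algebra_simps)
    show "- 1 * fst w + - (int k + 1) * snd w \<noteq> 0" if "w \<in> nbhd k" for w
      using fw(1)[OF that] unfolding neg by simp
    show "- 1 * fst z' + - (int k + 1) * snd z' \<le> - 1 * fst b + - (int k + 1) * snd b" if "z' \<in> X" for z'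
      using b(2)[OF that] unfolding neg by simp
  qed
  define d where "d = a - b"
  define h where "h z = snd d * fst z - fst d * snd z" for z :: point
  have hab: "h a = h b" by (simp add: h_def d_def algebra_simps)
  have ab: "a \<noteq> b"
  proof
    assume "a = b"
    then have eq: "f z = f a" if "z \<in> X" for z using a(2)[OF that] b(2)[OF that] by simp
    have none: "{w\<in>nbhd k. a + w \<in> X} = {}"
    proof (rule ccontr)
      assume "{w\<in>nbhd k. a + w \<in> X} \<noteq> {}"
      then obtain w where w: "w \<in> nbhd k" "a + w \<in> X" by blast
      then show False using eq[of "a + w"] fw(1)[of w] by (simp add: f_def algebra_simps)
    qed
    show False using nbrs[OF a(1)] unfolding none by simp
  qed
  have "\<exists>z\<in>X. h z \<noteq> h a"
  proof (rule ccontr)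
    assume "\<not> ?thesis"
    then have line: "h z = h a" if "z \<in> X" for z using that by blast
    \<comment> \<open>A nonhorizontal line meets each of the two adjacent rows at most once, and a
      horizontal one meets neither.\<close>
    have "inj_on snd {w\<in>nbhd k. a + w \<in> X}"
    proof (rule inj_onI)
      fix u v assume u: "u \<in> {w\<in>nbhd k. a + w \<in> X}" and v: "v \<in> {w\<in>nbhd k. a + w \<in> X}" and uv: "snd u = snd v"
      have hu: "snd d * fst u = fst d * snd u" "snd d * fst v = fst d * snd v"
        using line[of "a + u"] line[of "a + v"] u v by (simp_all add: h_def algebra_simps)
      have "snd d \<noteq> 0"
      proof
        assume 0: "snd d = 0"
        then have "fst d \<noteq> 0" using ab by (auto simp: d_def prod_eq_iff)
        then show False using hu(1) 0 u by (auto simp: nbhd_def)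
      qed
      then have "fst u = fst v" using hu uv by (metis mult_left_cancel)
      then show "u = v" using uv by (simp add: prod_eq_iff)
    qed
    then have "card {w\<in>nbhd k. a + w \<in> X} = card (snd ` {w\<in>nbhd k. a + w \<in> X})" by (simp add: card_image)
    also have "\<dots> \<le> card {-1, 1 :: int}" by (rule card_mono) (auto simp: nbhd_def)
    finally show False using nbrs[OF a(1)] by simp
  qed
  then obtain z1 where z1: "z1 \<in> X" "h z1 \<noteq> h a" by blast
  define s :: int where "s = (if h z1 > h a then 1 else -1)"
  have s: "s * h z1 > s * h a" using z1 by (auto simp: s_def)
  \<comment> \<open>\<open>N\<close> exceeds both the oscillation of \<open>f\<close> on
    \<open>X\<close> and the values of \<open>f\<close> on \<open>nbhd k\<close>. Thus
    \<open>g\<close> compares first by \<open>s * h\<close> and then by \<open>f\<close>, its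
    maximiser leaves the line through \<open>a\<close> and \<open>b\<close>, and \<open>g\<close>
    has no zero on \<open>nbhd k\<close>.\<close>
  define N where "N = (f a - f b) + 2 * int k + 2"
  define g where "g z = N * (s * h z) + f z" for z
  obtain c where c: "c \<in> X" "\<And>z'. z' \<in> X \<Longrightarrow> g z' \<le> g c" using argmax[of g] by blast
  have Npos: "N > f a - f b" "N > 2 * int k + 1" using a(2)[OF b(1)] by (auto simp: N_def)
  have "h c \<noteq> h a"
  proof
    assume hc: "h c = h a"
    have "g c \<le> N * (s * h a) + f a" using a(2)[OF c(1)] by (simp add: g_def hc)
    moreover have "N * (s * h a + 1) \<le> N * (s * h z1)" using s Npos by (intro mult_left_mono) auto
    then have "N * (s * h a) + N + f b \<le> g z1" using b(2)[OF z1(1)] by (simp add: g_def algebra_simps)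
    ultimately show False using c(2)[OF z1(1)] Npos by linarith
  qed
  have gw: "(N * s * snd d + 1) * fst w + (int k + 1 - N * s * fst d) * snd w \<noteq> 0" if w: "w \<in> nbhd k" for w
  proof -
    have e: "(N * s * snd d + 1) * fst w + (int k + 1 - N * s * fst d) * snd w = N * (s * h w) + f w"
      by (simp add: h_def f_def algebra_simps)
    show ?thesis
    proof (cases "h w = 0")
      case True then show ?thesis using e fw(1)[OF w] by simp
    next
      case False
      then have "\<bar>s * h w\<bar> \<ge> 1" by (auto simp: s_def abs_mult)
      then have "N * 1 \<le> N * \<bar>s * h w\<bar>" using Npos by (intro mult_left_mono) auto
      then have "\<bar>N * (s * h w)\<bar> \<ge> N" using Npos by (simp add: abs_mult)
      then show ?thesis using e fw(2)[OF w] Npos by linarith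
    qed
  qed
  have cc: "card {w\<in>nbhd k. c + w \<in> X} \<le> 2 * k + 1"
  proof (rule extreme_point_nbrs[OF gw])
    fix z' assume "z' \<in> X"
    then have "g z' \<le> g c" by (rule c(2))
    then show "(N * s * snd d + 1) * fst z' + (int k + 1 - N * s * fst d) * snd z'
      \<le> (N * s * snd d + 1) * fst c + (int k + 1 - N * s * fst d) * snd c"
      by (simp add: g_def h_def f_def algebra_simps)
  qed
  have "c \<noteq> a" "c \<noteq> b" using \<open>h c \<noteq> h a\<close> hab by auto
  then show ?thesis using that[of "{a, b, c}"] a b c ab ca cb cc by auto
qed

section \<open>Switchings in tuples of disjoint perfect matchings\<close>

definition disjoint_tuples :: "'a set \<Rightarrow> 'a set set \<Rightarrow> nat \<Rightarrow> 'a set set list set" where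
  "disjoint_tuples V E r =
     {Ms. length Ms = r \<and> (\<forall>i<r. perfect_matching V (Ms ! i) \<and> Ms ! i \<inter> E = {}) \<and>
          (\<forall>i<r. \<forall>j<r. i \<noteq> j \<longrightarrow> Ms ! i \<inter> Ms ! j = {})}"

lemma matching_tuples_eq: "matching_tuples n k r = disjoint_tuples (torus n) (L_edges n k) r"
  by (simp add: matching_tuples_def disjoint_tuples_def)

lemma finite_disjoint_tuples: assumes "finite V" shows "finite (disjoint_tuples V E r)"
proof (rule finite_subset)
  show "disjoint_tuples V E r \<subseteq> {Ms. set Ms \<subseteq> Pow (Pow V) \<and> length Ms = r}"
    by (auto simp: disjoint_tuples_def perfect_matching_def in_set_conv_nth) blast
  show "finite {Ms. set Ms \<subseteq> Pow (Pow V) \<and> length Ms = r}"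
    using assms by (intro finite_lists_length_eq) auto
qed

lemma perfect_matching_edge_eq:
  assumes "perfect_matching V M" "e \<in> M" "e' \<in> M" "v \<in> e" "v \<in> e'"
  shows "e = e'"
  using assms unfolding perfect_matching_def by (metis subsetD)

lemma perfect_matching_mate:
  assumes "perfect_matching V M" "v \<in> V"
  shows "\<exists>!x. {v, x} \<in> M"
proof -
  obtain e where e: "e \<in> M" "v \<in> e" using assms unfolding perfect_matching_def by metis
  then have "card e = 2" using assms by (simp add: perfect_matching_def)
  then obtain x where x: "e = {v, x}" using e(2) by (auto simp: card_2_iff)
  show ?thesis
  proof
    show "{v, x} \<in> M" using e x by simp
    fix y assume "{v, y} \<in> M"
    then have "{v, y} = {v, x}" using perfect_matching_edge_eq[OF assms(1), of "{v, y}" "{v, x}" v] e x by simp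
    then show "y = x" by (auto simp: doubleton_eq_iff)
  qed
qed

definition mate :: "'a set set \<Rightarrow> 'a \<Rightarrow> 'a" where
  "mate M v = (THE x. {v, x} \<in> M)"

lemma mate:
  assumes "perfect_matching V M" "v \<in> V"
  shows "{v, mate M v} \<in> M" "mate M v \<in> V" "mate M v \<noteq> v" "mate M (mate M v) = v"
    and "\<And>x. {v, x} \<in> M \<Longrightarrow> x = mate M v"
proof -
  show m: "{v, mate M v} \<in> M"
    using theI'[OF perfect_matching_mate[OF assms]] by (simp add: mate_def)
  show "\<And>x. {v, x} \<in> M \<Longrightarrow> x = mate M v" using m perfect_matching_mate[OF assms] by blast
  show V: "mate M v \<in> V" using m assms(1) unfolding perfect_matching_def by auto
  have "card {v, mate M v} = 2" using m assms(1) unfolding perfect_matching_def by blast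
  then show "mate M v \<noteq> v" by auto
  have "{mate M v, v} \<in> M" using m by (simp add: insert_commute)
  moreover have "{mate M v, mate M (mate M v)} \<in> M"
    using theI'[OF perfect_matching_mate[OF assms(1) V]] by (simp add: mate_def)
  ultimately show "mate M (mate M v) = v" using perfect_matching_mate[OF assms(1) V] by blast
qed

lemma perfect_matching_card: assumes "perfect_matching V M" "e \<in> M" shows "card e = 2" "e \<subseteq> V"
  using assms by (auto simp: perfect_matching_def)

lemma perfect_matching_switch:
  assumes M: "perfect_matching V M" and uw: "{u, w} \<in> M" and xy: "{x, y} \<in> M"
    and d: "distinct [u, w, x, y]"
  shows "perfect_matching V (M - {{u, w}, {x, y}} \<union> {{u, x}, {w, y}})" (is "perfect_matching V ?M'")
proof -
  have V: "u \<in> V" "w \<in> V" "x \<in> V" "y \<in> V" using perfect_matching_card(2)[OF M] uw xy by auto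
  have uniq: "e = e'" if "e \<in> M" "e' \<in> M" "v \<in> e" "v \<in> e'" for e e' v
    using perfect_matching_edge_eq[OF M that] .
  show ?thesis
    unfolding perfect_matching_def
  proof (intro conjI ballI)
    fix e assume "e \<in> ?M'"
    then show "e \<subseteq> V" "card e = 2" using perfect_matching_card[OF M] V d by auto
  next
    fix v assume v: "v \<in> V"
    consider "v = u \<or> v = x" | "v = w \<or> v = y" | "v \<notin> {u, w, x, y}" by blast
    then show "\<exists>!e. e \<in> ?M' \<and> v \<in> e"
    proof cases
      case 1
      show ?thesis
      proof (rule ex1I[of _ "{u, x}"])
        show "{u, x} \<in> ?M' \<and> v \<in> {u, x}" using 1 by auto
        fix e assume e: "e \<in> ?M' \<and> v \<in> e"
        then show "e = {u, x}" using 1 d uniq[of e "{u, w}" v] uniq[of e "{x, y}" v] uw xy by auto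
      qed
    next
      case 2
      show ?thesis
      proof (rule ex1I[of _ "{w, y}"])
        show "{w, y} \<in> ?M' \<and> v \<in> {w, y}" using 2 by auto
        fix e assume e: "e \<in> ?M' \<and> v \<in> e"
        then show "e = {w, y}" using 2 d uniq[of e "{u, w}" v] uniq[of e "{x, y}" v] uw xy by auto
      qed
    next
      case 3
      have m: "{v, mate M v} \<in> M" using mate(1)[OF M v] .
      show ?thesis
      proof (rule ex1I[of _ "{v, mate M v}"])
        have "{v, mate M v} \<noteq> {u, w}" "{v, mate M v} \<noteq> {x, y}" using 3 by blast+
        then show "{v, mate M v} \<in> ?M' \<and> v \<in> {v, mate M v}" using m by blast
        fix e assume e: "e \<in> ?M' \<and> v \<in> e"
        then have "e \<in> M" using 3 by blast
        then show "e = {v, mate M v}" using uniq[of e "{v, mate M v}" v] e m by blast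
      qed
    qed
  qed
qed

definition tuples_with :: "'a set \<Rightarrow> 'a set set \<Rightarrow> nat \<Rightarrow> (nat \<times> 'a set) set \<Rightarrow> 'a set set list set" where
  "tuples_with V E r F = {Ms\<in>disjoint_tuples V E r. \<forall>(i, e)\<in>F. e \<in> Ms ! i}"

text \<open>Switching: replacing the edges \<open>uw\<close> and \<open>xy\<close> of a matching by \<open>ux\<close> and \<open>wy\<close> is possible for all but
  few edges \<open>xy\<close>, and the original tuple can be recovered from the new one.\<close>

lemma switching:
  assumes V: "finite V" "u \<in> V" "w \<in> V" and i: "i < r" and F: "finite F" "(i, {u, w}) \<notin> F"
    and D: "\<And>v. v \<in> V \<Longrightarrow> card {x\<in>V. {v, x} \<in> E} \<le> D"
  shows "(card V - (2 + 2 * card F + 2 * (D + r))) * card (tuples_with V E r (insert (i, {u, w}) F))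
      \<le> card (tuples_with V E r F)"
proof -
  let ?T1 = "tuples_with V E r (insert (i, {u, w}) F)" and ?T2 = "tuples_with V E r F"
  \<comment> \<open>The partners that would create an edge of \<open>E\<close> or repeat an edge of
    some matching.\<close>
  define forb where "forb Ms v = {x\<in>V. {v, x} \<in> E \<or> (\<exists>j<r. {v, x} \<in> Ms ! j)}" for Ms v
  \<comment> \<open>The edges prescribed by \<open>F\<close> in the \<open>i\<close>-th matching
    must survive the switching, so \<open>x\<close> must not be an endpoint of one of them.
    Restricting to edges with two elements bounds \<open>Z\<close> by
    \<open>2 * card F\<close>.\<close>
  define Z where "Z = \<Union> {e. (i, e) \<in> F \<and> card e = 2}"
  \<comment> \<open>The choices are vertices \<open>x\<close>, not edges: both orientations of an
    edge \<open>xy\<close> count. Excluding the mates of \<open>forb Ms w\<close> makes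
    \<open>wy\<close> admissible.\<close>
  define X where "X Ms = V - ({u, w} \<union> Z \<union> forb Ms u \<union> mate (Ms ! i) ` forb Ms w)" for Ms
  define sw where "sw = (\<lambda>(Ms, x). Ms[i := Ms ! i - {{u, w}, {x, mate (Ms ! i) x}} \<union> {{u, x}, {w, mate (Ms ! i) x}}])"
  have T: "length Ms = r" "perfect_matching V (Ms ! j)" "Ms ! j \<inter> E = {}"
    "\<And>j'. j' < r \<Longrightarrow> j \<noteq> j' \<Longrightarrow> Ms ! j \<inter> Ms ! j' = {}" if "Ms \<in> disjoint_tuples V E r" "j < r" for Ms j
    using that unfolding disjoint_tuples_def by auto
  have T1: "Ms \<in> disjoint_tuples V E r" "{u, w} \<in> Ms ! i" "\<And>j e. (j, e) \<in> F \<Longrightarrow> e \<in> Ms ! j" if "Ms \<in> ?T1" for Ms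
    using that by (auto simp: tuples_with_def)
  have forb_card: "card (forb Ms v) \<le> D + r" "finite (forb Ms v)" if "Ms \<in> disjoint_tuples V E r" "v \<in> V" for Ms v
  proof -
    have "forb Ms v \<subseteq> {x\<in>V. {v, x} \<in> E} \<union> (\<lambda>j. mate (Ms ! j) v) ` {..<r}"
      using mate(5)[OF T(2)[OF that(1)] that(2)] by (auto simp: forb_def)
    then have "card (forb Ms v) \<le> card ({x\<in>V. {v, x} \<in> E} \<union> (\<lambda>j. mate (Ms ! j) v) ` {..<r})"
      using V(1) by (intro card_mono) auto
    also have "\<dots> \<le> card {x\<in>V. {v, x} \<in> E} + card ((\<lambda>j. mate (Ms ! j) v) ` {..<r})" by (rule card_Un_le)
    also have "\<dots> \<le> D + r" using D[OF that(2)] card_image_le[of "{..<r}" "\<lambda>j. mate (Ms ! j) v"] by simp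
    finally show "card (forb Ms v) \<le> D + r" .
    show "finite (forb Ms v)" using V(1) by (simp add: forb_def)
  qed
  have Zfin: "finite Z" and Zcard: "card Z \<le> 2 * card F"
  proof -
    have eq: "{e. (i, e) \<in> F \<and> card e = 2} \<subseteq> snd ` F" by force
    then have fin: "finite {e. (i, e) \<in> F \<and> card e = 2}" using F(1) finite_subset by blast
    show "finite Z" unfolding Z_def by (rule finite_Union[OF fin]) (auto intro: card_ge_0_finite)
    have "card Z \<le> (\<Sum>e\<in>{e. (i, e) \<in> F \<and> card e = 2}. card e)" unfolding Z_def
      using card_UN_le[OF fin, of "\<lambda>x. x"] by simp
    also have "\<dots> = 2 * card {e. (i, e) \<in> F \<and> card e = 2}" by simp
    also have "card {e. (i, e) \<in> F \<and> card e = 2} \<le> card (snd ` F)" using eq F(1) by (intro card_mono) auto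
    also have "card (snd ` F) \<le> card F" using F(1) by (rule card_image_le)
    finally show "card Z \<le> 2 * card F" by simp
  qed
  have Xcard: "card V - (2 + 2 * card F + 2 * (D + r)) \<le> card (X Ms)" if "Ms \<in> ?T1" for Ms
  proof -
    note fu = forb_card[OF T1(1)[OF that] V(2)] and fw = forb_card[OF T1(1)[OF that] V(3)]
    let ?B = "{u, w} \<union> Z \<union> forb Ms u \<union> mate (Ms ! i) ` forb Ms w"
    have "card ?B \<le> card {u, w} + card Z + card (forb Ms u) + card (mate (Ms ! i) ` forb Ms w)"
      by (meson add_le_mono1 card_Un_le order_trans)
    moreover have "card {u, w} \<le> 2" by (simp add: card_insert_if)
    moreover have "card (mate (Ms ! i) ` forb Ms w) \<le> D + r" using card_image_le[OF fw(2)] fw(1) order_trans by blast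
    moreover have "b \<le> 2 + 2 * f + 2 * (D + r)" if "b \<le> c1 + c2 + c3 + c4" "c1 \<le> 2" "c4 \<le> D + r" "c2 \<le> 2 * f" "c3 \<le> D + r"
      for b c1 c2 c3 c4 f :: nat using that by (simp add: algebra_simps)
    ultimately have "card ?B \<le> 2 + 2 * card F + 2 * (D + r)" using Zcard fu(1) by blast
    moreover have "card V - card ?B \<le> card (X Ms)"
      unfolding X_def using Zfin fu fw by (intro diff_card_le_card_Diff) auto
    ultimately show ?thesis by linarith
  qed
  have main: "sw (Ms, x) \<in> ?T2 \<and> perfect_matching V (sw (Ms, x) ! i) \<and> {u, x} \<in> sw (Ms, x) ! i \<and>
      {w, mate (Ms ! i) x} \<in> sw (Ms, x) ! i \<and>
      Ms ! i = sw (Ms, x) ! i - {{u, x}, {w, mate (Ms ! i) x}} \<union> {{u, w}, {x, mate (Ms ! i) x}}"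
    if Ms: "Ms \<in> ?T1" and x: "x \<in> X Ms" for Ms x
  proof -
    define M where "M = Ms ! i"
    define y where "y = mate M x"
    define M' where "M' = M - {{u, w}, {x, y}} \<union> {{u, x}, {w, y}}"
    have xV: "x \<in> V" using x by (auto simp: X_def)
    note dt = T1(1)[OF Ms]
    have M: "perfect_matching V M" using T(2)[OF dt i] by (simp add: M_def)
    have uwM: "{u, w} \<in> M" using T1(2)[OF Ms] by (simp add: M_def)
    have xyM: "{x, y} \<in> M" using mate(1)[OF M xV] by (simp add: y_def)
    have yV: "y \<in> V" using mate(2)[OF M xV] by (simp add: y_def)
    have xmy: "x = mate M y" using mate(4)[OF M xV] by (simp add: y_def)
    have xn: "x \<notin> forb Ms u" using x by (auto simp: X_def)
    have yn: "y \<notin> forb Ms w" using x xmy by (auto simp: X_def M_def)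
    have "u \<noteq> w" using perfect_matching_card(1)[OF M uwM] by auto
    moreover have "x \<noteq> y" using mate(3)[OF M xV] by (simp add: y_def)
    moreover have "x \<noteq> u" "x \<noteq> w" using x by (auto simp: X_def)
    moreover have "{u, w} \<noteq> {x, y}" using \<open>x \<noteq> u\<close> \<open>x \<noteq> w\<close> by auto
    then have "y \<noteq> u" "y \<noteq> w" using perfect_matching_edge_eq[OF M uwM xyM] by auto
    ultimately have dist: "distinct [u, w, x, y]" by auto
    have M': "perfect_matching V M'" unfolding M'_def by (rule perfect_matching_switch[OF M uwM xyM dist])
    have new: "{u, x} \<notin> E" "\<And>j. j < r \<Longrightarrow> {u, x} \<notin> Ms ! j" "{w, y} \<notin> E" "\<And>j. j < r \<Longrightarrow> {w, y} \<notin> Ms ! j"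
      using xn yn xV yV by (auto simp: forb_def)
    have sw: "sw (Ms, x) = Ms[i := M']" by (simp add: sw_def M'_def M_def y_def)
    have len: "length Ms = r" using T(1)[OF dt i] .
    have swi: "sw (Ms, x) ! i = M'" using len i by (simp add: sw)
    have swj: "sw (Ms, x) ! j = (if j = i then M' else Ms ! j)" for j using len i by (simp add: sw)
    have M'sub: "M' \<subseteq> M \<union> {{u, x}, {w, y}}" by (auto simp: M'_def)
    have ME: "M \<inter> E = {}" and MM: "\<And>j. j < r \<Longrightarrow> j \<noteq> i \<Longrightarrow> M \<inter> Ms ! j = {}"
      using T(3)[OF dt i] T(4)[OF dt i] by (auto simp: M_def)
    have M'E: "M' \<inter> E = {}" using M'sub ME new(1,3) by blast
    have M'M: "M' \<inter> Ms ! j = {}" if "j < r" "j \<noteq> i" for j using M'sub MM[OF that] new(2,4)[OF that(1)] by blast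
    have inD: "sw (Ms, x) \<in> disjoint_tuples V E r"
      unfolding disjoint_tuples_def mem_Collect_eq
    proof (intro conjI allI impI)
      show "length (sw (Ms, x)) = r" using len by (simp add: sw)
      fix j assume "j < r"
      then show "perfect_matching V (sw (Ms, x) ! j)" "sw (Ms, x) ! j \<inter> E = {}"
        using M' M'E T(2,3)[OF dt] by (auto simp: swj)
      fix j' assume "j' < r" "j \<noteq> j'"
      then show "sw (Ms, x) ! j \<inter> sw (Ms, x) ! j' = {}"
        using M'M[of j] M'M[of j'] T(4)[OF dt \<open>j < r\<close>] \<open>j < r\<close> by (auto simp: swj)
    qed
    have keep: "e \<in> sw (Ms, x) ! j" if je: "(j, e) \<in> F" for j e
    proof (cases "j = i")
      case False then show ?thesis using T1(3)[OF Ms je] by (simp add: swj)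
    next
      case True
      then have eM: "e \<in> M" using T1(3)[OF Ms je] by (simp add: M_def)
      have "e \<noteq> {u, w}" using je F(2) True by auto
      moreover have "e \<noteq> {x, y}"
      proof
        assume "e = {x, y}"
        then have "x \<in> Z" using je True perfect_matching_card(1)[OF M eM] by (auto simp: Z_def)
        then show False using x by (auto simp: X_def)
      qed
      ultimately show ?thesis using eM True by (simp add: swi M'_def)
    qed
    have "M = M' - {{u, x}, {w, y}} \<union> {{u, w}, {x, y}}"
      using uwM xyM new(2,4)[OF i] dist unfolding M'_def M_def by (auto simp: doubleton_eq_iff)
    moreover have "{u, x} \<in> M'" "{w, y} \<in> M'" by (auto simp: M'_def)
    moreover have "sw (Ms, x) \<in> ?T2" unfolding tuples_with_def using inD keep by blast
    ultimately show ?thesis using M' unfolding swi M_def[symmetric] y_def[symmetric] by (intro conjI)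
  qed
  \<comment> \<open>In the switched matching \<open>x\<close> is the mate of \<open>u\<close> and
    \<open>y\<close> the mate of \<open>w\<close>; this determines which edges to switch
    back.\<close>
  have inj: "inj_on sw (Sigma ?T1 X)"
  proof (rule inj_onI)
    fix a b assume a: "a \<in> Sigma ?T1 X" and b: "b \<in> Sigma ?T1 X" and eq: "sw a = sw b"
    obtain Ms x Ns y where ab: "a = (Ms, x)" "b = (Ns, y)" by (cases a; cases b)
    have Ms: "Ms \<in> ?T1" "x \<in> X Ms" and Ns: "Ns \<in> ?T1" "y \<in> X Ns" using a b by (auto simp: ab)
    note mM = main[OF Ms] and mN = main[OF Ns]
    have eq': "sw (Ms, x) = sw (Ns, y)" using eq ab by simp
    have "x = y" using mM mN mate(5)[of V "sw (Ms, x) ! i" u] V(2) unfolding eq' by metis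
    moreover have "mate (Ms ! i) x = mate (Ns ! i) y" using mM mN mate(5)[of V "sw (Ms, x) ! i" w] V(3) unfolding eq' by metis
    ultimately have "Ms ! i = Ns ! i" using mM mN unfolding eq' by metis
    have "Ms = (sw (Ms, x))[i := Ms ! i]" "Ns = (sw (Ns, y))[i := Ns ! i]" by (simp_all add: sw_def)
    then have "Ms = Ns" using eq' \<open>Ms ! i = Ns ! i\<close> by metis
    then show "a = b" using \<open>x = y\<close> ab by simp
  qed
  have fin: "finite ?T1" "finite ?T2" using finite_disjoint_tuples[OF V(1)] by (auto simp: tuples_with_def)
  have Xfin: "finite (X Ms)" for Ms using V(1) by (simp add: X_def)
  have "(card V - (2 + 2 * card F + 2 * (D + r))) * card ?T1 = (\<Sum>Ms\<in>?T1. card V - (2 + 2 * card F + 2 * (D + r)))"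
    by simp
  also have "\<dots> \<le> (\<Sum>Ms\<in>?T1. card (X Ms))" by (rule sum_mono) (rule Xcard)
  also have "\<dots> = card (Sigma ?T1 X)" using fin Xfin by simp
  also have "\<dots> = card (sw ` Sigma ?T1 X)" using inj by (simp add: card_image)
  also have "\<dots> \<le> card ?T2" using fin main by (intro card_mono) auto
  finally show ?thesis .
qed

text \<open>Reveal the partner in \<open>Y\<close> of one vertex of \<open>Q\<close> and the
  matching it is in: there are \<open>r * card Y\<close> choices, and by switching each holds for a
  fraction of at most 2 / |V| of the tuples, which gives one factor \<open>\<kappa>\<close>. An edge
  uses up at most two vertices of \<open>Q\<close>, so about half of \<open>card Q\<close> factors
  appear. The revealed edges accumulate in \<open>F\<close>, and \<open>f\<close> bounds the total
  amount of data throughout the induction.\<close>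

lemma cover_count:
  fixes \<kappa> :: real
  assumes V: "finite V" and D: "\<And>v. v \<in> V \<Longrightarrow> card {x\<in>V. {v, x} \<in> E} \<le> D"
    and Y: "Y \<subseteq> V" and small: "4 + 4 * f + 4 * (D + r) \<le> card V"
    and \<kappa>: "\<kappa> = 2 * real r * real (card Y) / real (card V)" "\<kappa> \<le> 1"
    and Q: "Q \<subseteq> V" and F: "finite F" "\<And>i e. (i, e) \<in> F \<Longrightarrow> e \<inter> Q = {}" "card F + card Q \<le> f"
  shows "real (card {Ms\<in>tuples_with V E r F. \<forall>u\<in>Q. \<exists>i<r. \<exists>w\<in>Y. {u, w} \<in> Ms ! i})
    \<le> \<kappa> ^ ((card Q + 1) div 2) * real (card (tuples_with V E r F))"
  using Q F
proof (induction "card Q" arbitrary: Q F rule: less_induct)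
  case less
  have finQ: "finite Q" using less.prems(1) V finite_subset by blast
  have fin: "finite (tuples_with V E r G)" for G using finite_disjoint_tuples[OF V(1)] by (auto simp: tuples_with_def)
  have Vpos: "card V > 0" using small by linarith
  have \<kappa>0: "\<kappa> \<ge> 0" using \<kappa>(1) by simp
  show ?case
  proof (cases "Q = {}")
    case True then show ?thesis by simp
  next
    case False
    then obtain u where u: "u \<in> Q" by blast
    define S where "S G P = {Ms\<in>tuples_with V E r G. \<forall>u\<in>P. \<exists>i<r. \<exists>w\<in>Y. {u, w} \<in> Ms ! i}" for G P
    have sub: "S F Q \<subseteq> (\<Union>(i, w)\<in>{..<r} \<times> Y. if w = u then {} else S (insert (i, {u, w}) F) (Q - {u, w}))"
    proof
      fix Ms assume Ms: "Ms \<in> S F Q"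
      then obtain i w where iw: "i < r" "w \<in> Y" "{u, w} \<in> Ms ! i" using u unfolding S_def by blast
      have "Ms \<in> disjoint_tuples V E r" using Ms by (simp add: S_def tuples_with_def)
      then have "perfect_matching V (Ms ! i)" using iw(1) by (simp add: disjoint_tuples_def)
      then have "w \<noteq> u" using perfect_matching_card(1)[OF _ iw(3)] by fastforce
      moreover have "Ms \<in> S (insert (i, {u, w}) F) (Q - {u, w})"
        using Ms iw by (auto simp: S_def tuples_with_def)
      ultimately show "Ms \<in> (\<Union>(i, w)\<in>{..<r} \<times> Y. if w = u then {} else S (insert (i, {u, w}) F) (Q - {u, w}))"
        using iw by auto
    qed
    define N where "N = real (card (tuples_with V E r F))"
    define p where "p = \<kappa> ^ ((card Q - 2 + 1) div 2)"
    have each: "real (card (S (insert (i, {u, w}) F) (Q - {u, w}))) \<le> p * (2 / real (card V) * N)"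
      if iw: "i < r" "w \<in> Y" "w \<noteq> u" for i w
    proof -
      have uV: "u \<in> V" using u less.prems by blast
      have wV: "w \<in> V" using iw Y by blast
      have new: "(i, {u, w}) \<notin> F" using less.prems(3)[of i "{u, w}"] u by blast
      have lt: "card (Q - {u, w}) < card Q" using u finQ by (intro psubset_card_mono) auto
      have "card (insert (i, {u, w}) F) + card (Q - {u, w}) \<le> f"
        using lt less.prems(2,4) new by simp
      moreover have "e \<inter> (Q - {u, w}) = {}" if "(j, e) \<in> insert (i, {u, w}) F" for j e
        using that less.prems(3) by auto
      ultimately have "real (card (S (insert (i, {u, w}) F) (Q - {u, w})))
          \<le> \<kappa> ^ ((card (Q - {u, w}) + 1) div 2) * real (card (tuples_with V E r (insert (i, {u, w}) F)))"
        unfolding S_def using less.prems by (intro less.hyps[OF lt]) auto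
      also have "\<dots> \<le> p * (2 / real (card V) * N)"
      proof (rule mult_mono)
        have "card Q - card {u, w} \<le> card (Q - {u, w})" by (rule diff_card_le_card_Diff) simp
        then have "card Q - 2 \<le> card (Q - {u, w})" using iw(3) by simp
        then have "(card Q - 2 + 1) div 2 \<le> (card (Q - {u, w}) + 1) div 2" by (intro div_le_mono) simp
        then show "\<kappa> ^ ((card (Q - {u, w}) + 1) div 2) \<le> p"
          unfolding p_def using \<kappa>0 \<kappa>(2) by (intro power_decreasing)
        have "(card V - (2 + 2 * card F + 2 * (D + r))) * card (tuples_with V E r (insert (i, {u, w}) F))
            \<le> card (tuples_with V E r F)"
          by (rule switching[OF V uV wV iw(1) less.prems(2) new D])
        \<comment> \<open>By \<open>small\<close> at least half of the vertices admit a switching,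
          whence the constant 2 in \<open>\<kappa>\<close>.\<close>
        moreover have "card V \<le> 2 * (card V - (2 + 2 * card F + 2 * (D + r)))"
          using small less.prems(4) by linarith
        then have "card V * card (tuples_with V E r (insert (i, {u, w}) F))
            \<le> 2 * (card V - (2 + 2 * card F + 2 * (D + r))) * card (tuples_with V E r (insert (i, {u, w}) F))"
          by (rule mult_right_mono) simp
        moreover have "2 * a * b \<le> 2 * c" if "a * b \<le> c" for a b c :: nat
          using that by simp
        ultimately have "card V * card (tuples_with V E r (insert (i, {u, w}) F)) \<le> 2 * card (tuples_with V E r F)"
          by (meson order_trans)
        then have "real (card V) * real (card (tuples_with V E r (insert (i, {u, w}) F))) \<le> 2 * N"
          unfolding N_def by (metis of_nat_le_iff of_nat_mult of_nat_numeral)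
        then show "real (card (tuples_with V E r (insert (i, {u, w}) F))) \<le> 2 / real (card V) * N"
          using Vpos by (simp add: field_simps)
      qed (use \<kappa>0 in \<open>auto simp: p_def\<close>)
      finally show ?thesis .
    qed
    have finY: "finite Y" using Y V finite_subset by blast
    have finS: "finite (S G P)" for G P using fin by (simp add: S_def)
    have "real (card (S F Q)) \<le> real (card (\<Union>(i, w)\<in>{..<r} \<times> Y. if w = u then {} else S (insert (i, {u, w}) F) (Q - {u, w})))"
      using sub finS finY by (intro of_nat_mono card_mono) auto
    also have "\<dots> \<le> (\<Sum>(i, w)\<in>{..<r} \<times> Y. real (card (if w = u then {} else S (insert (i, {u, w}) F) (Q - {u, w}))))"
      using card_UN_le[of "{..<r} \<times> Y" "\<lambda>(i, w). if w = u then {} else S (insert (i, {u, w}) F) (Q - {u, w})"] finY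
      by (simp add: case_prod_unfold flip: of_nat_sum)
    also have "\<dots> \<le> (\<Sum>(i, w)\<in>{..<r} \<times> Y. p * (2 / real (card V) * N))"
    proof (rule sum_mono)
      fix a assume "a \<in> {..<r} \<times> Y"
      moreover have "0 \<le> p * (2 / real (card V) * N)" using \<kappa>0 by (auto simp: p_def N_def)
      ultimately show "(case a of (i, w) \<Rightarrow> real (card (if w = u then {} else S (insert (i, {u, w}) F) (Q - {u, w}))))
          \<le> (case a of (i, w) \<Rightarrow> p * (2 / real (card V) * N))"
        using each by (auto split: prod.splits)
    qed
    also have "\<dots> = \<kappa> * p * N" using \<kappa>(1) by (simp add: card_cartesian_product)
    \<comment> \<open>Truncated subtraction is correct here: a single remaining vertex still
      requires a whole edge, and then \<open>card Q - 2\<close> is 0.\<close>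
    also have "\<kappa> * p = \<kappa> ^ ((card Q + 1) div 2)"
    proof -
      have "card Q > 0" using u finQ card_gt_0_iff by blast
      then have "(card Q + 1) div 2 = Suc ((card Q - 2 + 1) div 2)" by (cases "card Q = 1") auto
      then show ?thesis by (simp add: p_def)
    qed
    finally show ?thesis unfolding S_def N_def .
  qed
qed

section \<open>Sets that are linked to themselves\<close>

text \<open>In the application \<open>\<T>\<close> is the family of islands and \<open>U\<close> the
  set of vertices that stay inactive; the triples are the extreme points in each island.\<close>

definition self_linked :: "'a set set \<Rightarrow> nat \<Rightarrow> 'a set set list \<Rightarrow> bool" where
  "self_linked \<T> r Ms \<longleftrightarrow> (\<exists>U. U \<noteq> {} \<and> U \<subseteq> \<Union>\<T> \<and>
     (\<forall>T\<in>\<T>. U \<inter> T \<noteq> {} \<longrightarrow> (\<exists>Y. Y \<subseteq> U \<inter> T \<and> card Y = 3 \<and> (\<forall>u\<in>Y. \<exists>i<r. \<exists>w\<in>U. {u, w} \<in> Ms ! i))))"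

text \<open>Passes from the arbitrary set \<open>U\<close> to data that can be enumerated: the
  subfamily \<open>\<S>\<close> of members met by \<open>U\<close> and one triple in each of them.
  The partners are only remembered to lie in the union of \<open>\<S>\<close>.\<close>

lemma self_linked_witness:
  assumes "self_linked \<T> r Ms"
  shows "\<exists>\<S>\<in>Pow \<T> - {{}}. \<exists>c\<in>(\<Pi>\<^sub>E T\<in>\<S>. {Y. Y \<subseteq> T \<and> card Y = 3}).
    \<forall>u\<in>(\<Union>T\<in>\<S>. c T). \<exists>i<r. \<exists>w\<in>\<Union>\<S>. {u, w} \<in> Ms ! i"
proof -
  obtain U where U: "U \<noteq> {}" "U \<subseteq> \<Union>\<T>"
    "\<forall>T\<in>\<T>. U \<inter> T \<noteq> {} \<longrightarrow> (\<exists>Y. Y \<subseteq> U \<inter> T \<and> card Y = 3 \<and> (\<forall>u\<in>Y. \<exists>i<r. \<exists>w\<in>U. {u, w} \<in> Ms ! i))"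
    using assms unfolding self_linked_def by (elim exE conjE)
  define \<S> where "\<S> = {T\<in>\<T>. U \<inter> T \<noteq> {}}"
  have ex: "\<forall>T\<in>\<S>. \<exists>Y. Y \<subseteq> U \<inter> T \<and> card Y = 3 \<and> (\<forall>u\<in>Y. \<exists>i<r. \<exists>w\<in>U. {u, w} \<in> Ms ! i)"
    using U(3) unfolding \<S>_def by simp
  obtain c where c: "\<forall>T\<in>\<S>. c T \<subseteq> U \<inter> T \<and> card (c T) = 3 \<and> (\<forall>u\<in>c T. \<exists>i<r. \<exists>w\<in>U. {u, w} \<in> Ms ! i)"
    by (rule exE[OF bchoice[OF ex]]) (rule that)
  have US: "U \<subseteq> \<Union>\<S>" using U(2) unfolding \<S>_def by blast
  have 1: "\<S> \<in> Pow \<T> - {{}}" using U(1) US unfolding \<S>_def by blast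
  have 2: "restrict c \<S> \<in> (\<Pi>\<^sub>E T\<in>\<S>. {Y. Y \<subseteq> T \<and> card Y = 3})" using c by auto
  have 3: "\<forall>u\<in>(\<Union>T\<in>\<S>. restrict c \<S> T). \<exists>i<r. \<exists>w\<in>\<Union>\<S>. {u, w} \<in> Ms ! i"
  proof
    fix u assume "u \<in> (\<Union>T\<in>\<S>. restrict c \<S> T)"
    then obtain T where "T \<in> \<S>" "u \<in> c T" by auto
    then obtain i w where "i < r" "w \<in> U" "{u, w} \<in> Ms ! i" using c by blast
    then show "\<exists>i<r. \<exists>w\<in>\<Union>\<S>. {u, w} \<in> Ms ! i" using US by blast
  qed
  show ?thesis by (rule bexI[OF _ 1], rule bexI[OF _ 2], rule 3)
qed

text \<open>Exponential moment bound for a coefficient of the product of the factors 1 + z f(x),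
  which is at most exp(z B). The choice z = s / B is optimal.\<close>

lemma elementary_symmetric_bound:
  fixes f :: "'a \<Rightarrow> real"
  assumes A: "finite A" and f: "\<And>x. x \<in> A \<Longrightarrow> f x \<ge> 0" and B: "sum f A \<le> B" "B > 0" and s: "s \<ge> 1"
  shows "(\<Sum>X\<in>{X\<in>Pow A. card X = s}. prod f X) \<le> (exp 1 * B / real s) ^ s"
proof -
  define z where "z = real s / B"
  have z: "z > 0" using B s by (simp add: z_def)
  have "z ^ s * (\<Sum>X\<in>{X\<in>Pow A. card X = s}. prod f X) = (\<Sum>X\<in>{X\<in>Pow A. card X = s}. \<Prod>x\<in>X. z * f x)"
    unfolding sum_distrib_left by (rule sum.cong) (auto simp: prod.distrib)
  also have "\<dots> \<le> (\<Sum>X\<in>Pow A. \<Prod>x\<in>X. z * f x)"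
  proof (rule sum_mono2)
    show "0 \<le> (\<Prod>x\<in>X. z * f x)" if "X \<in> Pow A - {X\<in>Pow A. card X = s}" for X
      using that z f by (intro prod_nonneg) auto
  qed (use A in auto)
  also have "\<dots> = (\<Prod>x\<in>A. z * f x + 1)" using prod_add[OF A, of "\<lambda>x. z * f x" "\<lambda>_. 1"] by simp
  also have "\<dots> \<le> (\<Prod>x\<in>A. exp (z * f x))"
  proof (rule prod_mono)
    fix x assume "x \<in> A"
    then show "0 \<le> z * f x + 1 \<and> z * f x + 1 \<le> exp (z * f x)"
      using z f[of x] exp_ge_add_one_self[of "z * f x"] by (simp add: add.commute)
  qed
  also have "\<dots> = exp (z * sum f A)" using A by (simp add: exp_sum sum_distrib_left)
  also have "\<dots> \<le> exp (z * B)" using z B by simp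
  also have "\<dots> = exp 1 ^ s" using B by (simp add: z_def exp_of_nat_mult[symmetric])
  finally have "z ^ s * (\<Sum>X\<in>{X\<in>Pow A. card X = s}. prod f X) \<le> exp 1 ^ s" .
  then have "(\<Sum>X\<in>{X\<in>Pow A. card X = s}. prod f X) \<le> exp 1 ^ s / z ^ s"
    using z by (simp add: field_simps)
  also have "\<dots> = (exp 1 * B / real s) ^ s" by (simp add: z_def power_divide[symmetric])
  finally show ?thesis .
qed

text \<open>Splits sizes at the level \<open>l\<close>: the larger ones are paid by the fourth
  moment.\<close>

lemma le_add_fourth_power:
  fixes t l :: real assumes "t \<ge> 0" "l > 0" shows "t \<le> l + t ^ 4 / l ^ 3"
proof (cases "t \<le> l")
  case True
  have "0 \<le> t ^ 4 / l ^ 3" using assms by simp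
  then show ?thesis using True by linarith
next
  case False
  then have "l ^ 3 \<le> t ^ 3" using assms by (intro power_mono) auto
  then have "t * l ^ 3 \<le> t * t ^ 3" using assms by (intro mult_left_mono) auto
  also have "t * t ^ 3 = t ^ 4" by (simp add: eval_nat_numeral)
  finally have "t \<le> t ^ 4 / l ^ 3" using assms by (simp add: field_simps)
  then show ?thesis using assms by simp
qed

text \<open>The level \<open>l\<close> makes both terms of the bound on \<open>Y\<close> equal,
  \<open>l ^ 4 = \<mu> * N / s\<close>. With \<open>a ^ 8 = s / N\<close> and
  \<open>b ^ 8 = \<mu>\<close> the two factors per island are of order \<open>(b / a) ^ 8\<close>
  and, from three halves of an edge, \<open>r powr (3 / 2) * a ^ 9 * b ^ 3\<close>; a factor
  \<open>a\<close> is left over.\<close>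

lemma self_linked_term_bound:
  fixes N :: real
  assumes N: "N > 0" and r: "r \<ge> 1" and s: "s \<ge> 1" and Y0: "0 \<le> Y"
    and Y: "Y \<le> real s * l + \<mu> * N / l ^ 3" and l: "l = (root 8 \<mu>)\<^sup>2 / (root 8 (real s / N))\<^sup>2"
    and \<mu>: "\<mu> = 1 / (10 ^ 4 * (real r)\<^sup>2)" and sN: "real s \<le> \<mu> * N"
  shows "2 * real r * Y / N \<le> 1"
    and "(exp 1 * (\<mu> * N) / real s) ^ s * (2 * real r * Y / N) ^ ((3 * s + 1) div 2) \<le> root 8 (1 / N) * (1 / 4) ^ s"
proof -
  define a where "a = root 8 (real s / N)"
  define b where "b = root 8 \<mu>"
  define q where "q = 2 * sqrt (real r) * a ^ 3 * b"
  have \<mu>0: "\<mu> > 0" using r by (simp add: \<mu>)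
  have a: "a > 0" "a ^ 8 = real s / N" using N s by (auto simp: a_def)
  have b: "b > 0" "b ^ 8 = \<mu>" using \<mu>0 by (auto simp: b_def)
  have ab: "a \<le> b" using sN N unfolding a_def b_def by (intro real_root_le_mono) (auto simp: field_simps)
  have "sqrt (real r) ^ 4 = (real r)\<^sup>2" using power_mult[of "sqrt (real r)" 2 2] by simp
  then have "(b\<^sup>2 * sqrt (real r)) ^ 4 = b ^ 8 * (real r)\<^sup>2" by (simp add: power_mult_distrib power_mult[symmetric])
  also have "\<dots> = (1 / 10) ^ 4" using r by (simp add: b \<mu> field_simps)
  \<comment> \<open>The value of \<open>\<mu>\<close> is chosen for this identity; it absorbs all
    powers of \<open>r\<close>.\<close>
  finally have br: "b\<^sup>2 * sqrt (real r) = 1 / 10"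
    using b(1) by (subst (asm) power_eq_iff_eq_base) auto
  have b1: "b \<le> 1"
  proof -
    have "1 \<le> (real r)\<^sup>2" using r by simp
    then have "1 * 1 \<le> 10 ^ 4 * (real r)\<^sup>2" by (intro mult_mono) auto
    then have "b ^ 8 \<le> 1 ^ 8" using r unfolding b \<mu> by (simp add: divide_le_eq)
    then show ?thesis using b(1) by (subst (asm) power_mono_iff) auto
  qed
  have l': "l = b\<^sup>2 / a\<^sup>2" by (simp add: l a_def b_def)
  have sa: "real s = N * a ^ 8" using a N by (simp add: field_simps)
  have "real s * l + \<mu> * N / l ^ 3 = 2 * N * a ^ 6 * b\<^sup>2"
    unfolding sa l' b(2)[symmetric] using a(1) b(1) N by (simp add: field_simps eval_nat_numeral)
  then have YN: "Y \<le> 2 * N * a ^ 6 * b\<^sup>2" using Y by simp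
  have "2 * real r * Y / N \<le> 2 * real r * (2 * N * a ^ 6 * b\<^sup>2) / N"
    using YN N by (intro divide_right_mono mult_left_mono) auto
  also have "\<dots> = 4 * real r * a ^ 6 * b\<^sup>2" using N by simp
  also have "\<dots> = q\<^sup>2" unfolding q_def power_mult_distrib by (simp add: power_mult[symmetric])
  finally have kq: "2 * real r * Y / N \<le> q\<^sup>2" .
  have q0: "q \<ge> 0" using a b by (simp add: q_def)
  have q1: "q \<le> 1"
  proof -
    have "a ^ 3 * b \<le> b ^ 3 * b" using ab a b by (intro mult_right_mono power_mono) auto
    also have "\<dots> = b\<^sup>2 * b\<^sup>2" by (simp add: eval_nat_numeral)
    also have "\<dots> \<le> b\<^sup>2 * 1" using b1 b by (intro mult_left_mono) (auto simp: power_le_one)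
    finally have "q \<le> 2 * (sqrt (real r) * b\<^sup>2)" unfolding q_def by (simp add: mult.assoc mult_left_mono)
    then show ?thesis using br by (simp add: mult.commute)
  qed
  have "q\<^sup>2 \<le> 1" using q0 q1 by (simp add: power_le_one)
  then show "2 * real r * Y / N \<le> 1" using kq by linarith
  have "(2 * real r * Y / N) ^ ((3 * s + 1) div 2) \<le> (q\<^sup>2) ^ ((3 * s + 1) div 2)"
    using kq Y0 N by (intro power_mono) auto
  also have "\<dots> = q ^ (2 * ((3 * s + 1) div 2))" by (simp add: power_mult)
  also have "\<dots> \<le> q ^ (3 * s)" using q0 q1 by (intro power_decreasing) auto
  also have "\<dots> = (q ^ 3) ^ s" by (simp add: power_mult)
  finally have kap: "(2 * real r * Y / N) ^ ((3 * s + 1) div 2) \<le> (q ^ 3) ^ s" .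
  have "exp 1 * (\<mu> * N) / real s = exp 1 * (b ^ 8 / a ^ 8)" using N a by (simp add: sa b(2))
  then have "(exp 1 * (\<mu> * N) / real s) ^ s * (2 * real r * Y / N) ^ ((3 * s + 1) div 2)
      \<le> (exp 1 * (b ^ 8 / a ^ 8)) ^ s * (q ^ 3) ^ s"
    using kap a(1) b(1) Y0 N by (intro mult_mono) (auto intro!: zero_le_power divide_nonneg_pos mult_nonneg_nonneg)
  also have "\<dots> = (exp 1 * (b ^ 8 / a ^ 8) * q ^ 3) ^ s" by (simp only: power_mult_distrib)
  also have "exp 1 * (b ^ 8 / a ^ 8) * q ^ 3 = 8 * exp 1 * (b\<^sup>2 * sqrt (real r)) ^ 3 * a * b ^ 5"
    unfolding q_def power_mult_distrib using a(1) b(1) by (simp add: field_simps eval_nat_numeral)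
  also have "\<dots> = (8 * exp 1 / 1000) * (a * b ^ 5)" unfolding br by (simp add: power_divide)
  also have "((8 * exp 1 / 1000) * (a * b ^ 5)) ^ s \<le> (1 / 8 * a) ^ s"
  proof (rule power_mono)
    have "exp 1 \<le> (3 :: real)" using exp_le by simp
    then have "8 * exp 1 / 1000 \<le> (1 / 8 :: real)" by simp
    moreover have "a * b ^ 5 \<le> a * 1" using a b b1 by (intro mult_left_mono) (auto simp: power_le_one)
    ultimately show "(8 * exp 1 / 1000) * (a * b ^ 5) \<le> 1 / 8 * a" using a b by (intro mult_mono) auto
  qed (use a b in auto)
  also have "\<dots> = (1 / 8) ^ s * a ^ s" by (simp only: power_mult_distrib)
  \<comment> \<open>One factor \<open>a\<close> is kept to provide the eighth root of 1 / N, and the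
    geometric factor makes the sum over \<open>s\<close> converge.\<close>
  also have "\<dots> \<le> (1 / 8) ^ s * a ^ 1"
    using a s ab b1 by (intro mult_left_mono power_decreasing) auto
  also have "a \<le> real s * root 8 (1 / N)"
  proof -
    have "a = root 8 (real s) * root 8 (1 / N)" by (simp add: a_def real_root_divide)
    moreover have "root 8 (real s) \<le> real s"
    proof -
      have "real s \<le> real s ^ 8" using s by (simp add: self_le_power)
      then have "root 8 (real s) \<le> root 8 (real s ^ 8)" by simp
      then show ?thesis by (simp add: real_root_power_cancel)
    qed
    ultimately show ?thesis using N by (simp add: mult_right_mono)
  qed
  also have "(1 / 8) ^ s * (real s * root 8 (1 / N)) ^ 1 \<le> (1 / 8) ^ s * (2 ^ s * root 8 (1 / N))"
  proof -
    have "real s \<le> 2 ^ s" using less_exp[of s] by (metis less_imp_le of_nat_le_iff of_nat_numeral of_nat_power)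
    then show ?thesis using N by (intro mult_left_mono) (auto intro: mult_right_mono)
  qed
  also have "\<dots> = root 8 (1 / N) * ((1 / 8) ^ s * 2 ^ s)" by simp
  also have "(1 / 8 :: real) ^ s * 2 ^ s = (1 / 4) ^ s" by (simp add: power_mult_distrib[symmetric])
  finally show "(exp 1 * (\<mu> * N) / real s) ^ s * (2 * real r * Y / N) ^ ((3 * s + 1) div 2) \<le> root 8 (1 / N) * (1 / 4) ^ s"
    using a by simp
qed

text \<open>Union bound over the families of islands met by \<open>U\<close>, grouped by their
  number \<open>s\<close>, and over the triples in them. For fixed data \<open>cover_count\<close>
  is applied to the \<open>3 * s\<close> chosen vertices, with the union of the chosen islands as
  set of possible partners.\<close>

theorem self_linked_count:
  fixes V :: "'a set"
  assumes V: "finite V" and D: "\<And>v. v \<in> V \<Longrightarrow> card {x\<in>V. {v, x} \<in> E} \<le> D"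
    and r: "r \<ge> 1" and T: "\<And>T. T \<in> \<T> \<Longrightarrow> T \<noteq> {} \<and> T \<subseteq> V"
    and disj: "\<And>T T'. T \<in> \<T> \<Longrightarrow> T' \<in> \<T> \<Longrightarrow> T \<noteq> T' \<Longrightarrow> T \<inter> T' = {}"
    and fourth: "(\<Sum>T\<in>\<T>. real (card T) ^ 4) \<le> \<mu> * real (card V)"
    and \<mu>: "\<mu> = 1 / (10 ^ 4 * (real r)\<^sup>2)" and large: "8 + 8 * (D + r) \<le> card V"
  shows "real (card {Ms\<in>disjoint_tuples V E r. self_linked \<T> r Ms})
    \<le> root 8 (1 / real (card V)) * real (card (disjoint_tuples V E r))"
proof -
  define N where "N = real (card V)"
  have N: "N > 0" using large by (simp add: N_def)
  have \<mu>0: "\<mu> > 0" using r by (simp add: \<mu>)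
  have \<mu>1: "\<mu> \<le> 1 / 10 ^ 4"
  proof -
    have "1 \<le> (real r)\<^sup>2" using r by simp
    then show ?thesis unfolding \<mu> using r by (intro divide_left_mono) auto
  qed
  have finT: "finite \<T>" using T V by (intro finite_subset[of \<T> "Pow V"]) auto
  have Tcard: "card T \<ge> 1" if "T \<in> \<T>" for T
    using T[OF that] V finite_subset by (metis One_nat_def Suc_leI card_gt_0_iff)
  have sumS: "(\<Sum>T\<in>\<S>. real (card T) ^ 4) \<le> \<mu> * N" if "\<S> \<subseteq> \<T>" for \<S>
    using sum_mono2[OF finT that, of "\<lambda>T. real (card T) ^ 4"] fourth by (simp add: N_def)
  have cardS: "real (card \<S>) \<le> \<mu> * N" if "\<S> \<subseteq> \<T>" for \<S>
  proof -
    have "real (card \<S>) = (\<Sum>T\<in>\<S>. 1)" by simp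
    also have "\<dots> \<le> (\<Sum>T\<in>\<S>. real (card T) ^ 4)" using Tcard that by (intro sum_mono one_le_power) (force simp: Suc_le_eq)
    finally show ?thesis using sumS[OF that] by linarith
  qed
  have smallT: "4 + 4 * (3 * card \<T>) + 4 * (D + r) \<le> card V"
  proof -
    have "\<mu> * N \<le> N / 10 ^ 4"
      using mult_right_mono[OF \<mu>1 less_imp_le[OF N]] by (simp only: times_divide_eq_left mult_1)
    then have "real (card \<T>) \<le> N / 10 ^ 4" using cardS[of \<T>] by simp
    then have "real (24 * card \<T>) \<le> real (card V)" by (simp add: N_def)
    then have "24 * card \<T> \<le> card V" by (simp only: of_nat_le_iff)
    then show ?thesis using large by linarith
  qed
  define W where "W \<S> = {Ms\<in>disjoint_tuples V E r. \<exists>c\<in>(\<Pi>\<^sub>E T\<in>\<S>. {Y. Y \<subseteq> T \<and> card Y = 3}).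
    \<forall>u\<in>(\<Union>T\<in>\<S>. c T). \<exists>i<r. \<exists>w\<in>\<Union>\<S>. {u, w} \<in> Ms ! i}" for \<S>
  define \<kappa> where "\<kappa> \<S> = 2 * real r * real (card (\<Union>\<S>)) / N" for \<S> :: "'a set set"
  define K where "K = real (card (disjoint_tuples V E r))"
  have finD: "finite (disjoint_tuples V E r)" using finite_disjoint_tuples[OF V] .
  have Yb: "real (card (\<Union>\<S>)) \<le> real s * l + \<mu> * N / l ^ 3"
    if S: "\<S> \<subseteq> \<T>" "card \<S> = s" and l: "l > 0" for \<S> s l
  proof -
    have "finite \<S>" using S finT finite_subset by blast
    then have "card (\<Union>\<S>) \<le> (\<Sum>T\<in>\<S>. card T)" using card_UN_le[of \<S> "\<lambda>x. x"] by simp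
    then have "real (card (\<Union>\<S>)) \<le> (\<Sum>T\<in>\<S>. real (card T))" by (simp flip: of_nat_sum)
    also have "\<dots> \<le> (\<Sum>T\<in>\<S>. l + real (card T) ^ 4 / l ^ 3)" using l by (intro sum_mono le_add_fourth_power) auto
    also have "\<dots> = real s * l + (\<Sum>T\<in>\<S>. real (card T) ^ 4) / l ^ 3"
      using S by (simp add: sum.distrib sum_divide_distrib)
    also have "\<dots> \<le> real s * l + \<mu> * N / l ^ 3" using sumS[OF S(1)] l by (simp add: divide_right_mono)
    finally show ?thesis .
  qed
  define l where "l s = (root 8 \<mu>)\<^sup>2 / (root 8 (real s / N))\<^sup>2" for s :: nat
  have lpos: "l s > 0" if "s \<ge> 1" for s using that \<mu>0 N by (simp add: l_def)
  have W: "real (card (W \<S>)) \<le> (\<Prod>T\<in>\<S>. real (card T) ^ 3) * \<kappa> \<S> ^ ((3 * s + 1) div 2) * K"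
    if S: "\<S> \<subseteq> \<T>" "card \<S> = s" "s \<ge> 1" for \<S> s
  proof -
    have finS: "finite \<S>" using S finT finite_subset by blast
    have SV: "\<Union>\<S> \<subseteq> V" using S T by blast
    have finT': "finite T" if "T \<in> \<S>" for T
      using that S(1) T V by (meson finite_subset subsetD)
    have sN: "real s \<le> \<mu> * N" using cardS[OF S(1)] S(2) by simp
    have \<kappa>1: "\<kappa> \<S> \<le> 1" unfolding \<kappa>_def
      by (rule self_linked_term_bound(1)[OF N r S(3) _ Yb[OF S(1,2) lpos[OF S(3)]] l_def \<mu> sN]) simp
    let ?P = "\<Pi>\<^sub>E T\<in>\<S>. {Y. Y \<subseteq> T \<and> card Y = 3}"
    define C where "C c = {Ms\<in>tuples_with V E r {}. \<forall>u\<in>(\<Union>T\<in>\<S>. c T). \<exists>i<r. \<exists>w\<in>\<Union>\<S>. {u, w} \<in> Ms ! i}" for c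
    have t0: "tuples_with V E r {} = disjoint_tuples V E r" by (simp add: tuples_with_def)
    have finP: "finite ?P" using finS finT' by (intro finite_PiE) auto
    have each: "real (card (C c)) \<le> \<kappa> \<S> ^ ((3 * s + 1) div 2) * K" if c: "c \<in> ?P" for c
    proof -
      have cT: "c T \<subseteq> T" "card (c T) = 3" if "T \<in> \<S>" for T using c that by (auto simp: PiE_iff)
      have "card (\<Union>T\<in>\<S>. c T) = (\<Sum>T\<in>\<S>. card (c T))"
      proof (rule card_UN_disjoint[OF finS])
        show "\<forall>T\<in>\<S>. finite (c T)" using cT(1) finT' finite_subset by blast
        show "\<forall>T\<in>\<S>. \<forall>T'\<in>\<S>. T \<noteq> T' \<longrightarrow> c T \<inter> c T' = {}" using disj cT(1) S(1) by blast
      qed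
      then have cQ: "card (\<Union>T\<in>\<S>. c T) = 3 * s" using cT(2) S(2) by simp
      have "card \<S> \<le> card \<T>" using S(1) finT card_mono by blast
      then have le: "card {} + card (\<Union>T\<in>\<S>. c T) \<le> 3 * card \<T>" using cQ S(2) by simp
      have "real (card (C c)) \<le> \<kappa> \<S> ^ ((card (\<Union>T\<in>\<S>. c T) + 1) div 2) * real (card (tuples_with V E r {}))"
        unfolding C_def
        by (rule cover_count[OF V D SV smallT _ \<kappa>1]) (use le cT(1) SV in \<open>auto simp: \<kappa>_def N_def\<close>)
      then show ?thesis unfolding cQ t0 K_def .
    qed
    have "W \<S> \<subseteq> (\<Union>c\<in>?P. C c)" unfolding W_def C_def t0 by blast
    then have "real (card (W \<S>)) \<le> real (card (\<Union>c\<in>?P. C c))"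
      using finP finD by (intro of_nat_mono card_mono) (auto simp: C_def t0)
    also have "\<dots> \<le> (\<Sum>c\<in>?P. real (card (C c)))" using card_UN_le[OF finP, of C] by (simp flip: of_nat_sum)
    also have "\<dots> \<le> (\<Sum>c\<in>?P. \<kappa> \<S> ^ ((3 * s + 1) div 2) * K)" by (rule sum_mono) (rule each)
    also have "\<dots> = real (card ?P) * (\<kappa> \<S> ^ ((3 * s + 1) div 2) * K)" by simp
    also have "real (card ?P) \<le> (\<Prod>T\<in>\<S>. real (card T) ^ 3)"
    proof -
      have "card ?P = (\<Prod>T\<in>\<S>. card T choose 3)" using finS finT' by (simp add: card_PiE n_subsets)
      then have "real (card ?P) = (\<Prod>T\<in>\<S>. real (card T choose 3))" by simp
      also have "\<dots> \<le> (\<Prod>T\<in>\<S>. real (card T) ^ 3)"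
      proof (rule prod_mono)
        fix T assume "T \<in> \<S>"
        have "card T choose 3 \<le> card T ^ 3"
          by (cases "3 \<le> card T") (auto intro: binomial_le_pow simp: binomial_eq_0)
        then show "0 \<le> real (card T choose 3) \<and> real (card T choose 3) \<le> real (card T) ^ 3"
          by (simp flip: of_nat_power)
      qed
      finally show ?thesis .
    qed
    finally show ?thesis
      using N by (simp add: mult.assoc mult_right_mono \<kappa>_def K_def)
  qed
  have level: "(\<Sum>\<S>\<in>{\<S>\<in>Pow \<T>. card \<S> = s}. real (card (W \<S>))) \<le> root 8 (1 / N) * (1 / 4) ^ s * K"
    if s: "s \<ge> 1" for s
  proof (cases "real s \<le> \<mu> * N")
    \<comment> \<open>Every island contributes at least 1 to the fourth moment, so there are at most
      \<open>\<mu> * N\<close> islands.\<close>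
    case False
    then have none: "{\<S>\<in>Pow \<T>. card \<S> = s} = {}" using cardS by auto
    show ?thesis unfolding none using N by (simp add: K_def)
  next
    case True
    define y where "y = real s * l s + \<mu> * N / l s ^ 3"
    have y0: "y \<ge> 0" using lpos[OF s] \<mu>0 N by (simp add: y_def)
    define k where "k = 2 * real r * y / N"
    have "(\<Sum>\<S>\<in>{\<S>\<in>Pow \<T>. card \<S> = s}. real (card (W \<S>)))
        \<le> (\<Sum>\<S>\<in>{\<S>\<in>Pow \<T>. card \<S> = s}. (\<Prod>T\<in>\<S>. real (card T) ^ 3) * (k ^ ((3 * s + 1) div 2) * K))"
    proof (rule sum_mono)
      fix \<S> assume "\<S> \<in> {\<S>\<in>Pow \<T>. card \<S> = s}"
      then have S: "\<S> \<subseteq> \<T>" "card \<S> = s" by auto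
      have "\<kappa> \<S> \<le> k" unfolding \<kappa>_def k_def using Yb[OF S lpos[OF s]] N
        by (intro divide_right_mono mult_left_mono) (auto simp: y_def)
      then have "\<kappa> \<S> ^ ((3 * s + 1) div 2) \<le> k ^ ((3 * s + 1) div 2)" using N by (intro power_mono) (auto simp: \<kappa>_def)
      then have "(\<Prod>T\<in>\<S>. real (card T) ^ 3) * \<kappa> \<S> ^ ((3 * s + 1) div 2) * K
          \<le> (\<Prod>T\<in>\<S>. real (card T) ^ 3) * k ^ ((3 * s + 1) div 2) * K"
        by (intro mult_right_mono mult_left_mono prod_nonneg) (auto simp: K_def)
      then show "real (card (W \<S>)) \<le> (\<Prod>T\<in>\<S>. real (card T) ^ 3) * (k ^ ((3 * s + 1) div 2) * K)"
        using W[OF S s] by (simp add: mult.assoc)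
    qed
    also have "\<dots> = (\<Sum>\<S>\<in>{\<S>\<in>Pow \<T>. card \<S> = s}. \<Prod>T\<in>\<S>. real (card T) ^ 3) * (k ^ ((3 * s + 1) div 2) * K)"
      by (simp add: sum_distrib_right)
    also have "\<dots> \<le> (exp 1 * (\<mu> * N) / real s) ^ s * (k ^ ((3 * s + 1) div 2) * K)"
    proof (rule mult_right_mono)
      \<comment> \<open>An island offers at most \<open>card T ^ 3\<close> triples. Summed over all
        families of size \<open>s\<close>, their products form an elementary symmetric function of
        the cubes, and sizes are at least 1.\<close>
      have "(\<Sum>T\<in>\<T>. real (card T) ^ 3) \<le> (\<Sum>T\<in>\<T>. real (card T) ^ 4)"
        using Tcard by (intro sum_mono power_increasing) (auto simp: Suc_le_eq)
      also have "\<dots> \<le> \<mu> * N" by (rule sumS) simp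
      finally show "(\<Sum>\<S>\<in>{\<S>\<in>Pow \<T>. card \<S> = s}. \<Prod>T\<in>\<S>. real (card T) ^ 3) \<le> (exp 1 * (\<mu> * N) / real s) ^ s"
        using finT s \<mu>0 N by (intro elementary_symmetric_bound) auto
    qed (use y0 N in \<open>auto simp: k_def K_def\<close>)
    also have "\<dots> = ((exp 1 * (\<mu> * N) / real s) ^ s * k ^ ((3 * s + 1) div 2)) * K" by simp
    also have "\<dots> \<le> (root 8 (1 / N) * (1 / 4) ^ s) * K"
    proof (rule mult_right_mono)
      show "(exp 1 * (\<mu> * N) / real s) ^ s * k ^ ((3 * s + 1) div 2) \<le> root 8 (1 / N) * (1 / 4) ^ s"
        unfolding k_def
        by (rule self_linked_term_bound(2)[OF N r s y0 _ l_def \<mu> True]) (simp add: y_def)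
    qed (simp add: K_def)
    finally show ?thesis .
  qed
  have "{Ms\<in>disjoint_tuples V E r. self_linked \<T> r Ms} \<subseteq> (\<Union>\<S>\<in>Pow \<T> - {{}}. W \<S>)"
  proof
    fix Ms assume Ms: "Ms \<in> {Ms\<in>disjoint_tuples V E r. self_linked \<T> r Ms}"
    then have sl: "self_linked \<T> r Ms" by simp
    show "Ms \<in> (\<Union>\<S>\<in>Pow \<T> - {{}}. W \<S>)"
      by (rule bexE[OF self_linked_witness[OF sl]], rule UN_I, assumption) (use Ms in \<open>simp add: W_def\<close>)
  qed
  then have "real (card {Ms\<in>disjoint_tuples V E r. self_linked \<T> r Ms}) \<le> real (card (\<Union>\<S>\<in>Pow \<T> - {{}}. W \<S>))"
    using finT finD by (intro of_nat_mono card_mono) (auto simp: W_def)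
  also have "\<dots> \<le> (\<Sum>\<S>\<in>Pow \<T> - {{}}. real (card (W \<S>)))"
    using card_UN_le[of "Pow \<T> - {{}}" W] finT by (simp flip: of_nat_sum)
  also have "\<dots> = (\<Sum>s\<in>{1..card \<T>}. \<Sum>\<S>\<in>{\<S>\<in>Pow \<T> - {{}}. card \<S> = s}. real (card (W \<S>)))"
  proof (rule sum.group[symmetric])
    show "card ` (Pow \<T> - {{}}) \<subseteq> {1..card \<T>}"
      using finT by (auto simp: card_mono Suc_le_eq card_gt_0_iff finite_subset)
  qed (use finT in auto)
  also have "\<dots> \<le> (\<Sum>s\<in>{1..card \<T>}. root 8 (1 / N) * (1 / 4) ^ s * K)"
  proof (rule sum_mono)
    fix s assume s: "s \<in> {1..card \<T>}"
    then have "{\<S>\<in>Pow \<T> - {{}}. card \<S> = s} = {\<S>\<in>Pow \<T>. card \<S> = s}" by auto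
    then show "(\<Sum>\<S>\<in>{\<S>\<in>Pow \<T> - {{}}. card \<S> = s}. real (card (W \<S>))) \<le> root 8 (1 / N) * (1 / 4) ^ s * K"
      using level[of s] s by simp
  qed
  also have "\<dots> = root 8 (1 / N) * K * (\<Sum>s\<in>{1..card \<T>}. (1 / 4) ^ s)" by (simp add: sum_distrib_left mult_ac)
  also have "\<dots> \<le> root 8 (1 / N) * K * 1"
  proof (rule mult_left_mono)
    have "(\<Sum>s\<in>{1..m}. (1 / 4) ^ s) + (1 / 4) ^ m \<le> (1 :: real)" for m
      by (induction m) (auto simp: field_simps)
    then show "(\<Sum>s\<in>{1..card \<T>}. (1 / 4) ^ s) \<le> (1 :: real)"
      by (metis add_increasing2 divide_nonneg_nonneg le_add_same_cancel1 order_trans zero_le_numeral zero_le_one zero_le_power)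
  qed (use N in \<open>auto simp: K_def\<close>)
  finally show ?thesis by (simp add: N_def K_def)
qed

section \<open>Random subsets\<close>

abbreviation expect :: "'a set \<Rightarrow> real \<Rightarrow> ('a set \<Rightarrow> real) \<Rightarrow> real" where
  "expect V p f \<equiv> measure_pmf.expectation (random_subset V p) f"

definition depends_on :: "'a set \<Rightarrow> ('a set \<Rightarrow> 'b) \<Rightarrow> bool" where
  "depends_on S f \<longleftrightarrow> (\<forall>A B. A \<inter> S = B \<inter> S \<longrightarrow> f A = f B)"

lemma set_random_subset: "set_pmf (random_subset V p) \<subseteq> Pow V"
  by (auto simp: random_subset_def)

lemma expect_eq_sum:
  assumes "finite V"
  shows "expect V p f = (\<Sum>A\<in>Pow V. f A * pmf (random_subset V p) A)"
  by (rule integral_measure_pmf_real) (use assms set_random_subset in auto)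

lemma expect_mono:
  assumes "finite V" "\<And>A. A \<subseteq> V \<Longrightarrow> f A \<le> g A" shows "expect V p f \<le> expect V p g"
  unfolding expect_eq_sum[OF assms(1)] by (intro sum_mono mult_right_mono) (use assms in auto)

lemma expect_cong:
  assumes "finite V" "\<And>A. A \<subseteq> V \<Longrightarrow> f A = g A" shows "expect V p f = expect V p g"
  unfolding expect_eq_sum[OF assms(1)] by (intro sum.cong) (use assms in auto)

lemma expect_sum:
  assumes "finite V" shows "expect V p (\<lambda>A. \<Sum>i\<in>I. f i A) = (\<Sum>i\<in>I. expect V p (f i))"
  unfolding expect_eq_sum[OF assms] sum_distrib_right by (rule sum.swap)

lemma expect_cmult:
  assumes "finite V" shows "expect V p (\<lambda>A. c * f A) = c * expect V p f"
  unfolding expect_eq_sum[OF assms] by (simp add: sum_distrib_left mult.assoc)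

lemma expect_add:
  assumes "finite V" shows "expect V p (\<lambda>A. f A + g A) = expect V p f + expect V p g"
  unfolding expect_eq_sum[OF assms] by (simp add: sum.distrib distrib_right)

lemma expect_const: "expect V p (\<lambda>A. c) = c"
  by simp

lemma expect_nonneg: "(\<And>A. f A \<ge> 0) \<Longrightarrow> expect V p f \<ge> 0"
  by (rule integral_nonneg_AE) simp

lemma prob_eq_expect:
  "measure_pmf.prob M {x. Q x} = measure_pmf.expectation M (\<lambda>x. of_bool (Q x))"
proof -
  have "(\<lambda>x. of_bool (Q x)) = (indicator {x. Q x} :: _ \<Rightarrow> real)" by (auto simp: indicator_def)
  then show ?thesis by simp
qed

lemma random_subset_Un:
  assumes "finite A" "finite B" "A \<inter> B = {}"
  shows "random_subset (A \<union> B) p =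
    map_pmf (\<lambda>(X, Y). X \<union> Y) (pair_pmf (random_subset A p) (random_subset B p))"
proof -
  have "random_subset (A \<union> B) p =
      map_pmf (\<lambda>(f, g). {v\<in>A \<union> B. if v \<in> A then f v else g v})
        (pair_pmf (Pi_pmf A False (\<lambda>_. bernoulli_pmf p)) (Pi_pmf B False (\<lambda>_. bernoulli_pmf p)))"
    unfolding random_subset_def
    by (subst Pi_pmf_union[OF assms]) (simp add: pmf.map_comp o_def case_prod_unfold)
  also have "\<dots> = map_pmf (\<lambda>(f, g). {v\<in>A. f v} \<union> {v\<in>B. g v})
        (pair_pmf (Pi_pmf A False (\<lambda>_. bernoulli_pmf p)) (Pi_pmf B False (\<lambda>_. bernoulli_pmf p)))"
    using assms(3) by (intro map_pmf_cong) auto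
  also have "\<dots> = map_pmf (\<lambda>(X, Y). X \<union> Y) (pair_pmf (random_subset A p) (random_subset B p))"
    unfolding random_subset_def map_pair[symmetric] by (simp add: pmf.map_comp o_def case_prod_unfold)
  finally show ?thesis .
qed

lemma expectation_pair_mult:
  fixes f g :: "_ \<Rightarrow> real"
  assumes "finite (set_pmf P)" "finite (set_pmf Q)"
  shows "measure_pmf.expectation (pair_pmf P Q) (\<lambda>x. f (fst x) * g (snd x)) =
    measure_pmf.expectation P f * measure_pmf.expectation Q g"
proof -
  have "measure_pmf.expectation (pair_pmf P Q) (\<lambda>x. f (fst x) * g (snd x)) =
      (\<Sum>x\<in>set_pmf P \<times> set_pmf Q. f (fst x) * g (snd x) * pmf (pair_pmf P Q) x)"
    by (rule integral_measure_pmf_real) (use assms in auto)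
  also have "\<dots> = (\<Sum>(a, b)\<in>set_pmf P \<times> set_pmf Q. (f a * pmf P a) * (g b * pmf Q b))"
    by (rule sum.cong) (auto simp: pmf_pair)
  also have "\<dots> = (\<Sum>a\<in>set_pmf P. f a * pmf P a) * (\<Sum>b\<in>set_pmf Q. g b * pmf Q b)"
    by (simp add: sum_product sum.cartesian_product)
  also have "(\<Sum>a\<in>set_pmf P. f a * pmf P a) = measure_pmf.expectation P f"
    by (rule integral_measure_pmf_real[symmetric]) (use assms in auto)
  also have "(\<Sum>b\<in>set_pmf Q. g b * pmf Q b) = measure_pmf.expectation Q g"
    by (rule integral_measure_pmf_real[symmetric]) (use assms in auto)
  finally show ?thesis .
qed

lemma finite_set_random_subset: "finite V \<Longrightarrow> finite (set_pmf (random_subset V p))"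
  using set_random_subset finite_subset by (metis finite_Pow_iff)

text \<open>A random subset of \<open>V\<close> is the union of independent random subsets of
  \<open>V \<inter> S\<close> and \<open>V - S\<close>; \<open>f\<close> sees only the first and
  \<open>g\<close> only the second.\<close>

lemma expect_indep:
  assumes V: "finite V" and f: "depends_on S f" and g: "depends_on S' g" and S: "S \<inter> S' = {}"
  shows "expect V p (\<lambda>A. f A * g A) = expect V p f * expect V p g"
proof -
  let ?P = "random_subset (V \<inter> S) p" and ?Q = "random_subset (V - S) p"
  have split: "random_subset V p = map_pmf (\<lambda>(X, Y). X \<union> Y) (pair_pmf ?P ?Q)"
    using random_subset_Un[of "V \<inter> S" "V - S" p] V by (simp add: Int_Diff_Un Int_Diff_disjoint)
  have fX: "f (fst x \<union> snd x) = f (fst x)" and gY: "g (fst x \<union> snd x) = g (snd x)" if "x \<in> set_pmf (pair_pmf ?P ?Q)" for x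
  proof -
    have x: "fst x \<subseteq> V \<inter> S" "snd x \<subseteq> V - S" using that set_random_subset by fastforce+
    have "(fst x \<union> snd x) \<inter> S = fst x \<inter> S" using x by blast
    then show "f (fst x \<union> snd x) = f (fst x)" using f unfolding depends_on_def by blast
    have "(fst x \<union> snd x) \<inter> S' = snd x \<inter> S'" using x S by blast
    then show "g (fst x \<union> snd x) = g (snd x)" using g unfolding depends_on_def by blast
  qed
  have ex: "expect V p h = measure_pmf.expectation (pair_pmf ?P ?Q) (\<lambda>x. h (fst x \<union> snd x))" for h
    unfolding split by (simp add: case_prod_unfold)
  have cong: "measure_pmf.expectation (pair_pmf ?P ?Q) h = measure_pmf.expectation (pair_pmf ?P ?Q) h'"
    if "\<And>x. x \<in> set_pmf (pair_pmf ?P ?Q) \<Longrightarrow> h x = h' x" for h h' :: "_ \<Rightarrow> real"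
    using that by (intro integral_cong_AE) (auto simp: AE_measure_pmf_iff)
  have "expect V p (\<lambda>A. f A * g A) = measure_pmf.expectation (pair_pmf ?P ?Q) (\<lambda>x. f (fst x) * g (snd x))"
    unfolding ex by (rule cong) (simp add: fX gY)
  also have "\<dots> = measure_pmf.expectation ?P f * measure_pmf.expectation ?Q g"
    using V by (intro expectation_pair_mult finite_set_random_subset) auto
  also have "measure_pmf.expectation ?P f = measure_pmf.expectation (pair_pmf ?P ?Q) (\<lambda>x. f (fst x))" by simp
  also have "\<dots> = expect V p f" unfolding ex by (rule cong) (simp add: fX)
  also have "measure_pmf.expectation ?Q g = measure_pmf.expectation (pair_pmf ?P ?Q) (\<lambda>x. g (snd x))" by simp
  also have "\<dots> = expect V p g" unfolding ex by (rule cong) (simp add: gY)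
  finally show ?thesis .
qed

lemma random_subset_empty: "random_subset {} p = return_pmf {}"
  by (simp add: random_subset_def)

lemma random_subset_singleton:
  "random_subset {x} p = map_pmf (\<lambda>b. if b then {x} else {}) (bernoulli_pmf p)"
  unfolding random_subset_def
  by (subst Pi_pmf_singleton) (auto simp: pmf.map_comp o_def intro!: map_pmf_cong split: if_splits)

section \<open>Unions of independent random subsets\<close>

lemma bernoulli_or:
  assumes "0 \<le> p1" "p1 \<le> 1" "0 \<le> p2" "p2 \<le> 1" "1 - p = (1 - p1) * (1 - p2)"
  shows "bernoulli_pmf p = map_pmf (\<lambda>(a, b). a \<or> b) (pair_pmf (bernoulli_pmf p1) (bernoulli_pmf p2))"
proof -
  have 1: "0 \<le> (1 - p1) * (1 - p2)" "(1 - p1) * (1 - p2) \<le> 1"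
    using assms by (auto intro: mult_le_one)
  have p: "0 \<le> p" "p \<le> 1" using assms(5) 1 by linarith+
  have "pmf (map_pmf (\<lambda>(a, b). a \<or> b) (pair_pmf (bernoulli_pmf p1) (bernoulli_pmf p2))) False =
      measure_pmf.prob (pair_pmf (bernoulli_pmf p1) (bernoulli_pmf p2)) ((\<lambda>(a, b). a \<or> b) -` {False})"
    by (simp add: pmf_map)
  also have "(\<lambda>(a, b). a \<or> b) -` {False} = {(False, False)}" by auto
  also have "measure_pmf.prob (pair_pmf (bernoulli_pmf p1) (bernoulli_pmf p2)) {(False, False)} = (1 - p1) * (1 - p2)"
    using assms by (simp add: measure_pmf_single pmf_pair)
  finally have F: "pmf (map_pmf (\<lambda>(a, b). a \<or> b) (pair_pmf (bernoulli_pmf p1) (bernoulli_pmf p2))) False = 1 - p"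
    using assms by simp
  have "pmf M True = 1 - pmf M False" for M :: "bool pmf"
  proof -
    have "(\<Sum>b\<in>UNIV. pmf M b) = 1" by (rule sum_pmf_eq_1) auto
    then show ?thesis by (simp add: UNIV_bool)
  qed
  then have T: "pmf (map_pmf (\<lambda>(a, b). a \<or> b) (pair_pmf (bernoulli_pmf p1) (bernoulli_pmf p2))) True = p"
    using F by simp
  show ?thesis
    by (rule pmf_eqI) (use F T p in \<open>case_tac i; simp\<close>)
qed

text \<open>A vertex is missing from the union exactly if it is missing from both sets, so the
  complementary densities multiply. The induction adds one vertex at a time and exchanges the order
  of independent choices.\<close>

lemma random_subset_or:
  assumes p: "0 \<le> p1" "p1 \<le> 1" "0 \<le> p2" "p2 \<le> 1" "1 - p = (1 - p1) * (1 - p2)" and V: "finite V"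
  shows "random_subset V p = map_pmf (\<lambda>(X, Y). X \<union> Y) (pair_pmf (random_subset V p1) (random_subset V p2))"
  using V
proof induction
  case empty
  then show ?case by (simp add: random_subset_empty)
next
  case (insert x V)
  have ins: "random_subset (insert x V) q =
      bind_pmf (random_subset {x} q) (\<lambda>s. bind_pmf (random_subset V q) (\<lambda>Y. return_pmf (s \<union> Y)))" for q
    using random_subset_Un[of "{x}" V q] insert.hyps
    by (simp add: map_pmf_def pair_pmf_def bind_assoc_pmf bind_return_pmf)
  have sing: "random_subset {x} p =
      bind_pmf (random_subset {x} p1) (\<lambda>s1. bind_pmf (random_subset {x} p2) (\<lambda>s2. return_pmf (s1 \<union> s2)))"
    unfolding random_subset_singleton bernoulli_or[OF p]
    by (simp add: map_pmf_def pair_pmf_def bind_assoc_pmf bind_return_pmf)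
      (intro bind_pmf_cong refl, auto)
  have "random_subset (insert x V) p =
      bind_pmf (random_subset {x} p1) (\<lambda>s1. bind_pmf (random_subset {x} p2) (\<lambda>s2.
        bind_pmf (random_subset V p1) (\<lambda>Y1. bind_pmf (random_subset V p2) (\<lambda>Y2.
          return_pmf ((s1 \<union> s2) \<union> (Y1 \<union> Y2))))))"
    unfolding ins sing insert.IH
    by (simp add: map_pmf_def pair_pmf_def bind_assoc_pmf bind_return_pmf)
  also have "\<dots> = bind_pmf (random_subset {x} p1) (\<lambda>s1. bind_pmf (random_subset V p1) (\<lambda>Y1.
        bind_pmf (random_subset {x} p2) (\<lambda>s2. bind_pmf (random_subset V p2) (\<lambda>Y2.
          return_pmf ((s1 \<union> s2) \<union> (Y1 \<union> Y2))))))"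
    by (subst bind_commute_pmf[of "random_subset {x} p2" "random_subset V p1"]) (rule refl)
  also have "\<dots> = map_pmf (\<lambda>(X, Y). X \<union> Y) (pair_pmf (random_subset (insert x V) p1) (random_subset (insert x V) p2))"
    unfolding ins by (simp add: map_pmf_def pair_pmf_def bind_assoc_pmf bind_return_pmf Un_ac)
  finally show ?case .
qed

section \<open>Moment and tail estimates for random subsets\<close>

lemma expect_member:
  assumes "finite V" "x \<in> V" "0 \<le> p" "p \<le> 1"
  shows "expect V p (\<lambda>A. h (x \<in> A)) = p * h True + (1 - p) * h False"
proof -
  have "expect V p (\<lambda>A. h (x \<in> A)) =
      measure_pmf.expectation (map_pmf (\<lambda>f. f x) (Pi_pmf V False (\<lambda>_. bernoulli_pmf p))) h"
    using assms(2) by (simp add: random_subset_def)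
  also have "map_pmf (\<lambda>f. f x) (Pi_pmf V False (\<lambda>_. bernoulli_pmf p)) = bernoulli_pmf p"
    using assms by (simp add: Pi_pmf_component)
  finally show ?thesis using assms by simp
qed

lemma expect_prod_members:
  assumes V: "finite V" and S: "S \<subseteq> V" and p: "0 \<le> p" "p \<le> 1"
  shows "expect V p (\<lambda>A. \<Prod>x\<in>S. h (x \<in> A)) = (p * h True + (1 - p) * h False) ^ card S"
proof -
  have "finite S" using V S finite_subset by blast
  then show ?thesis using S
  proof induction
    case (insert x S)
    have "expect V p (\<lambda>A. \<Prod>x\<in>insert x S. h (x \<in> A)) = expect V p (\<lambda>A. h (x \<in> A) * (\<Prod>x\<in>S. h (x \<in> A)))"
      using insert.hyps by simp
    also have "\<dots> = expect V p (\<lambda>A. h (x \<in> A)) * expect V p (\<lambda>A. \<Prod>x\<in>S. h (x \<in> A))"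
    proof (rule expect_indep[OF V])
      show "depends_on {x} (\<lambda>A. h (x \<in> A))" unfolding depends_on_def
      proof (intro allI impI)
        fix A B assume "A \<inter> {x} = B \<inter> {x}"
        then have "x \<in> A \<longleftrightarrow> x \<in> B" by blast
        then show "h (x \<in> A) = h (x \<in> B)" by simp
      qed
      show "depends_on S (\<lambda>A. \<Prod>x\<in>S. h (x \<in> A))" unfolding depends_on_def
      proof (intro allI impI prod.cong refl)
        fix A B y assume "A \<inter> S = B \<inter> S" "y \<in> S"
        then have "y \<in> A \<longleftrightarrow> y \<in> B" by blast
        then show "h (y \<in> A) = h (y \<in> B)" by simp
      qed
    qed (use insert.hyps in auto)
    finally show ?case using insert expect_member[OF V _ p, of x h] by simp
  qed simp
qed

text \<open>Exponential moment with the fixed parameter 1. The constant 3/5 is a lower bound for 1 -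
  1/e.\<close>

lemma chernoff_lower:
  assumes V: "finite V" and S: "S \<subseteq> V" and p: "0 \<le> p" "p \<le> 1"
  shows "expect V p (\<lambda>A. of_bool (card (A \<inter> S) < N)) \<le> exp (real N - 3 / 5 * p * real (card S))"
proof -
  have finS: "finite S" using V S finite_subset by blast
  have prod: "(\<Prod>x\<in>S. if x \<in> A then exp (- 1) else 1) = exp (- real (card (A \<inter> S)))" for A
  proof -
    have "(\<Prod>x\<in>S. if x \<in> A then exp (- 1 :: real) else 1) = (\<Prod>x\<in>S \<inter> A. exp (- 1))"
      by (rule prod.inter_restrict[OF finS, symmetric])
    also have "\<dots> = exp (- real (card (A \<inter> S)))" by (simp add: exp_of_nat_mult[symmetric] Int_commute)
    finally show ?thesis .
  qed
  have "expect V p (\<lambda>A. of_bool (card (A \<inter> S) < N)) \<le> expect V p (\<lambda>A. exp (real N) * (\<Prod>x\<in>S. if x \<in> A then exp (- 1) else 1))"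
  proof (rule expect_mono[OF V])
    fix A
    have "of_bool (card (A \<inter> S) < N) \<le> exp (real N - real (card (A \<inter> S)))" by auto
    then show "of_bool (card (A \<inter> S) < N) \<le> exp (real N) * (\<Prod>x\<in>S. if x \<in> A then exp (- 1) else 1)"
      unfolding prod by (simp add: exp_diff exp_minus field_simps)
  qed
  also have "\<dots> = exp (real N) * (p * exp (- 1) + (1 - p) * 1) ^ card S"
    unfolding expect_cmult[OF V] using expect_prod_members[OF V S p, of "\<lambda>b. if b then exp (- 1) else 1"] by simp
  also have "\<dots> \<le> exp (real N) * exp (- (3 / 5) * p) ^ card S"
  proof (rule mult_left_mono[OF power_mono])
    have "5 / 2 \<le> exp (1 :: real)" using exp_lower_Taylor_quadratic[of 1] by simp
    then have "exp (- 1 :: real) \<le> 2 / 5" by (simp add: exp_minus field_simps)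
    then have "p * exp (- 1) \<le> p * (2 / 5)" using p by (intro mult_left_mono)
    then have "p * exp (- 1) + (1 - p) * 1 \<le> 1 + - (3 / 5) * p" by simp
    also have "\<dots> \<le> exp (- (3 / 5) * p)" by (rule exp_ge_add_one_self)
    finally show "p * exp (- 1) + (1 - p) * 1 \<le> exp (- (3 / 5) * p)" .
  qed (use p in auto)
  also have "\<dots> = exp (real N - 3 / 5 * p * real (card S))"
    by (simp add: exp_of_nat_mult[symmetric] exp_add[symmetric] algebra_simps)
  finally show ?thesis .
qed

lemma expect_subset:
  assumes V: "finite V" and S: "S \<subseteq> V" and p: "0 \<le> p" "p \<le> 1"
  shows "expect V p (\<lambda>A. of_bool (S \<subseteq> A)) = p ^ card S"
proof -
  have finS: "finite S" using V S finite_subset by blast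
  have "of_bool (S \<subseteq> A) = (\<Prod>x\<in>S. of_bool (x \<in> A) :: real)" for A
  proof (cases "S \<subseteq> A")
    case True
    have "(\<Prod>x\<in>S. of_bool (x \<in> A) :: real) = 1" by (rule prod.neutral) (use True in auto)
    then show ?thesis using True by simp
  next
    case False
    then have "\<exists>x\<in>S. of_bool (x \<in> A) = (0 :: real)" by auto
    then show ?thesis using False finS by (simp add: prod_zero)
  qed
  then show ?thesis using expect_prod_members[OF V S p, of of_bool] by simp
qed

lemma no_seed_prob:
  assumes V: "finite V" and p: "0 \<le> p" "p \<le> 1" and J: "finite J"
    and D: "\<And>j. j \<in> J \<Longrightarrow> D j \<subseteq> V \<and> card (D j) \<le> v"
    and disj: "\<And>i j. i \<in> J \<Longrightarrow> j \<in> J \<Longrightarrow> i \<noteq> j \<Longrightarrow> D i \<inter> D j = {}"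
  shows "expect V p (\<lambda>A. of_bool (\<forall>j\<in>J. \<not> D j \<subseteq> A)) \<le> (1 - p ^ v) ^ card J"
  using J D disj
proof induction
  case (insert j J)
  have "expect V p (\<lambda>A. of_bool (\<forall>i\<in>insert j J. \<not> D i \<subseteq> A)) =
      expect V p (\<lambda>A. of_bool (\<not> D j \<subseteq> A) * of_bool (\<forall>i\<in>J. \<not> D i \<subseteq> A))"
    by (intro arg_cong[where f = "expect V p"]) auto
  also have "\<dots> = expect V p (\<lambda>A. of_bool (\<not> D j \<subseteq> A)) * expect V p (\<lambda>A. of_bool (\<forall>i\<in>J. \<not> D i \<subseteq> A))"
  proof (rule expect_indep[OF V])
    show "depends_on (D j) (\<lambda>A. of_bool (\<not> D j \<subseteq> A) :: real)"
      unfolding depends_on_def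
    proof (intro allI impI)
      fix A B assume "A \<inter> D j = B \<inter> D j"
      then have "D j \<subseteq> A \<longleftrightarrow> D j \<subseteq> B" by blast
      then show "of_bool (\<not> D j \<subseteq> A) = (of_bool (\<not> D j \<subseteq> B) :: real)" by simp
    qed
    show "depends_on (\<Union>i\<in>J. D i) (\<lambda>A. of_bool (\<forall>i\<in>J. \<not> D i \<subseteq> A) :: real)"
      unfolding depends_on_def
    proof (intro allI impI)
      fix A B assume AB: "A \<inter> (\<Union>i\<in>J. D i) = B \<inter> (\<Union>i\<in>J. D i)"
      have "D i \<subseteq> A \<longleftrightarrow> D i \<subseteq> B" if "i \<in> J" for i using AB that by blast
      then show "of_bool (\<forall>i\<in>J. \<not> D i \<subseteq> A) = (of_bool (\<forall>i\<in>J. \<not> D i \<subseteq> B) :: real)" by auto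
    qed
    show "D j \<inter> (\<Union>i\<in>J. D i) = {}" using insert.prems(2)[of j] insert.hyps by blast
  qed
  also have "expect V p (\<lambda>A. of_bool (\<not> D j \<subseteq> A)) = 1 - p ^ card (D j)"
  proof -
    have "expect V p (\<lambda>A. of_bool (\<not> D j \<subseteq> A)) + expect V p (\<lambda>A. of_bool (D j \<subseteq> A)) = expect V p (\<lambda>A. 1)"
      unfolding expect_add[OF V, symmetric] by (rule expect_cong[OF V]) simp
    then show ?thesis using expect_subset[OF V _ p, of "D j"] insert.prems(1)[of j] by simp
  qed
  also have "(1 - p ^ card (D j)) * expect V p (\<lambda>A. of_bool (\<forall>i\<in>J. \<not> D i \<subseteq> A)) \<le> (1 - p ^ v) * (1 - p ^ v) ^ card J"
  proof (rule mult_mono)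
    show "1 - p ^ card (D j) \<le> 1 - p ^ v" using insert.prems(1)[of j] p by (simp add: power_decreasing)
    show "expect V p (\<lambda>A. of_bool (\<forall>i\<in>J. \<not> D i \<subseteq> A)) \<le> (1 - p ^ v) ^ card J"
      using insert.prems by (intro insert.IH) auto
    show "0 \<le> 1 - p ^ v" using p by (simp add: power_le_one)
    show "0 \<le> expect V p (\<lambda>A. of_bool (\<forall>i\<in>J. \<not> D i \<subseteq> A))" by (rule expect_nonneg) simp
  qed
  finally show ?case using insert.hyps by simp
qed simp

lemma expect_list_indep:
  assumes V: "finite V"
    and dep: "\<And>v. v \<in> set vs \<Longrightarrow> depends_on (S v) (\<lambda>A. Q v A)"
    and disj: "sorted_wrt (\<lambda>u v. S u \<inter> S v = {}) vs"
    and b: "\<And>v. v \<in> set vs \<Longrightarrow> expect V p (\<lambda>A. of_bool (Q v A)) \<le> d"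
  shows "expect V p (\<lambda>A. of_bool (\<forall>v\<in>set vs. Q v A)) \<le> d ^ length vs"
  using assms(2-4)
proof (induction vs)
  case (Cons v vs)
  have "expect V p (\<lambda>A. of_bool (\<forall>u\<in>set (v # vs). Q u A)) =
      expect V p (\<lambda>A. of_bool (Q v A) * of_bool (\<forall>u\<in>set vs. Q u A))"
    by (intro arg_cong[where f = "expect V p"]) auto
  also have "\<dots> = expect V p (\<lambda>A. of_bool (Q v A)) * expect V p (\<lambda>A. of_bool (\<forall>u\<in>set vs. Q u A))"
  proof (rule expect_indep[OF V])
    show "depends_on (S v) (\<lambda>A. of_bool (Q v A) :: real)"
      unfolding depends_on_def
    proof (intro allI impI)
      fix A B assume AB: "A \<inter> S v = B \<inter> S v"
      have "v \<in> set (v # vs)" by simp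
      from Cons.prems(1)[OF this] have "Q v A = Q v B" using AB unfolding depends_on_def by (elim allE impE)
      then show "of_bool (Q v A) = (of_bool (Q v B) :: real)" by simp
    qed
    show "depends_on (\<Union>u\<in>set vs. S u) (\<lambda>A. of_bool (\<forall>u\<in>set vs. Q u A) :: real)"
      unfolding depends_on_def
    proof (intro allI impI)
      fix A B assume AB: "A \<inter> (\<Union>u\<in>set vs. S u) = B \<inter> (\<Union>u\<in>set vs. S u)"
      have "Q u A = Q u B" if "u \<in> set vs" for u
      proof -
        have ABu: "A \<inter> S u = B \<inter> S u" using AB that by blast
        have "u \<in> set (v # vs)" using that by simp
        from Cons.prems(1)[OF this] show ?thesis using ABu unfolding depends_on_def by (elim allE impE)
      qed
      then show "of_bool (\<forall>u\<in>set vs. Q u A) = (of_bool (\<forall>u\<in>set vs. Q u B) :: real)" by auto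
    qed
    show "S v \<inter> (\<Union>u\<in>set vs. S u) = {}" using Cons.prems(2) by auto
  qed
  also have "\<dots> \<le> d * d ^ length vs"
  proof (rule mult_mono)
    show b: "expect V p (\<lambda>A. of_bool (Q v A)) \<le> d" using Cons.prems(3) by simp
    show "expect V p (\<lambda>A. of_bool (\<forall>u\<in>set vs. Q u A)) \<le> d ^ length vs"
      using Cons.prems by (intro Cons.IH) auto
    have "0 \<le> expect V p (\<lambda>A. of_bool (Q v A))" by (rule expect_nonneg) simp
    then show "0 \<le> d" using b by linarith
    show "0 \<le> expect V p (\<lambda>A. of_bool (\<forall>u\<in>set vs. Q u A))" by (rule expect_nonneg) simp
  qed
  finally show ?case by simp
qed simp

text \<open>Only pairs with intersecting supports contribute to the variance: at most
  \<open>K\<close> for each index, each bounded by the square of \<open>B\<close>. The level is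
  twice the bound \<open>\<mu>\<close> on the means, so exceeding it means a deviation from the
  actual mean by at least \<open>\<mu> * card I\<close>.\<close>

lemma chebyshev_local:
  fixes X :: "'i \<Rightarrow> 'a set \<Rightarrow> real"
  assumes V: "finite V" and I: "finite I" "I \<noteq> {}"
    and X: "\<And>i A. i \<in> I \<Longrightarrow> 0 \<le> X i A \<and> X i A \<le> B" and B: "0 \<le> B"
    and dep: "\<And>i. i \<in> I \<Longrightarrow> depends_on (S i) (X i)"
    and mean: "\<And>i. i \<in> I \<Longrightarrow> expect V p (X i) \<le> \<mu>" and \<mu>: "\<mu> > 0"
    and near: "\<And>i. i \<in> I \<Longrightarrow> card {j\<in>I. S i \<inter> S j \<noteq> {}} \<le> K"
  shows "expect V p (\<lambda>A. of_bool ((\<Sum>i\<in>I. X i A) \<ge> 2 * \<mu> * real (card I))) \<le> real K * B\<^sup>2 / (\<mu>\<^sup>2 * real (card I))"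
proof -
  define Y where "Y A = (\<Sum>i\<in>I. X i A)" for A
  define c where "c = expect V p Y"
  have c: "c = (\<Sum>i\<in>I. expect V p (X i))" unfolding c_def Y_def by (rule expect_sum[OF V])
  have N: "real (card I) > 0" using I by (simp add: card_gt_0_iff)
  define a where "a = \<mu> * real (card I)"
  have a: "a > 0" using \<mu> N by (simp add: a_def)
  have ca: "c \<le> a" unfolding c a_def using sum_bounded_above[of I "\<lambda>i. expect V p (X i)" \<mu>] mean by (simp add: mult.commute)
  have YY: "expect V p (\<lambda>A. Y A * Y A) = (\<Sum>i\<in>I. \<Sum>j\<in>I. expect V p (\<lambda>A. X i A * X j A))"
    unfolding Y_def sum_product by (simp add: expect_sum[OF V])
  have cc: "c * c = (\<Sum>i\<in>I. \<Sum>j\<in>I. expect V p (X i) * expect V p (X j))" unfolding c sum_product ..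
  have "expect V p (\<lambda>A. Y A * Y A) - c * c = (\<Sum>i\<in>I. \<Sum>j\<in>I. expect V p (\<lambda>A. X i A * X j A) - expect V p (X i) * expect V p (X j))"
    unfolding YY cc by (simp add: sum_subtractf)
  also have "\<dots> \<le> (\<Sum>i\<in>I. \<Sum>j\<in>I. if S i \<inter> S j \<noteq> {} then B\<^sup>2 else 0)"
  proof (intro sum_mono)
    fix i j assume ij: "i \<in> I" "j \<in> I"
    show "expect V p (\<lambda>A. X i A * X j A) - expect V p (X i) * expect V p (X j) \<le> (if S i \<inter> S j \<noteq> {} then B\<^sup>2 else 0)"
    proof (cases "S i \<inter> S j = {}")
      case True
      then show ?thesis using expect_indep[OF V dep[OF ij(1)] dep[OF ij(2)] True] by simp
    next
      case False
      have "expect V p (\<lambda>A. X i A * X j A) \<le> expect V p (\<lambda>A. B\<^sup>2)"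
        using X[OF ij(1)] X[OF ij(2)] B by (intro expect_mono[OF V]) (auto simp: power2_eq_square intro!: mult_mono)
      moreover have "0 \<le> expect V p (X i) * expect V p (X j)"
        using X ij by (intro mult_nonneg_nonneg expect_nonneg) auto
      ultimately show ?thesis using False by simp
    qed
  qed
  also have "\<dots> = (\<Sum>i\<in>I. real (card {j\<in>I. S i \<inter> S j \<noteq> {}}) * B\<^sup>2)"
    using I(1) by (intro sum.cong refl) (simp add: sum.If_cases Int_def)
  also have "\<dots> \<le> (\<Sum>i\<in>I. real K * B\<^sup>2)"
    using near by (intro sum_mono mult_right_mono) auto
  finally have var: "expect V p (\<lambda>A. Y A * Y A) - c * c \<le> real (card I) * real K * B\<^sup>2" by simp
  \<comment> \<open>The right-hand side is the square of \<open>(Y A - c) / a\<close>, written as a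
    sum to which linearity applies.\<close>
  have "expect V p (\<lambda>A. of_bool (Y A \<ge> 2 * a)) \<le> expect V p (\<lambda>A. (1 / a\<^sup>2) * (Y A * Y A + ((- 2 * c) * Y A + c * c)))"
  proof (rule expect_mono[OF V])
    fix A
    show "of_bool (Y A \<ge> 2 * a) \<le> (1 / a\<^sup>2) * (Y A * Y A + ((- 2 * c) * Y A + c * c))"
    proof -
      have eq: "Y A * Y A + ((- 2 * c) * Y A + c * c) = (Y A - c)\<^sup>2" by (simp add: power2_eq_square algebra_simps)
      show ?thesis
      proof (cases "Y A \<ge> 2 * a")
        case True
        then have "a \<le> Y A - c" using ca by linarith
        then have "a\<^sup>2 \<le> (Y A - c)\<^sup>2" using a by (intro power_mono) auto
        then show ?thesis unfolding eq using a True by (simp add: field_simps)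
      next
        case False
        then show ?thesis unfolding eq by simp
      qed
    qed
  qed
  also have "\<dots> = (1 / a\<^sup>2) * (expect V p (\<lambda>A. Y A * Y A) - c * c)"
    unfolding expect_cmult[OF V] expect_add[OF V] expect_const c_def[symmetric] by (simp add: algebra_simps)
  also have "\<dots> \<le> (1 / a\<^sup>2) * (real (card I) * real K * B\<^sup>2)" using var by (intro mult_left_mono) auto
  also have "\<dots> = real K * B\<^sup>2 / (\<mu>\<^sup>2 * real (card I))"
    using N \<mu> by (simp add: a_def field_simps power2_eq_square)
  finally show ?thesis unfolding Y_def a_def by (simp add: mult.assoc)
qed

section \<open>Closed sites of the torus\<close>

definition proj :: "nat \<Rightarrow> point \<Rightarrow> point" where
  "proj n z = (fst z mod int n, snd z mod int n)"

text \<open>The periodic set in the plane that covers a subset of the torus. Geometry takes place in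
  the plane, where the topology is simple, and probability on the torus.\<close>

definition lift :: "nat \<Rightarrow> point set \<Rightarrow> point set" where
  "lift n A = {z. proj n z \<in> A}"

lemma proj_in_torus: "n > 0 \<Longrightarrow> proj n z \<in> torus n"
  by (simp add: proj_def torus_def)

lemma proj_torus: "z \<in> torus n \<Longrightarrow> proj n z = z"
  by (auto simp: proj_def torus_def)

lemma proj_shift: "proj n (z + (i * int n, j * int n)) = proj n z"
  by (simp add: proj_def)

lemma proj_eqE:
  assumes "proj n u = proj n v"
  obtains i j where "u = v + (i * int n, j * int n)"
proof -
  have "int n dvd fst u - fst v" "int n dvd snd u - snd v"
    using assms by (auto simp: proj_def mod_eq_dvd_iff)
  then obtain i j where "fst u - fst v = int n * i" "snd u - snd v = int n * j" by (auto simp: dvd_def)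
  then have "u = v + (i * int n, j * int n)" by (simp add: prod_eq_iff algebra_simps)
  then show ?thesis by (rule that)
qed

lemma proj_decomp: obtains i j where "z = proj n z + (i * int n, j * int n)"
proof -
  have "proj n z = proj n (proj n z)" by (simp add: proj_def)
  then show ?thesis using proj_eqE[of n z "proj n z"] that by metis
qed

lemma finite_torus: "finite (torus n)" by (simp add: torus_def)
lemma card_torus: "card (torus n) = n\<^sup>2"
  by (simp add: torus_def card_cartesian_product power2_eq_square)

lemma lift_shift: "z + (i * int n, j * int n) \<in> lift n A \<longleftrightarrow> z \<in> lift n A"
  by (simp add: lift_def proj_shift)

text \<open>The first inequality separates the balls in the plane, the second prevents them from
  meeting around the torus.\<close>

lemma proj_sball_disjoint:
  assumes "sup_dist u v > 2 * \<rho>" "sup_dist u v + 2 * \<rho> < int n"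
  shows "proj n ` sball u \<rho> \<inter> proj n ` sball v \<rho> = {}"
proof (rule ccontr)
  assume "\<not> ?thesis"
  then obtain c where "c \<in> proj n ` sball u \<rho>" "c \<in> proj n ` sball v \<rho>" by blast
  then obtain a b where ab: "a \<in> sball u \<rho>" "b \<in> sball v \<rho>" "proj n a = proj n b" by blast
  obtain i j where ij: "a = b + (i * int n, j * int n)" using proj_eqE[OF ab(3)] .
  have d: "sup_dist u a \<le> \<rho>" "sup_dist v b \<le> \<rho>" using ab by (auto simp: sball_def)
  have "sup_dist a b \<le> sup_dist a u + (sup_dist u v + sup_dist v b)"
    using sup_dist_triangle[of a b u] sup_dist_triangle[of u b v] by linarith
  then have lt: "sup_dist a b < int n" using d assms(2) sup_dist_sym[of a u] by linarith
  have "i = 0" "j = 0"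
  proof -
    have "\<bar>i * int n\<bar> < int n" "\<bar>j * int n\<bar> < int n" using lt by (auto simp: ij sup_dist_def)
    then have "\<bar>i\<bar> * int n < 1 * int n" "\<bar>j\<bar> * int n < 1 * int n" by (auto simp: abs_mult)
    then have "\<bar>i\<bar> < 1" "\<bar>j\<bar> < 1" by (meson mult_right_less_imp_less of_nat_0_le_iff)+
    then show "i = 0" "j = 0" by auto
  qed
  then have "a = b" using ij by (simp add: prod_eq_iff)
  then show False using d assms(1) sup_dist_triangle[of u v a] sup_dist_sym[of v a] by simp
qed

text \<open>A site is open if all sites within distance \<open>R\<close> are good. Later
  \<open>R\<close> is the radius that a droplet needs in order to move, so a droplet centred at an
  open site can go to any adjacent site.\<close>

definition closed_set :: "nat \<Rightarrow> nat \<Rightarrow> nat \<Rightarrow> nat \<Rightarrow> point set \<Rightarrow> point set" where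
  "closed_set n k N R A = {z. \<exists>v\<in>sball z (int R). \<not> good_site k N (lift n A) v}"

lemma good_site_shift: "good_site k N (lift n A) (z + (i * int n, j * int n)) \<longleftrightarrow> good_site k N (lift n A) z"
proof -
  have "(fst (z + (i * int n, j * int n)) + s * a, snd (z + (i * int n, j * int n)) + t) \<in> lift n A \<longleftrightarrow>
      (fst z + s * a, snd z + t) \<in> lift n A" for s a t
    using lift_shift[of "(fst z + s * a, snd z + t)" i n j A] by (simp add: algebra_simps)
  then show ?thesis unfolding good_site_def by presburger
qed

lemma sup_dist_translate: "sup_dist (u + a) (v + a) = sup_dist u v" by (simp add: sup_dist_def)

lemma closed_set_shift: "z + (i * int n, j * int n) \<in> closed_set n k N R A \<longleftrightarrow> z \<in> closed_set n k N R A"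
proof -
  have imp: "z + (i * int n, j * int n) \<in> closed_set n k N R A" if z: "z \<in> closed_set n k N R A" for z i j
  proof -
    obtain v where v: "v \<in> sball z (int R)" "\<not> good_site k N (lift n A) v" using z unfolding closed_set_def by blast
    have "v + (i * int n, j * int n) \<in> sball (z + (i * int n, j * int n)) (int R)"
      using v(1) by (simp add: sball_def sup_dist_translate)
    then show ?thesis using v(2) good_site_shift unfolding closed_set_def by blast
  qed
  have "z = (z + (i * int n, j * int n)) + ((- i) * int n, (- j) * int n)" by (simp add: prod_eq_iff)
  then show ?thesis using imp by metis
qed

lemma good_site_depends:
  assumes "A \<inter> proj n ` sball z (int k) = B \<inter> proj n ` sball z (int k)" "k \<ge> 1"
  shows "good_site k N (lift n A) z = good_site k N (lift n B) z"
proof -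
  have "(fst z + s * a, snd z + t) \<in> lift n A \<longleftrightarrow> (fst z + s * a, snd z + t) \<in> lift n B"
    if "s \<in> {-1, 1}" "t \<in> {-1, 1}" "a \<in> {1..int k}" for s t a
  proof -
    have "(fst z + s * a, snd z + t) \<in> sball z (int k)" using that assms(2) by (auto simp: sball_def sup_dist_def)
    then have "proj n (fst z + s * a, snd z + t) \<in> proj n ` sball z (int k)" by blast
    then show ?thesis unfolding lift_def using assms(1) by blast
  qed
  then have "{a\<in>{1..int k}. (fst z + s * a, snd z + t) \<in> lift n A} = {a\<in>{1..int k}. (fst z + s * a, snd z + t) \<in> lift n B}"
    if "s \<in> {-1, 1}" "t \<in> {-1, 1}" for s t using that by blast
  then show ?thesis unfolding good_site_def by simp
qed

lemma closed_set_depends: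
  assumes "k \<ge> 1"
  shows "depends_on (proj n ` sball z (int R + int k)) (\<lambda>A. z \<in> closed_set n k N R A)"
  unfolding depends_on_def
proof (intro allI impI)
  fix A B assume AB: "A \<inter> proj n ` sball z (int R + int k) = B \<inter> proj n ` sball z (int R + int k)"
  have "good_site k N (lift n A) v = good_site k N (lift n B) v" if "v \<in> sball z (int R)" for v
  proof (rule good_site_depends[OF _ assms])
    have "sball v (int k) \<subseteq> sball z (int R + int k)"
      using that by (intro sball_mono) (simp add: sball_def sup_dist_sym)
    then show "A \<inter> proj n ` sball v (int k) = B \<inter> proj n ` sball v (int k)" using AB by blast
  qed
  then show "(z \<in> closed_set n k N R A) = (z \<in> closed_set n k N R B)" unfolding closed_set_def by blast
qed

text \<open>Union bound over the four half rows. Each consists of \<open>k\<close> distinct vertices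
  of the torus because \<open>k < n\<close>, and its number of active sites is estimated by the
  Chernoff bound.\<close>

lemma not_good_prob:
  assumes n: "k < n" and p: "0 \<le> p" "p \<le> 1"
  shows "expect (torus n) p (\<lambda>A. of_bool (\<not> good_site k N (lift n A) z)) \<le> 4 * exp (real N - 3 / 5 * p * real k)"
proof -
  define g where "g s t a = proj n (fst z + s * a, snd z + t)" for s t a
  define Seg where "Seg s t = g s t ` {1..int k}" for s t
  let ?I = "{-1, 1 :: int} \<times> {-1, 1 :: int}"
  have inj: "inj_on (g s t) {1..int k}" if "s \<in> {-1, 1}" for s t
  proof (rule inj_onI)
    fix a b assume ab: "a \<in> {1..int k}" "b \<in> {1..int k}" "g s t a = g s t b"
    then have "(fst z + s * a) mod int n = (fst z + s * b) mod int n" by (simp add: g_def proj_def)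
    then have "int n dvd s * a - s * b" by (simp add: mod_eq_dvd_iff)
    then have "int n dvd a - b" using that by (auto simp: dvd_diff_commute)
    moreover have "\<bar>a - b\<bar> < int n" using ab n by auto
    ultimately have "a - b = 0" using zdvd_imp_le[of "int n" "\<bar>a - b\<bar>"] by (cases "a = b") auto
    then show "a = b" by simp
  qed
  have SegV: "Seg s t \<subseteq> torus n" for s t unfolding Seg_def g_def using n proj_in_torus by (auto simp: g_def)
  have cardSeg: "card (Seg s t) = k" if "s \<in> {-1, 1}" for s t
    using card_image[OF inj[OF that]] by (simp add: Seg_def)
  have count: "card {a\<in>{1..int k}. (fst z + s * a, snd z + t) \<in> lift n A} = card (A \<inter> Seg s t)"
    if "s \<in> {-1, 1}" for s t A
  proof -
    have "A \<inter> Seg s t = g s t ` {a\<in>{1..int k}. (fst z + s * a, snd z + t) \<in> lift n A}"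
      by (auto simp: Seg_def lift_def g_def)
    moreover have "inj_on (g s t) {a\<in>{1..int k}. (fst z + s * a, snd z + t) \<in> lift n A}"
      using inj[OF that] by (rule inj_on_subset) auto
    ultimately show ?thesis by (simp add: card_image)
  qed
  have "expect (torus n) p (\<lambda>A. of_bool (\<not> good_site k N (lift n A) z))
      \<le> expect (torus n) p (\<lambda>A. \<Sum>(s, t)\<in>?I. of_bool (card (A \<inter> Seg s t) < N))"
  proof (rule expect_mono[OF finite_torus])
    fix A
    show "of_bool (\<not> good_site k N (lift n A) z) \<le> (\<Sum>(s, t)\<in>?I. of_bool (card (A \<inter> Seg s t) < N) :: real)"
    proof (cases "good_site k N (lift n A) z")
      case True
      then show ?thesis by (auto intro!: sum_nonneg)
    next
      case False
      then obtain s t where s: "s \<in> {-1, 1}" and t: "t \<in> {-1, 1}"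
        and st': "\<not> N \<le> card {a\<in>{1..int k}. (fst z + s * a, snd z + t) \<in> lift n A}"
        unfolding good_site_def by blast
      have st: "s \<in> {-1, 1}" "t \<in> {-1, 1}" "card (A \<inter> Seg s t) < N"
        using s t st' unfolding count[OF s] by auto
      have "(1 :: real) = (\<lambda>(s, t). of_bool (card (A \<inter> Seg s t) < N)) (s, t)" using st by simp
      also have "\<dots> \<le> (\<Sum>(s, t)\<in>?I. of_bool (card (A \<inter> Seg s t) < N))"
        by (rule member_le_sum) (use st in auto)
      finally show ?thesis using False by simp
    qed
  qed
  also have "\<dots> = (\<Sum>(s, t)\<in>?I. expect (torus n) p (\<lambda>A. of_bool (card (A \<inter> Seg s t) < N)))"
    unfolding case_prod_unfold by (rule expect_sum[OF finite_torus])
  also have "\<dots> \<le> (\<Sum>(s, t)\<in>?I. exp (real N - 3 / 5 * p * real k))"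
  proof (rule sum_mono)
    fix a assume a: "a \<in> ?I"
    obtain s t where st: "a = (s, t)" by (cases a)
    show "(case a of (s, t) \<Rightarrow> expect (torus n) p (\<lambda>A. of_bool (card (A \<inter> Seg s t) < N)))
        \<le> (case a of (s, t) \<Rightarrow> exp (real N - 3 / 5 * p * real k))"
      using chernoff_lower[OF finite_torus SegV p, of s t N] cardSeg[of s t] a unfolding st by auto
  qed
  also have "\<dots> = 4 * exp (real N - 3 / 5 * p * real k)" by (simp add: card_cartesian_product)
  finally show ?thesis .
qed

lemma closed_prob:
  assumes n: "k < n" and p: "0 \<le> p" "p \<le> 1"
  shows "expect (torus n) p (\<lambda>A. of_bool (z \<in> closed_set n k N R A))
    \<le> real ((2 * R + 1)\<^sup>2) * (4 * exp (real N - 3 / 5 * p * real k))"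
proof -
  have "expect (torus n) p (\<lambda>A. of_bool (z \<in> closed_set n k N R A))
      \<le> expect (torus n) p (\<lambda>A. \<Sum>v\<in>sball z (int R). of_bool (\<not> good_site k N (lift n A) v))"
  proof (rule expect_mono[OF finite_torus])
    fix A
    show "of_bool (z \<in> closed_set n k N R A) \<le> (\<Sum>v\<in>sball z (int R). of_bool (\<not> good_site k N (lift n A) v) :: real)"
    proof (cases "z \<in> closed_set n k N R A")
      case True
      then obtain v where v: "v \<in> sball z (int R)" "\<not> good_site k N (lift n A) v" by (auto simp: closed_set_def)
      have "(1 :: real) = of_bool (\<not> good_site k N (lift n A) v)" using v by simp
      also have "\<dots> \<le> (\<Sum>v\<in>sball z (int R). of_bool (\<not> good_site k N (lift n A) v))"
        by (rule member_le_sum) (use v finite_sball in auto)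
      finally show ?thesis using True by simp
    qed (simp add: sum_nonneg)
  qed
  also have "\<dots> = (\<Sum>v\<in>sball z (int R). expect (torus n) p (\<lambda>A. of_bool (\<not> good_site k N (lift n A) v)))"
    by (rule expect_sum[OF finite_torus])
  also have "\<dots> \<le> (\<Sum>v\<in>sball z (int R). 4 * exp (real N - 3 / 5 * p * real k))"
    by (intro sum_mono not_good_prob[OF assms])
  also have "\<dots> = real ((2 * R + 1)\<^sup>2) * (4 * exp (real N - 3 / 5 * p * real k))"
    by (simp add: card_sball)
  finally show ?thesis .
qed

section \<open>Chains of separated closed sites on the torus\<close>

definition chain_at :: "nat \<Rightarrow> point set \<Rightarrow> nat \<Rightarrow> point \<Rightarrow> bool" where
  "chain_at R C m v \<longleftrightarrow> (\<exists>vs. length vs = m \<and> separated_chain (int R) C (v # vs))"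

text \<open>The possible continuations of a chain from \<open>v\<close>, regardless of which sites
  are closed: a fixed finite set, suitable for a union bound.\<close>

definition step_lists :: "nat \<Rightarrow> nat \<Rightarrow> point \<Rightarrow> point list set" where
  "step_lists R m v = {vs. length vs = m \<and> successively (\<lambda>u v. sup_dist u v \<le> int R + 1) (v # vs)}"

lemma step_lists_card:
  "finite (step_lists R m v) \<and> card (step_lists R m v) \<le> ((2 * R + 3)\<^sup>2) ^ m"
proof (induction m arbitrary: v)
  case 0
  have "step_lists R 0 v = {[]}" by (auto simp: step_lists_def)
  then show ?case by simp
next
  case (Suc m)
  let ?B = "sball v (int R + 1)"
  have eq: "step_lists R (Suc m) v = (\<Union>u\<in>?B. (#) u ` step_lists R m u)"
  proof
    show "step_lists R (Suc m) v \<subseteq> (\<Union>u\<in>?B. (#) u ` step_lists R m u)"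
    proof
      fix vs assume vs: "vs \<in> step_lists R (Suc m) v"
      then obtain u us where "vs = u # us" by (cases vs) (auto simp: step_lists_def)
      moreover from this have "u \<in> ?B" "us \<in> step_lists R m u" using vs by (simp_all add: step_lists_def sball_def)
      ultimately show "vs \<in> (\<Union>u\<in>?B. (#) u ` step_lists R m u)" by blast
    qed
  qed (auto simp: step_lists_def sball_def)
  have "card (step_lists R (Suc m) v) \<le> (\<Sum>u\<in>?B. card ((#) u ` step_lists R m u))"
    unfolding eq by (rule card_UN_le[OF finite_sball])
  also have "\<dots> \<le> (\<Sum>u\<in>?B. ((2 * R + 3)\<^sup>2) ^ m)"
    using Suc.IH by (intro sum_mono) (meson card_image_le order_trans)
  also have "\<dots> = ((2 * R + 3)\<^sup>2) ^ Suc m"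
  proof -
    have "card ?B = (2 * R + 3)\<^sup>2" by (simp add: card_sball nat_add_distrib algebra_simps)
    then show ?thesis by simp
  qed
  finally show ?case using eq Suc.IH finite_sball by auto
qed

lemma step_lists_dist:
  assumes "vs \<in> step_lists R m v" "u \<in> set (v # vs)"
  shows "sup_dist v u \<le> int m * (int R + 1)"
  using assms
proof (induction m arbitrary: v vs)
  case 0
  then show ?case by (auto simp: step_lists_def)
next
  case (Suc m)
  obtain w us where vs: "vs = w # us" using Suc.prems(1) by (cases vs) (auto simp: step_lists_def)
  have us: "us \<in> step_lists R m w" and vw: "sup_dist v w \<le> int R + 1" using Suc.prems(1) by (auto simp: vs step_lists_def)
  show ?case
  proof (cases "u = v")
    case True then show ?thesis by simp
  next
    case False
    then have "u \<in> set (w # us)" using Suc.prems(2) vs by auto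
    then have "sup_dist w u \<le> int m * (int R + 1)" using Suc.IH us by blast
    then show ?thesis using vw sup_dist_triangle[of v u w] by (simp add: algebra_simps)
  qed
qed

lemma separated_chain_step_lists:
  "separated_chain (int R) C (v # vs) \<Longrightarrow> vs \<in> step_lists R (length vs) v"
  by (simp add: separated_chain_def step_lists_def)

text \<open>Union bound over the possible positions. A chain of \<open>m\<close> links has
  \<open>m + 1\<close> sites, whence the exponent \<open>Suc m\<close>. Whether a site is closed
  depends on a ball of radius \<open>R + k\<close>; for distances above \<open>R1\<close> these
  balls are disjoint, and the condition on \<open>m\<close> keeps the chain too short to wrap around
  the torus.\<close>

lemma chain_prob:
  assumes n: "k < n" and k: "k \<ge> 1" and p: "0 \<le> p" "p \<le> 1" and R1: "2 * (R + k) \<le> R1"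
    and m: "2 * m * (R1 + 1) + 2 * (R + k) < n"
    and \<delta>: "\<delta> = real ((2 * R + 1)\<^sup>2) * (4 * exp (real N - 3 / 5 * p * real k))"
  shows "expect (torus n) p (\<lambda>A. of_bool (chain_at R1 (closed_set n k N R A) m v)) \<le> real ((2 * R1 + 3)\<^sup>2) ^ m * \<delta> ^ Suc m"
proof -
  define Ls where "Ls = {vs\<in>step_lists R1 m v. sorted_wrt (\<lambda>u v. sup_dist u v > int R1) (v # vs)}"
  have finL: "finite Ls" and cardL: "card Ls \<le> ((2 * R1 + 3)\<^sup>2) ^ m"
  proof -
    have sub: "Ls \<subseteq> step_lists R1 m v" by (auto simp: Ls_def)
    then show "finite Ls" using step_lists_card finite_subset by blast
    have "card Ls \<le> card (step_lists R1 m v)" using sub step_lists_card by (intro card_mono) auto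
    then show "card Ls \<le> ((2 * R1 + 3)\<^sup>2) ^ m" using step_lists_card[of R1 m v] by simp
  qed
  have "expect (torus n) p (\<lambda>A. of_bool (chain_at R1 (closed_set n k N R A) m v))
      \<le> expect (torus n) p (\<lambda>A. \<Sum>vs\<in>Ls. of_bool (\<forall>u\<in>set (v # vs). u \<in> closed_set n k N R A))"
  proof (rule expect_mono[OF finite_torus])
    fix A
    show "of_bool (chain_at R1 (closed_set n k N R A) m v) \<le> (\<Sum>vs\<in>Ls. of_bool (\<forall>u\<in>set (v # vs). u \<in> closed_set n k N R A) :: real)"
    proof (cases "chain_at R1 (closed_set n k N R A) m v")
      case True
      then obtain vs where vs: "length vs = m" "separated_chain (int R1) (closed_set n k N R A) (v # vs)"
        unfolding chain_at_def by blast
      have vsL: "vs \<in> Ls" using vs separated_chain_step_lists[OF vs(2)] by (simp add: Ls_def separated_chain_def)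
      have "(1 :: real) = of_bool (\<forall>u\<in>set (v # vs). u \<in> closed_set n k N R A)"
        using vs(2) by (auto simp: separated_chain_def)
      also have "\<dots> \<le> (\<Sum>vs\<in>Ls. of_bool (\<forall>u\<in>set (v # vs). u \<in> closed_set n k N R A))"
        by (rule member_le_sum[OF vsL _ finL]) simp
      finally show ?thesis using True by simp
    qed (simp add: sum_nonneg)
  qed
  also have "\<dots> = (\<Sum>vs\<in>Ls. expect (torus n) p (\<lambda>A. of_bool (\<forall>u\<in>set (v # vs). u \<in> closed_set n k N R A)))"
    by (rule expect_sum[OF finite_torus])
  also have "\<dots> \<le> (\<Sum>vs\<in>Ls. \<delta> ^ Suc m)"
  proof (rule sum_mono)
    fix vs assume vs: "vs \<in> Ls"
    then have st: "vs \<in> step_lists R1 m v" by (simp add: Ls_def)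
    have "expect (torus n) p (\<lambda>A. of_bool (\<forall>u\<in>set (v # vs). u \<in> closed_set n k N R A)) \<le> \<delta> ^ length (v # vs)"
    proof (rule expect_list_indep[where S = "\<lambda>u. proj n ` sball u (int R + int k)", OF finite_torus])
      show "sorted_wrt (\<lambda>u v. proj n ` sball u (int R + int k) \<inter> proj n ` sball v (int R + int k) = {}) (v # vs)"
      proof (rule sorted_wrt_mono_rel[rotated])
        show "sorted_wrt (\<lambda>u v. sup_dist u v > int R1) (v # vs)" using vs by (simp add: Ls_def)
        fix a b assume a: "a \<in> set (v # vs)" and b: "b \<in> set (v # vs)" and ab: "int R1 < sup_dist a b"
        have "sup_dist a b \<le> 2 * (int m * (int R1 + 1))"
          using step_lists_dist[OF st a] step_lists_dist[OF st b] sup_dist_triangle[of a b v] sup_dist_sym[of a v] by linarith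
        moreover have "int (2 * m * (R1 + 1) + 2 * (R + k)) < int n" using m by (simp only: of_nat_less_iff)
        ultimately have "sup_dist a b + 2 * (int R + int k) < int n" by (simp add: algebra_simps)
        moreover have "int (2 * (R + k)) \<le> int R1" using R1 by (simp only: of_nat_le_iff)
        then have "2 * (int R + int k) < sup_dist a b" using ab by simp
        ultimately show "proj n ` sball a (int R + int k) \<inter> proj n ` sball b (int R + int k) = {}"
          by (intro proj_sball_disjoint)
      qed
      show "depends_on (proj n ` sball u (int R + int k)) (\<lambda>A. u \<in> closed_set n k N R A)" for u
        by (rule closed_set_depends[OF k])
      show "expect (torus n) p (\<lambda>A. of_bool (u \<in> closed_set n k N R A)) \<le> \<delta>" for u
        unfolding \<delta> by (rule closed_prob[OF n p])
    qed
    then show "expect (torus n) p (\<lambda>A. of_bool (\<forall>u\<in>set (v # vs). u \<in> closed_set n k N R A)) \<le> \<delta> ^ Suc m"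
      using st by (simp add: step_lists_def)
  qed
  also have "\<dots> = real (card Ls) * \<delta> ^ Suc m" by simp
  also have "\<dots> \<le> real (((2 * R1 + 3)\<^sup>2) ^ m) * \<delta> ^ Suc m"
    using cardL by (intro mult_right_mono) (auto simp: \<delta> simp del: of_nat_power)
  finally show ?thesis by simp
qed

lemma chain_at_depends:
  assumes "k \<ge> 1"
  shows "depends_on (proj n ` sball v (int m * (int R1 + 1) + (int R + int k))) (\<lambda>A. chain_at R1 (closed_set n k N R A) m v)"
  unfolding depends_on_def
proof (intro allI impI)
  let ?S = "proj n ` sball v (int m * (int R1 + 1) + (int R + int k))"
  fix A B assume AB: "A \<inter> ?S = B \<inter> ?S"
  have *: "u \<in> closed_set n k N R A \<longleftrightarrow> u \<in> closed_set n k N R B" if "vs \<in> step_lists R1 m v" "u \<in> set (v # vs)" for u vs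
  proof -
    have "sball u (int R + int k) \<subseteq> sball v (int m * (int R1 + 1) + (int R + int k))"
      using step_lists_dist[OF that] by (intro sball_mono) (simp add: sup_dist_sym)
    then have "A \<inter> proj n ` sball u (int R + int k) = B \<inter> proj n ` sball u (int R + int k)" using AB by blast
    then show ?thesis using closed_set_depends[OF assms, of n u R N] unfolding depends_on_def by (elim allE impE)
  qed
  have "separated_chain (int R1) (closed_set n k N R A) (v # vs) \<longleftrightarrow> separated_chain (int R1) (closed_set n k N R B) (v # vs)"
    if "length vs = m" for vs
  proof (cases "vs \<in> step_lists R1 m v")
    case True
    then have "set (v # vs) \<subseteq> closed_set n k N R A \<longleftrightarrow> set (v # vs) \<subseteq> closed_set n k N R B"
      using *[OF True] by blast
    then show ?thesis unfolding separated_chain_def by blast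
  next
    case False
    then show ?thesis using that separated_chain_step_lists by blast
  qed
  then show "chain_at R1 (closed_set n k N R A) m v = chain_at R1 (closed_set n k N R B) m v"
    unfolding chain_at_def by blast
qed

lemma chain_at_shift:
  assumes "chain_at R1 (closed_set n k N R A) m z"
  shows "chain_at R1 (closed_set n k N R A) m (proj n z)"
proof -
  obtain i j where ij: "z = proj n z + (i * int n, j * int n)" by (rule proj_decomp)
  define a where "a = ((- i) * int n, (- j) * int n)"
  have pz: "proj n z = z + a"
  proof -
    have "(proj n z + (i * int n, j * int n)) + a = proj n z" by (simp add: a_def prod_eq_iff)
    then show ?thesis using ij by metis
  qed
  obtain vs where vs: "length vs = m" "separated_chain (int R1) (closed_set n k N R A) (z # vs)"
    using assms unfolding chain_at_def by blast
  have sh: "u + a \<in> closed_set n k N R A \<longleftrightarrow> u \<in> closed_set n k N R A" for u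
    unfolding a_def by (rule closed_set_shift)
  have "separated_chain (int R1) (closed_set n k N R A) (map (\<lambda>u. u + a) (z # vs))"
    unfolding separated_chain_def
  proof (intro conjI)
    show "set (map (\<lambda>u. u + a) (z # vs)) \<subseteq> closed_set n k N R A"
    proof
      fix x assume "x \<in> set (map (\<lambda>u. u + a) (z # vs))"
      then obtain u where "u \<in> set (z # vs)" "x = u + a" unfolding set_map by blast
      then show "x \<in> closed_set n k N R A" using vs(2) sh unfolding separated_chain_def by blast
    qed
  qed (use vs(2) in \<open>simp_all only: separated_chain_def successively_map sorted_wrt_map sup_dist_translate\<close>)
  then show ?thesis unfolding chain_at_def pz using vs(1) by (intro exI[of _ "map (\<lambda>u. u + a) vs"]) simp
qed

text \<open>An island whose radius is witnessed by a chain of \<open>m\<close> links has at most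
  \<open>(3 * (m + 1) * (R + 1)) ^ 2\<close> sites, and the fourth power of this is the summand.
  Summing over \<open>m\<close> instead of taking the longest chain makes the expectation
  easy.\<close>

definition chain_weight :: "nat \<Rightarrow> point set \<Rightarrow> nat \<Rightarrow> point \<Rightarrow> real" where
  "chain_weight R C M v = (\<Sum>m<M. (3 * real (m + 1) * real (R + 1)) ^ 8 * of_bool (chain_at R C m v))"

text \<open>Since m + 1 is at most 2^m, its eighth power is at most 256^m, half of what 512^m
  allows.\<close>

lemma geometric_eighth_power:
  fixes q :: real assumes "0 \<le> q" "q \<le> 1 / 512"
  shows "(\<Sum>m<M. real (m + 1) ^ 8 * q ^ m) \<le> 2"
proof -
  have "real (m + 1) ^ 8 * q ^ m \<le> (1 / 2) ^ m" for m
  proof -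
    have "real (m + 1) \<le> 2 ^ m"
      using less_exp[of m] by (metis Suc_eq_plus1 Suc_leI of_nat_le_iff of_nat_numeral of_nat_power)
    then have "real (m + 1) ^ 8 \<le> (2 ^ m) ^ 8" by (intro power_mono) auto
    also have "\<dots> = 256 ^ m" by (simp add: power_mult[symmetric] mult.commute[of m] power_mult)
    finally have "real (m + 1) ^ 8 * q ^ m \<le> 256 ^ m * (1 / 512) ^ m" using assms by (intro mult_mono power_mono) auto
    also have "\<dots> = (1 / 2) ^ m" by (simp add: power_mult_distrib[symmetric])
    finally show ?thesis .
  qed
  then have "(\<Sum>m<M. real (m + 1) ^ 8 * q ^ m) \<le> (\<Sum>m<M. (1 / 2) ^ m)" by (intro sum_mono) auto
  also have "\<dots> \<le> 2"
  proof -
    have "(\<Sum>m<M. (1 / 2 :: real) ^ m) + 2 * (1 / 2) ^ M = 2" by (induction M) (auto simp: field_simps)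
    moreover have "0 \<le> 2 * (1 / 2 :: real) ^ M" by simp
    ultimately show ?thesis by linarith
  qed
  finally show ?thesis .
qed

lemma near_count:
  assumes "v \<in> torus n"
  shows "card {w\<in>torus n. proj n ` sball v (int L) \<inter> proj n ` sball w (int L) \<noteq> {}} \<le> (4 * L + 1)\<^sup>2"
proof -
  have "{w\<in>torus n. proj n ` sball v (int L) \<inter> proj n ` sball w (int L) \<noteq> {}} \<subseteq> proj n ` sball v (int (2 * L))"
  proof
    fix w assume w: "w \<in> {w\<in>torus n. proj n ` sball v (int L) \<inter> proj n ` sball w (int L) \<noteq> {}}"
    then obtain c where "c \<in> proj n ` sball v (int L)" "c \<in> proj n ` sball w (int L)" by blast
    then obtain a b where ab: "a \<in> sball v (int L)" "b \<in> sball w (int L)" "proj n a = proj n b" by blast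
    obtain i j where ij: "a = b + (i * int n, j * int n)" using proj_eqE[OF ab(3)] .
    let ?w = "w + (i * int n, j * int n)"
    have "sup_dist a ?w \<le> int L" using ab(2) by (simp add: ij sup_dist_translate sball_def sup_dist_sym)
    then have "sup_dist v ?w \<le> int (2 * L)" using ab(1) sup_dist_triangle[of v ?w a] by (simp add: sball_def)
    moreover have "proj n ?w = w" using w by (simp add: proj_shift proj_torus)
    ultimately show "w \<in> proj n ` sball v (int (2 * L))" by (metis (mono_tags) image_eqI mem_Collect_eq sball_def)
  qed
  then have "card {w\<in>torus n. proj n ` sball v (int L) \<inter> proj n ` sball w (int L) \<noteq> {}} \<le> card (proj n ` sball v (int (2 * L)))"
    using finite_sball by (intro card_mono) auto
  also have "\<dots> \<le> card (sball v (int (2 * L)))" using finite_sball by (rule card_image_le)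
  also have "\<dots> = (4 * L + 1)\<^sup>2" by (simp add: card_sball nat_mult_distrib)
  finally show ?thesis .
qed

text \<open>The weight at \<open>v\<close> depends only on the ball of radius \<open>L\<close>, so
  Chebyshev's inequality applies with few dependent pairs. Its mean is a geometric series in
  \<open>m\<close> with ratio at most 1/512, up to eighth powers.\<close>

lemma chain_weight_prob:
  assumes n: "k < n" and k: "k \<ge> 1" and p: "0 \<le> p" "p \<le> 1" and R1: "2 * (R + k) \<le> R1"
    and M: "2 * M * (R1 + 1) + 2 * (R + k) < n"
    and \<delta>: "\<delta> = real ((2 * R + 1)\<^sup>2) * (4 * exp (real N - 3 / 5 * p * real k))"
    and q: "real ((2 * R1 + 3)\<^sup>2) * \<delta> \<le> 1 / 512"
    and \<mu>: "2 * (3 * real (R1 + 1)) ^ 8 * \<delta> \<le> \<mu>" "\<mu> > 0"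
    and L: "L = M * (R1 + 1) + (R + k)" and B: "B = real M * (3 * real M * real (R1 + 1)) ^ 8"
  shows "expect (torus n) p (\<lambda>A. of_bool ((\<Sum>v\<in>torus n. chain_weight R1 (closed_set n k N R A) M v) \<ge> 2 * \<mu> * real (n\<^sup>2)))
    \<le> real ((4 * L + 1)\<^sup>2) * B\<^sup>2 / (\<mu>\<^sup>2 * real (n\<^sup>2))"
proof -
  define X where "X v A = chain_weight R1 (closed_set n k N R A) M v" for v A
  have \<delta>0: "\<delta> \<ge> 0" by (simp add: \<delta>)
  have "expect (torus n) p (\<lambda>A. of_bool ((\<Sum>v\<in>torus n. X v A) \<ge> 2 * \<mu> * real (card (torus n))))
    \<le> real ((4 * L + 1)\<^sup>2) * B\<^sup>2 / (\<mu>\<^sup>2 * real (card (torus n)))"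
  proof (rule chebyshev_local[where S = "\<lambda>v. proj n ` sball v (int L)", OF finite_torus finite_torus])
    show "torus n \<noteq> {}" using n by (auto simp: torus_def)
    show "0 \<le> X v A \<and> X v A \<le> B" for v A
    proof
      show "0 \<le> X v A" unfolding X_def chain_weight_def by (intro sum_nonneg) auto
      have "X v A \<le> (\<Sum>m<M. (3 * real M * real (R1 + 1)) ^ 8)"
        unfolding X_def chain_weight_def
      proof (rule sum_mono)
        fix m assume "m \<in> {..<M}"
        then have "(3 * real (m + 1) * real (R1 + 1)) ^ 8 \<le> (3 * real M * real (R1 + 1)) ^ 8"
          by (intro power_mono mult_right_mono mult_left_mono) auto
        moreover have "0 \<le> (3 * real M * real (R1 + 1)) ^ 8" by simp
        ultimately show "(3 * real (m + 1) * real (R1 + 1)) ^ 8 * of_bool (chain_at R1 (closed_set n k N R A) m v)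
            \<le> (3 * real M * real (R1 + 1)) ^ 8" by (cases "chain_at R1 (closed_set n k N R A) m v") simp_all
      qed
      then show "X v A \<le> B" by (simp add: B)
    qed
    show "0 \<le> B" by (simp add: B)
    show "depends_on (proj n ` sball v (int L)) (X v)" for v
      unfolding depends_on_def
    proof (intro allI impI)
      fix A A' assume AA: "A \<inter> proj n ` sball v (int L) = A' \<inter> proj n ` sball v (int L)"
      have "chain_at R1 (closed_set n k N R A) m v = chain_at R1 (closed_set n k N R A') m v" if "m < M" for m
      proof -
        have "int m * (int R1 + 1) \<le> int M * (int R1 + 1)" using that by (intro mult_right_mono) auto
        then have "sball v (int m * (int R1 + 1) + (int R + int k)) \<subseteq> sball v (int L)"
          by (intro sball_mono) (simp add: L algebra_simps)
        then have "A \<inter> proj n ` sball v (int m * (int R1 + 1) + (int R + int k)) = A' \<inter> proj n ` sball v (int m * (int R1 + 1) + (int R + int k))"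
          using AA by blast
        then show ?thesis using chain_at_depends[OF k, of n v m R1 R N] unfolding depends_on_def by (elim allE impE)
      qed
      then show "X v A = X v A'" unfolding X_def chain_weight_def by (intro sum.cong) auto
    qed
    show "expect (torus n) p (X v) \<le> \<mu>" for v
    proof -
      have "expect (torus n) p (X v) = (\<Sum>m<M. expect (torus n) p (\<lambda>A. (3 * real (m + 1) * real (R1 + 1)) ^ 8 * of_bool (chain_at R1 (closed_set n k N R A) m v)))"
        unfolding X_def chain_weight_def by (rule expect_sum[OF finite_torus])
      also have "\<dots> \<le> (\<Sum>m<M. ((3 * real (R1 + 1)) ^ 8 * \<delta>) * (real (m + 1) ^ 8 * (real ((2 * R1 + 3)\<^sup>2) * \<delta>) ^ m))"
      proof (rule sum_mono)
        fix m assume m: "m \<in> {..<M}"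
        have "2 * m * (R1 + 1) \<le> 2 * M * (R1 + 1)" using m by (intro mult_right_mono) auto
        then have m2: "2 * m * (R1 + 1) + 2 * (R + k) < n" using M by linarith
        have "expect (torus n) p (\<lambda>A. (3 * real (m + 1) * real (R1 + 1)) ^ 8 * of_bool (chain_at R1 (closed_set n k N R A) m v))
            = (3 * real (m + 1) * real (R1 + 1)) ^ 8 * expect (torus n) p (\<lambda>A. of_bool (chain_at R1 (closed_set n k N R A) m v))"
          by (rule expect_cmult[OF finite_torus])
        also have "\<dots> \<le> (3 * real (m + 1) * real (R1 + 1)) ^ 8 * (real ((2 * R1 + 3)\<^sup>2) ^ m * \<delta> ^ Suc m)"
          by (intro mult_left_mono chain_prob[OF n k p R1 m2 \<delta>]) auto
        also have "\<dots> = ((3 * real (R1 + 1)) ^ 8 * \<delta>) * (real (m + 1) ^ 8 * (real ((2 * R1 + 3)\<^sup>2) * \<delta>) ^ m)"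
        proof -
          have e: "3 * real (m + 1) * real (R1 + 1) = 3 * real (R1 + 1) * real (m + 1)" by (simp only: mult_ac)
          show ?thesis unfolding e power_mult_distrib[of "3 * real (R1 + 1)"] power_mult_distrib[of "real ((2 * R1 + 3)\<^sup>2)"]
            by (simp only: power_Suc mult_ac)
        qed
        finally show "expect (torus n) p (\<lambda>A. (3 * real (m + 1) * real (R1 + 1)) ^ 8 * of_bool (chain_at R1 (closed_set n k N R A) m v))
            \<le> ((3 * real (R1 + 1)) ^ 8 * \<delta>) * (real (m + 1) ^ 8 * (real ((2 * R1 + 3)\<^sup>2) * \<delta>) ^ m)" .
      qed
      also have "\<dots> = ((3 * real (R1 + 1)) ^ 8 * \<delta>) * (\<Sum>m<M. real (m + 1) ^ 8 * (real ((2 * R1 + 3)\<^sup>2) * \<delta>) ^ m)"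
        by (simp only: sum_distrib_left)
      also have "\<dots> \<le> ((3 * real (R1 + 1)) ^ 8 * \<delta>) * 2"
        using \<delta>0 q by (intro mult_left_mono geometric_eighth_power) auto
      finally show ?thesis using \<mu>(1) by (simp add: mult_ac)
    qed
    show "card {w\<in>torus n. proj n ` sball v (int L) \<inter> proj n ` sball w (int L) \<noteq> {}} \<le> (4 * L + 1)\<^sup>2"
      if "v \<in> torus n" for v using near_count[OF that] .
  qed (use \<mu> in auto)
  then show ?thesis unfolding X_def card_torus .
qed

section \<open>Islands of the torus\<close>

text \<open>The deterministic consequences of a typical first set \<open>A\<close>. Without chains
  of \<open>M\<close> links all closed clusters have radius at most \<open>M * (R1 + 1)\<close>, and
  \<open>n_large\<close> makes islands small enough to embed into the torus.\<close>

locale nice_configuration =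
  fixes n k N R R1 M :: nat and A :: "point set" and C :: "point set"
  assumes C_def: "C = closed_set n k N R A"
    and no_long_chain: "\<And>v. v \<in> torus n \<Longrightarrow> \<not> chain_at R1 C M v"
    and n_large: "2 * M * (R1 + 1) < n"
begin

lemma n_pos: "n > 0" using n_large by simp

lemma no_chain: "\<not> chain_at R1 C M z"
  using chain_at_shift[of R1 n k N R A M z] no_long_chain[OF proj_in_torus[OF n_pos]] unfolding C_def by blast

lemma reach_chain:
  assumes "reach C u z" "sup_dist u z \<ge> int m * (int R1 + 1)"
  shows "chain_at R1 C m u"
  using separated_chain_exists[OF assms] unfolding chain_at_def by simp

sublocale closed_sites C "int M * (int R1 + 1)"
proof
  show "sup_dist c t \<le> int M * (int R1 + 1)" if "reach C c t" for c t
    using reach_chain[OF that, of M] no_chain by fastforce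
  show "0 \<le> int M * (int R1 + 1)" by simp
qed

lemma C_shift: "z + (i * int n, j * int n) \<in> C \<longleftrightarrow> z \<in> C"
  unfolding C_def by (rule closed_set_shift)

definition S :: "point set" where
  "S = (SOME S. (\<exists>s. S = {v. reach (- C) s v}) \<and> \<not> sbounded S)"

lemma S_props: obtains s where "S = {v. reach (- C) s v}" "\<not> sbounded S"
proof -
  have "\<exists>S. (\<exists>s. S = {v. reach (- C) s v}) \<and> \<not> sbounded S"
  proof -
    obtain s S where "S = {v. reach (- C) s v}" "\<not> sbounded S" by (rule unbounded_component_exists)
    then show ?thesis by blast
  qed
  then have "(\<exists>s. S = {v. reach (- C) s v}) \<and> \<not> sbounded S" unfolding S_def by (rule someI_ex)
  then show ?thesis using that by blast
qed

lemma S_unbounded: "\<not> sbounded S" by (rule S_props)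

lemma S_connected: "sconnected S"
  by (rule S_props) (simp add: sconnected_component)

lemma S_open: "S \<inter> C = {}"
proof (rule S_props)
  fix s assume "S = {v. reach (- C) s v}"
  then show ?thesis using reach_in(2)[of "- C" s] by blast
qed

lemma S_dense: obtains v where "v \<in> S" "v \<in> sball z (int M * (int R1 + 1) + 1)"
proof (rule S_props)
  fix s assume "S = {v. reach (- C) s v}" "\<not> sbounded S"
  then show ?thesis using unbounded_component_dense[of S s z] that by blast
qed

text \<open>Closed sites are periodic, so a translate of \<open>S\<close> by a period is again an
  unbounded open component, and there is only one.\<close>

lemma S_shift: "z + (i * int n, j * int n) \<in> S \<longleftrightarrow> z \<in> S"
proof -
  have imp: "z + (i * int n, j * int n) \<in> S" if z: "z \<in> S" for z i j
  proof -
    obtain s where s: "S = {v. reach (- C) s v}" by (rule S_props)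
    define a where "a = (i * int n, j * int n)"
    define S' where "S' = {v. reach (- C) (a + s) v}"
    have sh: "a + u \<in> - C" if "u \<in> - C" for u
      using that C_shift[of u i j] by (simp add: a_def add.commute)
    have img: "a + u \<in> S'" if "u \<in> S" for u
      using reach_translate[of "- C" s u a "- C"] that sh unfolding S'_def s by blast
    have "\<not> sbounded S'"
    proof
      assume "sbounded S'"
      then obtain c m where cm: "S' \<subseteq> sball c m" by (auto simp: sbounded_def)
      have "S \<subseteq> sball (c - a) m"
      proof
        fix u assume "u \<in> S"
        then have "a + u \<in> sball c m" using img cm by blast
        then have "sup_dist c (a + u) \<le> m" by (simp add: sball_def)
        then show "u \<in> sball (c - a) m" by (simp add: sball_def sup_dist_def algebra_simps)
      qed
      then show False using S_unbounded unfolding sbounded_def by blast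
    qed
    then have "S' = S" by (intro unbounded_component_unique[OF s S_unbounded S'_def])
    then show ?thesis using img[OF z] by (simp add: a_def add.commute)
  qed
  have "z = (z + (i * int n, j * int n)) + ((- i) * int n, (- j) * int n)" by (simp add: prod_eq_iff)
  then show ?thesis using imp by metis
qed

definition isl :: "point \<Rightarrow> point set" where
  "isl w = {v. reach (- S) w v}"

definition islands :: "point set set" where
  "islands = {proj n ` isl w | w. w \<notin> S}"

lemma isl_shift: "isl (w + (i * int n, j * int n)) = (\<lambda>v. v + (i * int n, j * int n)) ` isl w"
proof -
  have imp: "v + (i * int n, j * int n) \<in> isl (w + (i * int n, j * int n))" if "v \<in> isl w" for v w i j
    using reach_translate[of "- S" w v "(i * int n, j * int n)" "- S"] that S_shift
    by (simp add: isl_def add.commute)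
  show ?thesis
  proof
    show "(\<lambda>v. v + (i * int n, j * int n)) ` isl w \<subseteq> isl (w + (i * int n, j * int n))" using imp by blast
    show "isl (w + (i * int n, j * int n)) \<subseteq> (\<lambda>v. v + (i * int n, j * int n)) ` isl w"
    proof
      fix v assume v: "v \<in> isl (w + (i * int n, j * int n))"
      have e: "w + (i * int n, j * int n) + ((- i) * int n, (- j) * int n) = w" by (simp add: prod_eq_iff)
      have "v + ((- i) * int n, (- j) * int n) \<in> isl w"
        using imp[OF v, of "- i" "- j"] unfolding e .
      moreover have "v = v + ((- i) * int n, (- j) * int n) + (i * int n, j * int n)" by (simp add: prod_eq_iff)
      ultimately show "v \<in> (\<lambda>v. v + (i * int n, j * int n)) ` isl w" by blast
    qed
  qed
qed

lemma isl_eq: "v \<in> isl w \<Longrightarrow> isl v = isl w"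
  unfolding isl_def using reach_sym reach_trans by blast

text \<open>If the projections of two planar islands meet, one of them is a periodic translate of
  the other, and both have the same projection.\<close>

lemma islands_disjoint:
  assumes "T \<in> islands" "T' \<in> islands" "T \<inter> T' \<noteq> {}" shows "T = T'"
proof -
  obtain w w' where w: "T = proj n ` isl w" "T' = proj n ` isl w'" using assms unfolding islands_def by blast
  then obtain a b where ab: "a \<in> isl w" "b \<in> isl w'" "proj n a = proj n b" using assms(3) by blast
  obtain i j where ij: "a = b + (i * int n, j * int n)" using proj_eqE[OF ab(3)] .
  have "isl w = isl (b + (i * int n, j * int n))" using isl_eq[OF ab(1)] ij by simp
  also have "\<dots> = (\<lambda>v. v + (i * int n, j * int n)) ` isl w'" unfolding isl_shift isl_eq[OF ab(2)] ..
  finally have "proj n ` isl w = proj n ` isl w'" by (simp add: image_image proj_shift)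
  then show ?thesis using w by simp
qed

lemma islands_subset:
  assumes "T \<in> islands" shows "T \<noteq> {}" "T \<subseteq> torus n"
proof -
  obtain w where w: "T = proj n ` isl w" "w \<notin> S" using assms unfolding islands_def by blast
  have "w \<in> isl w" using w(2) by (simp add: isl_def reach_refl)
  then show "T \<noteq> {}" using w(1) by blast
  show "T \<subseteq> torus n" using w(1) proj_in_torus[OF n_pos] by blast
qed

lemma isl_radius: assumes "w \<notin> S" obtains c where "isl w \<subseteq> sball c (int M * (int R1 + 1))"
proof (rule S_props)
  fix s assume "S = {v. reach (- C) s v}" "\<not> sbounded S"
  then show ?thesis using island_radius[of S s w] assms that unfolding isl_def by blast
qed

lemma proj_inj_isl: assumes "w \<notin> S" shows "inj_on (proj n) (isl w)"
proof (rule inj_onI)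
  obtain c where c: "isl w \<subseteq> sball c (int M * (int R1 + 1))" using isl_radius[OF assms] .
  fix a b assume ab: "a \<in> isl w" "b \<in> isl w" "proj n a = proj n b"
  obtain i j where ij: "a = b + (i * int n, j * int n)" using proj_eqE[OF ab(3)] .
  have "sup_dist a b \<le> 2 * (int M * (int R1 + 1))"
    using subsetD[OF c ab(1)] subsetD[OF c ab(2)] sup_dist_triangle[of a b c] sup_dist_sym[of a c] by (simp add: sball_def)
  also have "\<dots> < int n"
  proof -
    have "int (2 * M * (R1 + 1)) < int n" using n_large by (simp only: of_nat_less_iff)
    then show ?thesis by (simp add: algebra_simps)
  qed
  finally have lt: "sup_dist a b < int n" .
  have "\<bar>i * int n\<bar> < int n" "\<bar>j * int n\<bar> < int n" using lt by (auto simp: ij sup_dist_def)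
  then have "\<bar>i\<bar> * int n < 1 * int n" "\<bar>j\<bar> * int n < 1 * int n" by (auto simp: abs_mult)
  then have "\<bar>i\<bar> < 1" "\<bar>j\<bar> < 1" by (meson mult_right_less_imp_less of_nat_0_le_iff)+
  then show "a = b" using ij by (simp add: prod_eq_iff)
qed

text \<open>Along the closed path from \<open>t0\<close> to the farthest point \<open>t\<close>
  there is a chain whose number of links is the radius divided by \<open>R1 + 1\<close>, rounded
  down. As \<open>t0\<close> lies in the island, different islands charge their sizes to different
  vertices of the torus.\<close>

lemma island_weight:
  assumes "T \<in> islands"
  shows "\<exists>v\<in>T. real (card T) ^ 4 \<le> chain_weight R1 C M v"
proof -
  obtain w where w: "T = proj n ` isl w" "w \<notin> S" using assms unfolding islands_def by blast
  obtain t0 t where t0: "reach (- S) w t0" and t: "reach C t0 t" and sub: "isl w \<subseteq> sball t0 (sup_dist t0 t)"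
  proof (rule S_props)
    fix s assume s: "S = {v. reach (- C) s v}" "\<not> sbounded S"
    show ?thesis by (rule island[OF s w(2)]) (use that in \<open>simp add: isl_def\<close>)
  qed
  define D where "D = nat (sup_dist t0 t)"
  define m where "m = D div (R1 + 1)"
  have D: "int D = sup_dist t0 t" using sup_dist_nonneg by (simp add: D_def)
  have chain: "chain_at R1 C i t0" if "i \<le> m" for i
  proof (rule reach_chain[OF t])
    have "i * (R1 + 1) \<le> m * (R1 + 1)" using that by (rule mult_le_mono1)
    also have "\<dots> \<le> D" unfolding m_def by (rule div_times_less_eq_dividend)
    finally have "int (i * (R1 + 1)) \<le> int D" by (simp only: of_nat_le_iff)
    then show "sup_dist t0 t \<ge> int i * (int R1 + 1)" unfolding D by (simp add: algebra_simps)
  qed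
  have mM: "m < M" using chain[of M] no_chain by (metis not_le)
  have "D < (m + 1) * (R1 + 1)" unfolding m_def using dividend_less_div_times[of "R1 + 1" D] by simp
  then have "2 * D + 1 \<le> 3 * ((m + 1) * (R1 + 1))" by linarith
  then have "2 * D + 1 \<le> 3 * (m + 1) * (R1 + 1)" by (simp only: mult.assoc)
  then have Dle: "(2 * D + 1)\<^sup>2 \<le> (3 * (m + 1) * (R1 + 1))\<^sup>2" by (rule power_mono) simp
  have "card T \<le> card (isl w)" unfolding w(1) using sub finite_sball finite_subset by (intro card_image_le) blast
  also have "\<dots> \<le> card (sball t0 (sup_dist t0 t))" using sub finite_sball by (rule card_mono[rotated])
  also have "\<dots> = (2 * D + 1)\<^sup>2" using sup_dist_nonneg by (simp add: card_sball D_def)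
  also note Dle
  finally have "real (card T) \<le> real ((3 * (m + 1) * (R1 + 1))\<^sup>2)" by (simp only: of_nat_le_iff)
  then have "real (card T) ^ 4 \<le> real ((3 * (m + 1) * (R1 + 1))\<^sup>2) ^ 4" by (intro power_mono) auto
  also have "\<dots> = (3 * real (m + 1) * real (R1 + 1)) ^ 8"
    by (simp only: of_nat_power of_nat_mult of_nat_numeral power_mult[symmetric]) simp
  also have "\<dots> = (3 * real (m + 1) * real (R1 + 1)) ^ 8 * of_bool (chain_at R1 C m (proj n t0))"
    using chain_at_shift[of R1 n k N R A m t0] chain[of m] unfolding C_def by simp
  also have "\<dots> \<le> chain_weight R1 C M (proj n t0)"
    unfolding chain_weight_def
    by (rule member_le_sum[where f = "\<lambda>m. (3 * real (m + 1) * real (R1 + 1)) ^ 8 * of_bool (chain_at R1 C m (proj n t0))"]) (use mM in auto)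
  finally show ?thesis using t0 unfolding w(1) isl_def by blast
qed

lemma islands_fourth_moment:
  "(\<Sum>T\<in>islands. real (card T) ^ 4) \<le> (\<Sum>v\<in>torus n. chain_weight R1 C M v)"
proof -
  have "\<forall>T\<in>islands. \<exists>v. v \<in> T \<and> real (card T) ^ 4 \<le> chain_weight R1 C M v" using island_weight by blast
  from bchoice[OF this] obtain f where f: "\<And>T. T \<in> islands \<Longrightarrow> f T \<in> T \<and> real (card T) ^ 4 \<le> chain_weight R1 C M (f T)" by blast
  have inj: "inj_on f islands"
  proof (rule inj_onI)
    fix T T' assume T: "T \<in> islands" "T' \<in> islands" "f T = f T'"
    then have "f T \<in> T \<inter> T'" using f[OF T(1)] f[OF T(2)] by simp
    then show "T = T'" using islands_disjoint[OF T(1,2)] by blast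
  qed
  have "(\<Sum>T\<in>islands. real (card T) ^ 4) \<le> (\<Sum>T\<in>islands. chain_weight R1 C M (f T))"
    by (rule sum_mono) (use f in blast)
  also have "\<dots> = (\<Sum>v\<in>f ` islands. chain_weight R1 C M v)" using inj by (simp add: sum.reindex)
  also have "\<dots> \<le> (\<Sum>v\<in>torus n. chain_weight R1 C M v)"
  proof (rule sum_mono2[OF finite_torus])
    show "f ` islands \<subseteq> torus n" using f islands_subset(2) by blast
    show "0 \<le> chain_weight R1 C M v" for v unfolding chain_weight_def by (intro sum_nonneg) auto
  qed
  finally show ?thesis .
qed

end

section \<open>The majority process on the torus\<close>

lemma maj_step_mono_chain: "s \<le> t \<Longrightarrow> (maj_step r G ^^ s) A \<subseteq> (maj_step r G ^^ t) A"
proof (induction t rule: dec_induct)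
  case (step t)
  have "(maj_step r G ^^ t) A \<subseteq> (maj_step r G ^^ Suc t) A" by (auto simp: maj_step_def)
  then show ?case using step.IH by blast
qed simp

lemma maj_final_superset: "A \<subseteq> maj_final r G A"
proof -
  have "(maj_step r G ^^ 0) A \<subseteq> maj_final r G A" unfolding maj_final_def by blast
  then show ?thesis by simp
qed

lemma maj_final_subset: assumes "A \<subseteq> verts G" shows "maj_final r G A \<subseteq> verts G"
proof -
  have "(maj_step r G ^^ t) A \<subseteq> verts G" for t
    by (induction t) (use assms in \<open>auto simp: maj_step_def\<close>)
  then show ?thesis unfolding maj_final_def by blast
qed

text \<open>The finitely many neighbours that ever become active are all active at some common time;
  the vertex follows in the next round.\<close>

lemma maj_final_stable:
  assumes "finite (nbrs G v)" "v \<in> verts G"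
    "int (card (nbrs G v \<inter> maj_final r G A)) - int (card (nbrs G v - maj_final r G A)) \<ge> r"
  shows "v \<in> maj_final r G A"
proof -
  let ?B = "\<lambda>t. (maj_step r G ^^ t) A"
  have "\<exists>t. X \<subseteq> ?B t" if "finite X" "X \<subseteq> maj_final r G A" for X
    using that
  proof induction
    case (insert x X)
    then obtain t where t: "X \<subseteq> ?B t" by auto
    obtain s where s: "x \<in> ?B s" using insert.prems unfolding maj_final_def by blast
    have "?B t \<subseteq> ?B (max s t)" "?B s \<subseteq> ?B (max s t)" by (rule maj_step_mono_chain, simp)+
    then show ?case using t s by blast
  qed simp
  then obtain t where "nbrs G v \<inter> maj_final r G A \<subseteq> ?B t" using assms(1) by (metis Int_lower2 finite_Int)
  moreover have "?B t \<subseteq> maj_final r G A" unfolding maj_final_def by blast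
  ultimately have "nbrs G v \<inter> maj_final r G A = nbrs G v \<inter> ?B t" "nbrs G v - maj_final r G A = nbrs G v - ?B t" by blast+
  then have "v \<in> ?B (Suc t)" using assms by (simp add: maj_step_def)
  then show ?thesis unfolding maj_final_def by blast
qed

lemma proj_add: "proj n (proj n a + b) = proj n (a + b)"
  by (simp add: proj_def mod_add_left_eq)

lemma nbhd_uminus: "w \<in> nbhd k \<Longrightarrow> - w \<in> nbhd k" by (auto simp: nbhd_def)

text \<open>An edge does not remember which endpoint it was generated from; the symmetry of
  \<open>nbhd k\<close> under negation repairs this.\<close>

lemma L_edges_iff:
  assumes u: "u \<in> torus n" and v: "v \<in> torus n"
  shows "{u, v} \<in> L_edges n k \<longleftrightarrow> (\<exists>w\<in>nbhd k. u = proj n (v + w))"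
proof
  assume "{u, v} \<in> L_edges n k"
  then obtain x y a b where e: "{u, v} = {(x, y), ((x + a) mod int n, (y + b) mod int n)}"
    and ab: "a \<in> {- int k..int k}" "b \<in> {-1, 1}" unfolding L_edges_def by blast
  have w: "(a, b) \<in> nbhd k" using ab by (auto simp: nbhd_def)
  have p: "((x + a) mod int n, (y + b) mod int n) = proj n ((x, y) + (a, b))" by (simp add: proj_def)
  from e consider "v = (x, y)" "u = proj n ((x, y) + (a, b))" | "u = (x, y)" "v = proj n ((x, y) + (a, b))"
    unfolding p by (auto simp: doubleton_eq_iff)
  then show "\<exists>w\<in>nbhd k. u = proj n (v + w)"
  proof cases
    case 1 then show ?thesis using w by blast
  next
    case 2
    have "proj n (v + - (a, b)) = proj n ((x, y) + (a, b) + - (a, b))" unfolding 2 by (rule proj_add)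
    also have "(x, y) + (a, b) + - (a, b) = u" using 2 by simp
    finally have "u = proj n (v + - (a, b))" using proj_torus[OF u] by simp
    then show ?thesis using nbhd_uminus[OF w] by blast
  qed
next
  assume "\<exists>w\<in>nbhd k. u = proj n (v + w)"
  then obtain w where w: "w \<in> nbhd k" "u = proj n (v + w)" by blast
  obtain x y a b where e: "v = (x, y)" "w = (a, b)" by (cases v; cases w)
  have "{u, v} = {(x, y), ((x + a) mod int n, (y + b) mod int n)}" using w e by (auto simp: proj_def)
  moreover have "a \<in> {- int k..int k}" "b \<in> {-1, 1}" using w e by (auto simp: nbhd_def)
  ultimately show "{u, v} \<in> L_edges n k" unfolding L_edges_def using v e by blast
qed

locale torus_graph =
  fixes n k r :: nat and Ms :: "point set set list" and G :: "point graph"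
  assumes Ms: "Ms \<in> matching_tuples n k r" and G: "G = (torus n, L_edges n k \<union> \<Union> (set Ms))"
    and n: "2 * k < n" "2 < n"
begin

lemma matching: "i < r \<Longrightarrow> perfect_matching (torus n) (Ms ! i)"
  using Ms by (simp add: matching_tuples_def)

lemma nbrs_eq:
  assumes v: "v \<in> torus n"
  shows "nbrs G v = (\<lambda>w. proj n (v + w)) ` nbhd k \<union> (\<lambda>i. mate (Ms ! i) v) ` {..<r}"
proof -
  have len: "length Ms = r" using Ms by (simp add: matching_tuples_def)
  have L: "{u, v} \<in> L_edges n k \<longleftrightarrow> u \<in> (\<lambda>w. proj n (v + w)) ` nbhd k" if "u \<in> torus n" for u
    using L_edges_iff[OF that v] by blast
  have M: "{u, v} \<in> Ms ! i \<longleftrightarrow> u = mate (Ms ! i) v" if "i < r" for u i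
  proof -
    have c: "{u, v} = {v, u}" by blast
    show ?thesis unfolding c using mate(1,5)[OF matching[OF that] v] by blast
  qed
  have U: "{u, v} \<in> \<Union> (set Ms) \<longleftrightarrow> u \<in> (\<lambda>i. mate (Ms ! i) v) ` {..<r}" for u
  proof -
    have "{u, v} \<in> \<Union> (set Ms) \<longleftrightarrow> (\<exists>i<r. {u, v} \<in> Ms ! i)" using len by (fastforce simp: in_set_conv_nth)
    also have "\<dots> \<longleftrightarrow> (\<exists>i<r. u = mate (Ms ! i) v)" using M[where u = u] by blast
    finally show ?thesis by blast
  qed
  have "u \<in> torus n" if "u \<in> (\<lambda>i. mate (Ms ! i) v) ` {..<r}" for u using that mate(2)[OF matching v] by auto
  moreover have "u \<in> torus n" if "u \<in> (\<lambda>w. proj n (v + w)) ` nbhd k" for u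
  proof -
    have "n > 0" using n by simp
    then show ?thesis using that proj_in_torus by blast
  qed
  ultimately show ?thesis unfolding nbrs_def G verts_def edges_def fst_conv snd_conv using L U by blast
qed

lemma card_nbrs:
  assumes v: "v \<in> torus n"
  shows "card (nbrs G v) = 4 * k + 2 + r"
proof -
  have inj1: "inj_on (\<lambda>w. proj n (v + w)) (nbhd k)"
  proof (rule inj_onI)
    fix w w' assume w: "w \<in> nbhd k" "w' \<in> nbhd k" "proj n (v + w) = proj n (v + w')"
    obtain i j where "v + w = v + w' + (i * int n, j * int n)" using proj_eqE[OF w(3)] .
    then have d: "fst w - fst w' = i * int n" "snd w - snd w' = j * int n" by (auto simp: prod_eq_iff)
    have "\<bar>i * int n\<bar> < int n" "\<bar>j * int n\<bar> < int n"
      using w(1,2) n unfolding d[symmetric] by (auto simp: nbhd_def)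
    then have "\<bar>i\<bar> * int n < 1 * int n" "\<bar>j\<bar> * int n < 1 * int n" by (auto simp: abs_mult)
    then have "\<bar>i\<bar> < 1" "\<bar>j\<bar> < 1" by (meson mult_right_less_imp_less of_nat_0_le_iff)+
    then show "w = w'" using d by (simp add: prod_eq_iff)
  qed
  have inj2: "inj_on (\<lambda>i. mate (Ms ! i) v) {..<r}"
  proof (rule inj_onI)
    fix i j assume ij: "i \<in> {..<r}" "j \<in> {..<r}" "mate (Ms ! i) v = mate (Ms ! j) v"
    have "{v, mate (Ms ! i) v} \<in> Ms ! i" "{v, mate (Ms ! i) v} \<in> Ms ! j"
      using mate(1)[OF matching v, of i] mate(1)[OF matching v, of j] ij by auto
    then show "i = j" using Ms ij unfolding matching_tuples_def by blast
  qed
  have "(\<lambda>w. proj n (v + w)) ` nbhd k \<inter> (\<lambda>i. mate (Ms ! i) v) ` {..<r} = {}"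
  proof (rule ccontr)
    assume "\<not> ?thesis"
    then obtain w i where wi: "w \<in> nbhd k" "i < r" "mate (Ms ! i) v = proj n (v + w)" by auto
    then have "{mate (Ms ! i) v, v} \<in> L_edges n k" using L_edges_iff[OF mate(2)[OF matching[OF wi(2)] v] v] by blast
    moreover have "{mate (Ms ! i) v, v} = {v, mate (Ms ! i) v}" by blast
    then have "{mate (Ms ! i) v, v} \<in> Ms ! i" using mate(1)[OF matching[OF wi(2)] v] by simp
    ultimately show False using Ms wi(2) unfolding matching_tuples_def by blast
  qed
  then show ?thesis unfolding nbrs_eq[OF v]
    by (simp add: card_Un_disjoint card_image[OF inj1] card_image[OF inj2] card_nbhd)
qed

text \<open>Among the 4k + 2 + r neighbours of an inactive vertex the active ones exceed the
  inactive ones by less than r, so at least 2k + 2 are inactive. The count is split into lattice and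
  matching neighbours.\<close>

lemma inactive_nbrs:
  assumes F: "F = maj_final (int r) G A" and z: "z \<notin> lift n F"
  shows "2 * k + 2 \<le> card {w\<in>nbhd k. z + w \<notin> lift n F} + card {i\<in>{..<r}. mate (Ms ! i) (proj n z) \<notin> F}"
proof -
  define v where "v = proj n z"
  have v: "v \<in> torus n" using proj_in_torus n by (simp add: v_def)
  have vF: "v \<notin> F" using z by (simp add: lift_def v_def)
  have fin: "finite (nbrs G v)" unfolding nbrs_eq[OF v] by simp
  have "\<not> int (card (nbrs G v \<inter> F)) - int (card (nbrs G v - F)) \<ge> int r"
    using maj_final_stable[OF fin, of "int r" A] vF v unfolding F by (auto simp: G verts_def)
  moreover have "card (nbrs G v) = card (nbrs G v \<inter> F) + card (nbrs G v - F)"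
    using fin card_Int_Diff[OF fin, of F] by simp
  ultimately have "card (nbrs G v - F) \<ge> 2 * k + 2" using card_nbrs[OF v] by linarith
  also have "nbrs G v - F \<subseteq> (\<lambda>w. proj n (v + w)) ` {w\<in>nbhd k. z + w \<notin> lift n F} \<union> (\<lambda>i. mate (Ms ! i) v) ` {i\<in>{..<r}. mate (Ms ! i) v \<notin> F}"
    unfolding nbrs_eq[OF v] lift_def by (auto simp: v_def proj_add)
  then have "card (nbrs G v - F) \<le> card ((\<lambda>w. proj n (v + w)) ` {w\<in>nbhd k. z + w \<notin> lift n F} \<union> (\<lambda>i. mate (Ms ! i) v) ` {i\<in>{..<r}. mate (Ms ! i) v \<notin> F})"
    by (intro card_mono) auto
  also have "\<dots> \<le> card ((\<lambda>w. proj n (v + w)) ` {w\<in>nbhd k. z + w \<notin> lift n F}) + card ((\<lambda>i. mate (Ms ! i) v) ` {i\<in>{..<r}. mate (Ms ! i) v \<notin> F})"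
    by (rule card_Un_le)
  also have "\<dots> \<le> card {w\<in>nbhd k. z + w \<notin> lift n F} + card {i\<in>{..<r}. mate (Ms ! i) v \<notin> F}"
    by (intro add_mono card_image_le) auto
  finally show ?thesis by (simp add: v_def)
qed

lemma activation:
  assumes F: "F = maj_final (int r) G A" and z: "card {w\<in>nbhd k. z + w \<in> lift n F} \<ge> 2 * k + 1 + r"
  shows "z \<in> lift n F"
proof (rule ccontr)
  assume "z \<notin> lift n F"
  note inactive_nbrs[OF F this]
  moreover have "card {i\<in>{..<r}. mate (Ms ! i) (proj n z) \<notin> F} \<le> card {..<r}" by (rule card_mono) auto
  moreover have "card {w\<in>nbhd k. z + w \<in> lift n F} + card {w\<in>nbhd k. z + w \<notin> lift n F} = 4 * k + 2"
  proof -
    have "card ({w\<in>nbhd k. z + w \<in> lift n F} \<union> {w\<in>nbhd k. z + w \<notin> lift n F}) = card {w\<in>nbhd k. z + w \<in> lift n F} + card {w\<in>nbhd k. z + w \<notin> lift n F}"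
      by (rule card_Un_disjoint) auto
    moreover have "{w\<in>nbhd k. z + w \<in> lift n F} \<union> {w\<in>nbhd k. z + w \<notin> lift n F} = nbhd k" by blast
    ultimately show ?thesis by (simp add: card_nbhd)
  qed
  ultimately show False using z by simp
qed

end

text \<open>The good-site threshold \<open>r + 2 * e + 2\<close> and the radius
  \<open>k * (k div e + 4)\<close> are those of \<open>droplet_spreads\<close>. The point
  \<open>c\<close> carries the seed. With \<open>r + 1 \<le> 2 * k\<close> an inactive vertex has at
  least three inactive lattice neighbours even if all its matching neighbours are inactive.\<close>

locale nice_process = nice_configuration n k "r + 2 * e + 2" "k * (k div e + 4)" R1 M A1 C + torus_graph n k r Ms G
  for n k r e R1 M :: nat and A1 C :: "point set" and Ms G +
  fixes A :: "point set" and c :: point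
  assumes e: "1 \<le> e" "e \<le> k" and k2: "2 \<le> k" and r2k: "r + 1 \<le> 2 * k"
    and A1A: "A1 \<subseteq> A" and A: "A \<subseteq> torus n"
    and seed: "c \<in> S" "\<And>z. z \<in> droplet k e (prof k e (k div e + 1) + int k) \<Longrightarrow> c + z \<in> lift n A"
begin

definition F :: "point set" where "F = maj_final (int r) G A"
abbreviation W0 :: int where "W0 \<equiv> prof k e (k div e + 1) + int k"

lemma AF: "A \<subseteq> F" unfolding F_def by (rule maj_final_superset)

lemma F_sub: "F \<subseteq> torus n" unfolding F_def using maj_final_subset[of A G] A by (simp add: G verts_def)

text \<open>The droplet travels from the seed along a path in \<open>S\<close>; sites of
  \<open>S\<close> are open, so everything it needs for the next step is good.\<close>

lemma S_hot:
  assumes "s \<in> S" "z \<in> droplet k e W0" shows "s + z \<in> lift n F"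
proof -
  have "reach S c s" using S_connected seed(1) assms(1) by (simp add: sconnected_def)
  then have "\<forall>z\<in>droplet k e W0. s + z \<in> lift n F"
  proof (induction rule: reach_induct)
    case refl
    show ?case using seed(2) AF by (auto simp: lift_def)
  next
    case (step v w)
    have vS: "v \<in> S" using reach_in(2)[OF step.hyps(1)] .
    have good: "good_site k (r + 2 * e + 2) (lift n A1) u" if "u \<in> sball v (int (k * (k div e + 4)))" for u
      using vS S_open that unfolding C_def closed_set_def by blast
    have sub: "lift n A1 \<subseteq> lift n F" using A1A AF by (auto simp: lift_def)
    show ?case
    proof
      fix z assume z: "z \<in> droplet k e W0"
      show "w + z \<in> lift n F"
        by (rule droplet_spreads[OF activation[OF F_def] sub e k2 refl _ good step.hyps(3) z]) (use step.IH in auto)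
    qed
  qed
  then show ?thesis using assms(2) by blast
qed

lemma droplet_uminus: "z \<in> droplet k e W \<Longrightarrow> - z \<in> droplet k e W"
  by (auto simp: droplet_def)

text \<open>Droplets are symmetric: a site of \<open>S\<close> in the droplet around
  \<open>z\<close> would have \<open>z\<close> in its own droplet.\<close>

lemma not_hot:
  assumes "z \<notin> lift n F" "d \<in> droplet k e W0" shows "z + d \<notin> S"
proof
  assume "z + d \<in> S"
  from S_hot[OF this droplet_uminus[OF assms(2)]] show False using assms(1) by simp
qed

lemma small_in_droplet: "\<bar>a\<bar> \<le> int k \<Longrightarrow> \<bar>b\<bar> \<le> 1 \<Longrightarrow> (a, b) \<in> droplet k e W0"
proof -
  assume a: "\<bar>a\<bar> \<le> int k" and b: "\<bar>b\<bar> \<le> 1"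
  have "nat \<bar>b\<bar> \<le> k div e + 1" using b by linarith
  then have "prof k e (nat \<bar>b\<bar>) \<le> prof k e (k div e + 1)" by (rule prof_mono)
  then show ?thesis using a unfolding droplet_def by simp
qed

text \<open>A whole droplet around an inactive site avoids \<open>S\<close>. It contains the path
  that goes horizontally to the column of the neighbour and then one step up or down, so the
  neighbour lies in the same island.\<close>

lemma nbr_same_island:
  assumes z: "z \<notin> lift n F" "z \<in> isl u" and w: "w \<in> nbhd k"
  shows "z + w \<in> isl u"
proof -
  obtain x y where xy: "z = (x, y)" by (cases z)
  obtain a b where ab: "w = (a, b)" by (cases w)
  have a: "\<bar>a\<bar> \<le> int k" and b: "b = 1 \<or> b = -1" using w by (auto simp: ab nbhd_def)
  have "reach (- S) (x, y) (x + a, y)"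
  proof (rule reach_horizontal)
    fix i assume i: "min x (x + a) \<le> i" "i \<le> max x (x + a)"
    have "\<bar>i - x\<bar> \<le> int k" using i a by linarith
    then have "z + (i - x, 0) \<notin> S" by (intro not_hot[OF z(1)] small_in_droplet) auto
    then show "(i, y) \<in> - S" by (simp add: xy)
  qed
  moreover have "tadj (x + a, y) (x + a, y + b)" using b by (auto simp: tadj_iff)
  moreover have "(x + a, y + b) \<in> - S"
  proof -
    have "z + (a, b) \<notin> S" by (intro not_hot[OF z(1)] small_in_droplet) (use a b in auto)
    then show ?thesis by (simp add: xy)
  qed
  ultimately have "reach (- S) z (z + w)" unfolding xy ab by (simp add: reach_step)
  then show ?thesis using z(2) unfolding isl_def using reach_trans by blast
qed

text \<open>All lattice neighbours of an inactive site are in its island, so each island can be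
  treated as a finite set \<open>X\<close> in the plane. An extreme point has at most 2k + 1 of the
  2k + 2 inactive neighbours it needs in the lattice, hence one through a matching.\<close>

theorem disseminates_or_self_linked: "disseminates (int r) G A \<or> self_linked islands r Ms"
proof (cases "F = torus n")
  case True
  moreover have "verts G = torus n" by (simp add: G verts_def)
  ultimately show ?thesis unfolding disseminates_def F_def by simp
next
  case False
  define U where "U = torus n - F"
  have U0: "U \<noteq> {}" using False F_sub by (auto simp: U_def)
  have lift_iff: "z \<notin> lift n F \<longleftrightarrow> proj n z \<in> U" for z
    using proj_in_torus[OF n_pos] by (simp add: lift_def U_def)
  have notS: "z \<notin> S" if "z \<notin> lift n F" for z
    using not_hot[OF that small_in_droplet[of 0 0]] by (simp flip: zero_prod_def)
  have Usub: "U \<subseteq> \<Union>islands"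
  proof
    fix u assume u: "u \<in> U"
    then have pu: "proj n u = u" by (simp add: U_def proj_torus)
    then have uS: "u \<notin> S" using notS lift_iff u by metis
    then have "u \<in> isl u" by (simp add: isl_def reach_refl)
    then have "u \<in> proj n ` isl u" using pu by (metis imageI)
    then show "u \<in> \<Union>islands" using uS unfolding islands_def by blast
  qed
  have "\<exists>Y. Y \<subseteq> U \<inter> T \<and> card Y = 3 \<and> (\<forall>u\<in>Y. \<exists>i<r. \<exists>w\<in>U. {u, w} \<in> Ms ! i)"
    if T: "T \<in> islands" and UT: "U \<inter> T \<noteq> {}" for T
  proof -
    obtain q where q: "T = proj n ` isl q" "q \<notin> S" using T unfolding islands_def by blast
    define X where "X = {z\<in>isl q. z \<notin> lift n F}"
    obtain u where "u \<in> U" "u \<in> T" using UT by blast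
    then obtain x where "x \<in> isl q" "proj n x \<in> U" using q(1) by blast
    then have X0: "X \<noteq> {}" unfolding X_def using lift_iff by blast
    have finX: "finite X"
    proof -
      obtain d where "isl q \<subseteq> sball d (int M * (int R1 + 1))" using isl_radius[OF q(2)] .
      then have "X \<subseteq> sball d (int M * (int R1 + 1))" unfolding X_def by blast
      then show ?thesis using finite_sball finite_subset by blast
    qed
    have eqX: "{w\<in>nbhd k. z + w \<notin> lift n F} = {w\<in>nbhd k. z + w \<in> X}" if "z \<in> X" for z
      using that nbr_same_island[of z q] unfolding X_def by blast
    have key: "2 * k + 2 \<le> card {w\<in>nbhd k. z + w \<in> X} + card {i\<in>{..<r}. mate (Ms ! i) (proj n z) \<notin> F}" if "z \<in> X" for z
      using inactive_nbrs[OF F_def, of z] that unfolding eqX[OF that] by (auto simp: X_def)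
    have three: "3 \<le> card {w\<in>nbhd k. z + w \<in> X}" if "z \<in> X" for z
    proof -
      have "card {i\<in>{..<r}. mate (Ms ! i) (proj n z) \<notin> F} \<le> card {..<r}" by (rule card_mono) auto
      then show ?thesis using key[OF that] r2k by simp
    qed
    obtain Y where Y: "Y \<subseteq> X" "card Y = 3" "\<And>z. z \<in> Y \<Longrightarrow> card {w\<in>nbhd k. z + w \<in> X} \<le> 2 * k + 1"
      using three_extreme_points[OF finX X0 three] by blast
    have "Y \<subseteq> isl q" using Y(1) unfolding X_def by blast
    then have "inj_on (proj n) Y" using proj_inj_isl[OF q(2)] inj_on_subset by blast
    then have "card (proj n ` Y) = 3" using Y(2) by (simp add: card_image)
    moreover have "proj n ` Y \<subseteq> U \<inter> T" using Y(1) lift_iff q(1) unfolding X_def by blast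
    moreover have "\<exists>i<r. \<exists>w\<in>U. {u, w} \<in> Ms ! i" if uY: "u \<in> proj n ` Y" for u
    proof -
      obtain z where z: "z \<in> Y" "u = proj n z" using uY by blast
      have zX: "z \<in> X" using z(1) Y(1) by blast
      have "card {i\<in>{..<r}. mate (Ms ! i) u \<notin> F} \<noteq> 0" using key[OF zX] Y(3)[OF z(1)] unfolding z(2) by linarith
      then have "{i\<in>{..<r}. mate (Ms ! i) u \<notin> F} \<noteq> {}" by (metis card.empty)
      then obtain i where i: "i < r" "mate (Ms ! i) u \<notin> F" by blast
      have ut: "u \<in> torus n" using z(2) proj_in_torus[OF n_pos] by simp
      have "mate (Ms ! i) u \<in> U" using mate(2)[OF matching[OF i(1)] ut] i(2) by (simp add: U_def)
      then show ?thesis using mate(1)[OF matching[OF i(1)] ut] i(1) by blast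
    qed
    ultimately show ?thesis by blast
  qed
  then have "self_linked islands r Ms" unfolding self_linked_def using U0 Usub by blast
  then show ?thesis ..
qed

end

section \<open>Existence of matching tuples\<close>

lemma involution_perfect_matching:
  assumes f: "\<And>v. v \<in> V \<Longrightarrow> f v \<in> V \<and> f v \<noteq> v \<and> f (f v) = v"
  shows "perfect_matching V {{v, f v} | v. v \<in> V}"
  unfolding perfect_matching_def
proof (intro conjI ballI)
  fix e assume "e \<in> {{v, f v} | v. v \<in> V}"
  then obtain v where "v \<in> V" "e = {v, f v}" by blast
  moreover have "f v \<in> V" "f v \<noteq> v" using f[OF \<open>v \<in> V\<close>] by auto
  ultimately show "e \<subseteq> V" "card e = 2" by (auto simp: card_insert_if)
next
  fix v assume v: "v \<in> V"
  show "\<exists>!e. e \<in> {{v, f v} | v. v \<in> V} \<and> v \<in> e"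
  proof (rule ex1I[of _ "{v, f v}"])
    show "{v, f v} \<in> {{v, f v} | v. v \<in> V} \<and> v \<in> {v, f v}" using v by blast
    fix e assume "e \<in> {{v, f v} | v. v \<in> V} \<and> v \<in> e"
    then obtain u where u: "u \<in> V" "e = {u, f u}" "v \<in> {u, f u}" by blast
    then consider "v = u" | "v = f u" by blast
    then show "e = {v, f v}"
    proof cases
      case 1 then show ?thesis using u by simp
    next
      case 2
      then have "f v = u" using f[OF u(1)] by simp
      then have "e = {f v, v}" using 2 u(2) by simp
      then show ?thesis by (simp add: insert_commute)
    qed
  qed
qed

text \<open>Within each row, the \<open>i\<close>-th matching joins the even position \<open>x\<close> to the odd position \<open>x + 2i + 1\<close>.\<close>

lemma matching_tuples_nonempty:
  assumes n: "even n" "n \<ge> 2" and r: "2 * r \<le> n"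
  shows "matching_tuples n k r \<noteq> {}"
proof -
  define \<sigma> where "\<sigma> i x = (if even x then (x + (2 * int i + 1)) mod int n else (x - (2 * int i + 1)) mod int n)" for i :: nat and x :: int
  define f where "f i v = (\<sigma> i (fst v), snd v)" for i and v :: point
  have par: "even (x mod int n) = even x" for x
    using n(1) by (metis dvd_mod_iff even_of_nat)
  have \<sigma>par: "even (\<sigma> i x) \<longleftrightarrow> odd x" for i x by (simp add: \<sigma>_def par)
  have \<sigma>\<sigma>: "\<sigma> i (\<sigma> i x) = x" if "0 \<le> x" "x < int n" for i x
  proof (cases "even x")
    case True
    then have "\<sigma> i (\<sigma> i x) = (\<sigma> i x - (2 * int i + 1)) mod int n" using \<sigma>par[of i x] by (simp add: \<sigma>_def)
    also have "\<dots> = x mod int n" using True by (simp add: \<sigma>_def mod_diff_left_eq)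
    finally show ?thesis using that by simp
  next
    case False
    then have "\<sigma> i (\<sigma> i x) = (\<sigma> i x + (2 * int i + 1)) mod int n" using \<sigma>par[of i x] by (simp add: \<sigma>_def)
    also have "\<dots> = x mod int n" using False by (simp add: \<sigma>_def mod_add_left_eq)
    finally show ?thesis using that by simp
  qed
  have f: "f i v \<in> torus n \<and> f i v \<noteq> v \<and> f i (f i v) = v" if "v \<in> torus n" for i v
  proof -
    have v: "0 \<le> fst v" "fst v < int n" "0 \<le> snd v" "snd v < int n" using that by (auto simp: torus_def)
    have "0 \<le> \<sigma> i (fst v)" "\<sigma> i (fst v) < int n" using n by (auto simp: \<sigma>_def)
    moreover have "\<sigma> i (fst v) \<noteq> fst v" using \<sigma>par[of i "fst v"] by metis
    ultimately show ?thesis using v \<sigma>\<sigma>[OF v(1,2)] by (auto simp: f_def torus_def prod_eq_iff)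
  qed
  define Mi where "Mi i = {{v, f i v} | v. v \<in> torus n}" for i
  have pm: "perfect_matching (torus n) (Mi i)" for i unfolding Mi_def by (rule involution_perfect_matching) (rule f)
  have feq: "i = j" if v: "v \<in> torus n" and eq: "f i v = f j v" and ij: "i < r" "j < r" for i j v
  proof -
    have "int n dvd 2 * (int i - int j)"
    proof (cases "even (fst v)")
      case True
      then have "(fst v + (2 * int i + 1)) mod int n = (fst v + (2 * int j + 1)) mod int n" using eq by (simp add: f_def \<sigma>_def)
      then show ?thesis by (simp add: mod_eq_dvd_iff right_diff_distrib)
    next
      case False
      then have "(fst v - (2 * int i + 1)) mod int n = (fst v - (2 * int j + 1)) mod int n" using eq by (simp add: f_def \<sigma>_def)
      then have "int n dvd 2 * int j - 2 * int i" by (simp add: mod_eq_dvd_iff)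
      then have "int n dvd - (2 * int j - 2 * int i)" by (simp only: dvd_minus_iff)
      then show ?thesis by (simp add: algebra_simps)
    qed
    moreover have "\<bar>2 * (int i - int j)\<bar> < int n"
    proof -
      have "2 * int i + 2 \<le> int n" "2 * int j + 2 \<le> int n" using ij r by simp_all
      then show ?thesis by (simp add: abs_if)
    qed
    ultimately have "2 * (int i - int j) = 0" using zdvd_imp_le[of "int n" "\<bar>2 * (int i - int j)\<bar>"] by fastforce
    then show ?thesis by simp
  qed
  have disj: "Mi i \<inter> Mi j = {}" if ij: "i < r" "j < r" "i \<noteq> j" for i j
  proof (rule ccontr)
    assume "Mi i \<inter> Mi j \<noteq> {}"
    then obtain u v where uv: "u \<in> torus n" "v \<in> torus n" "{u, f i u} = {v, f j v}" unfolding Mi_def by blast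
    then consider "u = v" "f i u = f j v" | "u = f j v" "f i u = v" by (auto simp: doubleton_eq_iff)
    then have "f i u = f j u"
    proof cases
      case 2 then show ?thesis using f[OF uv(2), of j] by simp
    qed simp
    then show False using feq[OF uv(1)] ij by blast
  qed
  \<comment> \<open>The matchings stay within rows, whereas lattice edges change the row by one,
    which is nonzero modulo \<open>n\<close>.\<close>
  have noL: "Mi i \<inter> L_edges n k = {}" for i
  proof (rule ccontr)
    assume "Mi i \<inter> L_edges n k \<noteq> {}"
    then obtain v where v: "v \<in> torus n" "{v, f i v} \<in> L_edges n k" unfolding Mi_def by blast
    have fv: "f i v \<in> torus n" using f[OF v(1)] by blast
    obtain w where w: "w \<in> nbhd k" "v = proj n (f i v + w)" using L_edges_iff[OF v(1) fv] v(2) by blast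
    have "snd v = (snd v + snd w) mod int n" using arg_cong[OF w(2), of snd] by (simp add: proj_def f_def)
    then have "snd v mod int n = (snd v + snd w) mod int n" using v(1) by (auto simp: torus_def)
    then have "int n dvd snd w" using mod_eq_dvd_iff[of "snd v + snd w" "int n" "snd v"] by simp
    moreover have "snd w = 1 \<or> snd w = -1" using w(1) by (auto simp: nbhd_def)
    ultimately have "int n dvd 1" by auto
    then show False using n by simp
  qed
  have "map Mi [0..<r] \<in> matching_tuples n k r"
    unfolding matching_tuples_def using pm disj noL by auto
  then show ?thesis by blast
qed

section \<open>A bound for fixed parameters\<close>

lemma prob_pair_slice:
  assumes "\<And>a. a \<in> set_pmf P \<Longrightarrow> measure_pmf.prob Q {b. X a b} \<le> \<epsilon>" "0 \<le> \<epsilon>"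
  shows "measure_pmf.prob (pair_pmf P Q) {x. X (fst x) (snd x)} \<le> \<epsilon>"
proof -
  have "ennreal (measure_pmf.prob (pair_pmf P Q) {x. X (fst x) (snd x)}) =
      (\<integral>\<^sup>+x. indicator {x. X (fst x) (snd x)} x \<partial>pair_pmf P Q)"
    by (simp add: measure_pmf.emeasure_eq_measure)
  also have "\<dots> = (\<integral>\<^sup>+a. \<integral>\<^sup>+b. indicator {b. X a b} b \<partial>Q \<partial>P)"
    unfolding nn_integral_pair_pmf' by (simp add: indicator_def)
  also have "\<dots> = (\<integral>\<^sup>+a. ennreal (measure_pmf.prob Q {b. X a b}) \<partial>P)"
    by (simp add: measure_pmf.emeasure_eq_measure)
  also have "\<dots> \<le> (\<integral>\<^sup>+a. ennreal \<epsilon> \<partial>P)"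
    by (rule nn_integral_mono_AE) (use assms(1) in \<open>auto simp: AE_measure_pmf_iff intro!: ennreal_leI\<close>)
  also have "\<dots> = ennreal \<epsilon>" by (simp add: measure_pmf.emeasure_space_1)
  finally show ?thesis using assms(2) by simp
qed

lemma prob_pair_slice':
  assumes "\<And>b. b \<in> set_pmf Q \<Longrightarrow> measure_pmf.prob P {a. X a b} \<le> \<epsilon>" "0 \<le> \<epsilon>"
  shows "measure_pmf.prob (pair_pmf P Q) {x. X (fst x) (snd x)} \<le> \<epsilon>"
proof -
  have "measure_pmf.prob (pair_pmf P Q) {x. X (fst x) (snd x)} =
      measure_pmf.prob (pair_pmf Q P) {x. X (snd x) (fst x)}"
    by (subst pair_commute_pmf) (simp add: vimage_def case_prod_unfold)
  also have "\<dots> \<le> \<epsilon>" using prob_pair_slice[of Q P "\<lambda>b a. X a b"] assms by blast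
  finally show ?thesis .
qed

lemma card_L_nbrs:
  assumes "v \<in> torus n" shows "card {x\<in>torus n. {v, x} \<in> L_edges n k} \<le> 4 * k + 2"
proof -
  have "{x\<in>torus n. {v, x} \<in> L_edges n k} \<subseteq> (\<lambda>w. proj n (v + w)) ` nbhd k"
  proof
    fix x assume x: "x \<in> {x\<in>torus n. {v, x} \<in> L_edges n k}"
    then have "{x, v} \<in> L_edges n k" by (simp add: insert_commute)
    then show "x \<in> (\<lambda>w. proj n (v + w)) ` nbhd k" using L_edges_iff[of x n v k] x assms by blast
  qed
  then have "card {x\<in>torus n. {v, x} \<in> L_edges n k} \<le> card ((\<lambda>w. proj n (v + w)) ` nbhd k)" by (intro card_mono) auto
  also have "\<dots> \<le> card (nbhd k)" by (rule card_image_le) simp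
  finally show ?thesis by (simp add: card_nbhd)
qed

section \<open>Probabilities of an atypical first set and of a missing seed\<close>

definition nice :: "nat \<Rightarrow> nat \<Rightarrow> nat \<Rightarrow> nat \<Rightarrow> nat \<Rightarrow> nat \<Rightarrow> real \<Rightarrow> point set \<Rightarrow> bool" where
  "nice n k N R R1 M b A \<longleftrightarrow> (\<forall>v\<in>torus n. \<not> chain_at R1 (closed_set n k N R A) M v) \<and>
     (\<Sum>v\<in>torus n. chain_weight R1 (closed_set n k N R A) M v) < b"

text \<open>Two sources of failure: a chain of \<open>M\<close> links somewhere, excluded by a union
  bound over the torus, and a large total weight, excluded by the second moment.\<close>

lemma not_nice_prob:
  assumes n: "k < n" and k: "k \<ge> 1" and p: "0 \<le> p" "p \<le> 1" and R1: "2 * (R + k) \<le> R1"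
    and M: "2 * M * (R1 + 1) + 2 * (R + k) < n"
    and \<delta>: "\<delta> = real ((2 * R + 1)\<^sup>2) * (4 * exp (real N - 3 / 5 * p * real k))"
    and q: "real ((2 * R1 + 3)\<^sup>2) * \<delta> \<le> 1 / 512"
    and \<mu>: "2 * (3 * real (R1 + 1)) ^ 8 * \<delta> \<le> \<mu>" "\<mu> > 0"
    and L: "L = M * (R1 + 1) + (R + k)" and B: "B = real M * (3 * real M * real (R1 + 1)) ^ 8"
  shows "measure_pmf.prob (random_subset (torus n) p) {A. \<not> nice n k N R R1 M (2 * \<mu> * real (n\<^sup>2)) A}
    \<le> real (n\<^sup>2) * (1 / 512) ^ M + real ((4 * L + 1)\<^sup>2) * B\<^sup>2 / (\<mu>\<^sup>2 * real (n\<^sup>2))"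
proof -
  let ?C = "\<lambda>A. closed_set n k N R A"
  have fin: "finite (torus n)" by (rule finite_torus)
  have \<delta>0: "\<delta> \<ge> 0" by (simp add: \<delta>)
  have "\<delta> \<le> 1"
  proof -
    have "1 \<le> (2 * R1 + 3)\<^sup>2" by (rule one_le_power) simp
    then have "1 \<le> real ((2 * R1 + 3)\<^sup>2)" by (metis of_nat_1 of_nat_le_iff)
    then have "1 * \<delta> \<le> real ((2 * R1 + 3)\<^sup>2) * \<delta>"
      using \<delta>0 by (intro mult_right_mono)
    then show ?thesis using q by simp
  qed
  have "expect (torus n) p (\<lambda>A. of_bool (\<not> nice n k N R R1 M (2 * \<mu> * real (n\<^sup>2)) A))
      \<le> expect (torus n) p (\<lambda>A. (\<Sum>v\<in>torus n. of_bool (chain_at R1 (?C A) M v)) +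
          of_bool ((\<Sum>v\<in>torus n. chain_weight R1 (?C A) M v) \<ge> 2 * \<mu> * real (n\<^sup>2)))"
  proof (rule expect_mono[OF fin])
    fix A
    show "of_bool (\<not> nice n k N R R1 M (2 * \<mu> * real (n\<^sup>2)) A) \<le> (\<Sum>v\<in>torus n. of_bool (chain_at R1 (?C A) M v)) +
          (of_bool ((\<Sum>v\<in>torus n. chain_weight R1 (?C A) M v) \<ge> 2 * \<mu> * real (n\<^sup>2)) :: real)"
    proof (cases "\<exists>v\<in>torus n. chain_at R1 (?C A) M v")
      case True
      then obtain v where v: "v \<in> torus n" "chain_at R1 (?C A) M v" by blast
      have "(1 :: real) = of_bool (chain_at R1 (?C A) M v)" using v by simp
      also have "\<dots> \<le> (\<Sum>v\<in>torus n. of_bool (chain_at R1 (?C A) M v))"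
        by (rule member_le_sum) (use v fin in auto)
      finally have 1: "(1 :: real) \<le> (\<Sum>v\<in>torus n. of_bool (chain_at R1 (?C A) M v))" .
      have 2: "of_bool (\<not> nice n k N R R1 M (2 * \<mu> * real (n\<^sup>2)) A) \<le> (1 :: real)" by simp
      have 3: "0 \<le> (of_bool ((\<Sum>v\<in>torus n. chain_weight R1 (?C A) M v) \<ge> 2 * \<mu> * real (n\<^sup>2)) :: real)" by simp
      show ?thesis using 1 2 3 by linarith
    next
      case False
      then have "\<not> nice n k N R R1 M (2 * \<mu> * real (n\<^sup>2)) A \<longleftrightarrow> (\<Sum>v\<in>torus n. chain_weight R1 (?C A) M v) \<ge> 2 * \<mu> * real (n\<^sup>2)"
        unfolding nice_def by (simp add: not_less)
      then show ?thesis by (simp add: sum_nonneg)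
    qed
  qed
  also have "\<dots> = (\<Sum>v\<in>torus n. expect (torus n) p (\<lambda>A. of_bool (chain_at R1 (?C A) M v))) +
      expect (torus n) p (\<lambda>A. of_bool ((\<Sum>v\<in>torus n. chain_weight R1 (?C A) M v) \<ge> 2 * \<mu> * real (n\<^sup>2)))"
    unfolding expect_add[OF fin] expect_sum[OF fin] ..
  also have "\<dots> \<le> (\<Sum>v\<in>torus n. (1 / 512) ^ M) + real ((4 * L + 1)\<^sup>2) * B\<^sup>2 / (\<mu>\<^sup>2 * real (n\<^sup>2))"
  proof (rule add_mono[OF sum_mono])
    fix v
    have "expect (torus n) p (\<lambda>A. of_bool (chain_at R1 (?C A) M v)) \<le> real ((2 * R1 + 3)\<^sup>2) ^ M * \<delta> ^ Suc M"
      by (rule chain_prob[OF n k p R1 M \<delta>])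
    also have "\<dots> = (real ((2 * R1 + 3)\<^sup>2) * \<delta>) ^ M * \<delta>" by (simp add: power_mult_distrib)
    also have "\<dots> \<le> (1 / 512) ^ M * 1"
      using q \<delta>0 \<open>\<delta> \<le> 1\<close> by (intro mult_mono power_mono) auto
    finally show "expect (torus n) p (\<lambda>A. of_bool (chain_at R1 (?C A) M v)) \<le> (1 / 512) ^ M" by simp
  next
    show "expect (torus n) p (\<lambda>A. of_bool ((\<Sum>v\<in>torus n. chain_weight R1 (?C A) M v) \<ge> 2 * \<mu> * real (n\<^sup>2)))
      \<le> real ((4 * L + 1)\<^sup>2) * B\<^sup>2 / (\<mu>\<^sup>2 * real (n\<^sup>2))"
      by (rule chain_weight_prob[OF n k p R1 M \<delta> q \<mu> L B])
  qed
  also have "(\<Sum>v\<in>torus n. (1 / 512 :: real) ^ M) = real (n\<^sup>2) * (1 / 512) ^ M" by (simp add: card_torus)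
  finally show ?thesis unfolding prob_eq_expect .
qed

definition seeded :: "nat \<Rightarrow> nat \<Rightarrow> nat \<Rightarrow> point set \<Rightarrow> point set \<Rightarrow> bool" where
  "seeded n k e S A \<longleftrightarrow> (\<exists>c\<in>S. \<forall>z\<in>droplet k e (prof k e (k div e + 1) + int k). c + z \<in> lift n A)"

text \<open>The torus contains a grid of disjoint boxes of side \<open>2 * \<rho> + 1\<close>. As
  \<open>S\<close> is dense, each box has a site of \<open>S\<close> near its centre with its whole
  droplet inside of the box, which gives independent trials for the second set while
  \<open>S\<close> is fixed.\<close>

lemma (in nice_configuration) not_seeded_prob:
  assumes p: "0 \<le> p" "p \<le> 1" and e: "1 \<le> e" "e \<le> k" and k: "2 \<le> k"
    and \<rho>: "\<rho> = M * (R1 + 1) + 1 + k * (k div e + 4)"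
    and v: "v = (2 * k * (k div e + 2) + 1) * (2 * (k div e + 2) + 1)"
  shows "measure_pmf.prob (random_subset (torus n) p) {A2. \<not> seeded n k e S A2} \<le> (1 - p ^ v) ^ ((n div (2 * \<rho> + 1))\<^sup>2)"
proof -
  define g where "g = n div (2 * \<rho> + 1)"
  define s where "s = 2 * \<rho> + 1"
  define J where "J = {0..<g} \<times> {0..<g}"
  define z where "z j = (int (s * fst j), int (s * snd j))" for j
  let ?D = "droplet k e (prof k e (k div e + 1) + int k)"
  have "\<forall>j. \<exists>u. u \<in> S \<and> u \<in> sball (z j) (int M * (int R1 + 1) + 1)" by (meson S_dense)
  then obtain u where u: "\<And>j. u j \<in> S \<and> u j \<in> sball (z j) (int M * (int R1 + 1) + 1)" by metis
  define D where "D j = proj n ` ((+) (u j) ` ?D)" for j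
  have Dball: "D j \<subseteq> proj n ` sball (z j) (int \<rho>)" for j
  proof -
    have "(+) (u j) ` ?D \<subseteq> sball (z j) (int \<rho>)"
    proof
      fix x assume "x \<in> (+) (u j) ` ?D"
      then obtain d where d: "d \<in> ?D" "x = u j + d" by blast
      then have "sup_dist (0, 0) d \<le> int (k * (k div e + 4))" using droplet_finite_card(3)[OF e k] by (auto simp: sball_def)
      then have "sup_dist (u j) x \<le> int (k * (k div e + 4))" unfolding d(2) by (simp add: sup_dist_def)
      moreover have "sup_dist (z j) (u j) \<le> int M * (int R1 + 1) + 1" using u[of j] by (simp add: sball_def)
      ultimately have "sup_dist (z j) x \<le> int M * (int R1 + 1) + 1 + int (k * (k div e + 4))"
        using sup_dist_triangle[of "z j" x "u j"] by linarith
      also have "\<dots> = int \<rho>" by (simp add: \<rho> algebra_simps)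
      finally show "x \<in> sball (z j) (int \<rho>)" by (simp add: sball_def)
    qed
    then show ?thesis unfolding D_def by blast
  qed
  have sg: "s * g \<le> n" unfolding s_def g_def by (rule times_div_less_eq_dividend)
  have disj: "D i \<inter> D j = {}" if ij: "i \<in> J" "j \<in> J" "i \<noteq> j" for i j
  proof -
    have diff: "\<bar>int (s * a) - int (s * b)\<bar> \<le> int (s * g) - int s" "a \<noteq> b \<Longrightarrow> \<bar>int (s * a) - int (s * b)\<bar> \<ge> int s"
      if ab: "a < g" "b < g" for a b
    proof -
      have e: "int (s * a) - int (s * b) = int s * (int a - int b)" by (simp add: right_diff_distrib)
      have "\<bar>int a - int b\<bar> \<le> int g - 1" using ab by linarith
      then have "int s * \<bar>int a - int b\<bar> \<le> int s * (int g - 1)" by (intro mult_left_mono) auto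
      then show "\<bar>int (s * a) - int (s * b)\<bar> \<le> int (s * g) - int s" unfolding e abs_mult by (simp add: right_diff_distrib)
      assume "a \<noteq> b"
      then have "\<bar>int a - int b\<bar> \<ge> 1" by linarith
      then have "int s * 1 \<le> int s * \<bar>int a - int b\<bar>" by (intro mult_left_mono) auto
      then show "\<bar>int (s * a) - int (s * b)\<bar> \<ge> int s" unfolding e abs_mult by simp
    qed
    have g: "fst i < g" "snd i < g" "fst j < g" "snd j < g" using ij by (auto simp: J_def)
    have up: "sup_dist (z i) (z j) \<le> int (s * g) - int s"
      using diff(1)[OF g(1,3)] diff(1)[OF g(2,4)] unfolding sup_dist_def z_def fst_conv snd_conv by simp
    have "fst i \<noteq> fst j \<or> snd i \<noteq> snd j" using ij(3) by (auto simp: prod_eq_iff)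
    then have lo: "sup_dist (z i) (z j) \<ge> int s"
      using diff(2)[OF g(1,3)] diff(2)[OF g(2,4)] unfolding sup_dist_def z_def fst_conv snd_conv by linarith
    have "int (s * g) \<le> int n" using sg by (simp only: of_nat_le_iff)
    then have "sup_dist (z i) (z j) + 2 * int \<rho> < int n" using up by (simp add: s_def)
    moreover have "2 * int \<rho> < sup_dist (z i) (z j)" using lo by (simp add: s_def)
    ultimately have "proj n ` sball (z i) (int \<rho>) \<inter> proj n ` sball (z j) (int \<rho>) = {}" by (intro proj_sball_disjoint)
    then show ?thesis using Dball[of i] Dball[of j] by blast
  qed
  have Dsub: "D j \<subseteq> torus n \<and> card (D j) \<le> v" for j
  proof
    show "D j \<subseteq> torus n" unfolding D_def using proj_in_torus[OF n_pos] by blast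
    have "card (D j) \<le> card ?D" unfolding D_def
      using droplet_finite_card(1)[OF e k] by (meson card_image_le finite_imageI order_trans)
    then show "card (D j) \<le> v" using droplet_finite_card(2)[OF e k] unfolding v by simp
  qed
  have "seeded n k e S A2" if "D j \<subseteq> A2" for j A2
    unfolding seeded_def using that u[of j] unfolding D_def lift_def by blast
  then have "of_bool (\<not> seeded n k e S A2) \<le> (of_bool (\<forall>j\<in>J. \<not> D j \<subseteq> A2) :: real)" for A2 by auto
  then have "expect (torus n) p (\<lambda>A2. of_bool (\<not> seeded n k e S A2)) \<le> expect (torus n) p (\<lambda>A2. of_bool (\<forall>j\<in>J. \<not> D j \<subseteq> A2))"
    by (intro expect_mono[OF finite_torus])
  also have "\<dots> \<le> (1 - p ^ v) ^ card J"
    by (rule no_seed_prob[OF finite_torus p]) (use Dsub disj in \<open>auto simp: J_def\<close>)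
  also have "card J = g\<^sup>2" by (simp add: J_def card_cartesian_product power2_eq_square)
  finally show ?thesis unfolding prob_eq_expect g_def .
qed

text \<open>The four error terms bound, in this order, a long chain, a large chain weight, the
  absence of a seed and a self-linked set of islands. The first three concern the initial set, the
  last one the matchings for a given initial set.\<close>

theorem dissemination_lower_bound:
  fixes n k r e M :: nat and p :: real
  assumes n: "even n" "2 * k < n" "2 * r \<le> n" "8 + 8 * (4 * k + 2 + r) \<le> n\<^sup>2"
    and e: "1 \<le> e" "e \<le> k" and k: "2 \<le> k" and r: "1 \<le> r" "r + 1 \<le> 2 * k" and p: "0 \<le> p" "p < 1"
    and R: "R = k * (k div e + 4)"
    and M: "2 * M * (4 * R + 1) + 2 * (R + k) < n"
    and \<delta>: "\<delta> = real ((2 * R + 1)\<^sup>2) * (4 * exp (real (r + 2 * e + 2) - 3 / 5 * (p / 2) * real k))"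
    and q: "real ((8 * R + 3)\<^sup>2) * \<delta> \<le> 1 / 512"
    and \<mu>: "\<mu> = 1 / (2 * (10 ^ 4 * (real r)\<^sup>2))" "2 * (3 * real (4 * R + 1)) ^ 8 * \<delta> \<le> \<mu>"
    and L: "L = M * (4 * R + 1) + (R + k)" and B: "B = real M * (3 * real M * real (4 * R + 1)) ^ 8"
    and \<rho>: "\<rho> = M * (4 * R + 1) + 1 + R"
    and v: "v = (2 * k * (k div e + 2) + 1) * (2 * (k div e + 2) + 1)"
  shows "1 - dissemination_prob n k r p \<le> real (n\<^sup>2) * (1 / 512) ^ M + real ((4 * L + 1)\<^sup>2) * B\<^sup>2 / (\<mu>\<^sup>2 * real (n\<^sup>2))
    + (1 - (p / 2) ^ v) ^ ((n div (2 * \<rho> + 1))\<^sup>2) + root 8 (1 / real (n\<^sup>2))"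
proof -
  define p1 where "p1 = p / 2"
  \<comment> \<open>The solution of 1 - p = (1 - p/2)(1 - p2), so that the union of both sets has
    density exactly p; it is at least p/2.\<close>
  define p2 where "p2 = (p / 2) / (1 - p / 2)"
  have p1: "0 \<le> p1" "p1 \<le> 1" using p by (auto simp: p1_def)
  have p2: "p / 2 \<le> p2" "0 \<le> p2" "p2 \<le> 1" using p by (auto simp: p2_def field_simps)
  have pp: "1 - p = (1 - p1) * (1 - p2)" using p by (simp add: p1_def p2_def field_simps)
  define N where "N = r + 2 * e + 2"
  let ?V = "torus n" and ?Q = "pmf_of_set (matching_tuples n k r)"
  let ?P1 = "random_subset ?V p1" and ?P2 = "random_subset ?V p2"
  define gr where "gr Ms = (torus n, L_edges n k \<union> \<Union> (set Ms))" for Ms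
  define dis where "dis Ms AA \<longleftrightarrow> disseminates (int r) (gr Ms) (fst AA \<union> snd AA)" for Ms and AA :: "point set \<times> point set"
  define C where "C A1 = closed_set n k N R A1" for A1
  define ni where "ni A1 \<longleftrightarrow> nice n k N R (4 * R) M (2 * \<mu> * real (n\<^sup>2)) A1" for A1
  have n2: "2 < n" using n(2) k by linarith
  have \<mu>0: "\<mu> > 0" using r by (simp add: \<mu>)
  have finT: "finite (matching_tuples n k r)" unfolding matching_tuples_eq by (rule finite_disjoint_tuples[OF finite_torus])
  have neT: "matching_tuples n k r \<noteq> {}" using n n2 by (intro matching_tuples_nonempty) auto
  have setQ: "set_pmf ?Q = matching_tuples n k r" using finT neT by simp
  \<comment> \<open>Hence \<open>2 * (R + k) \<le> 4 * R\<close>, so \<open>4 * R\<close> can serve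
    as the separation of the chains.\<close>
  have kR: "k \<le> R" unfolding R by simp
  have conf: "nice_configuration n k N R (4 * R) M A1 (C A1)" if "ni A1" for A1
  proof
    show "C A1 = closed_set n k N R A1" by (simp add: C_def)
    show "\<not> chain_at (4 * R) (C A1) M v" if "v \<in> torus n" for v
      using \<open>ni A1\<close> that by (simp add: ni_def nice_def C_def)
    show "2 * M * (4 * R + 1) < n" using M by linarith
  qed
  let ?S = "\<lambda>A1. nice_configuration.S (C A1)" and ?I = "\<lambda>A1. nice_configuration.islands n (C A1)"
  have main: "dis Ms (A1, A2) \<or> self_linked (?I A1) r Ms"
    if Ms: "Ms \<in> matching_tuples n k r" and A1: "A1 \<subseteq> ?V" and A2: "A2 \<subseteq> ?V" and ni: "ni A1" and sd: "seeded n k e (?S A1) A2"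
    for Ms A1 A2
  proof -
    interpret nice_configuration n k N R "4 * R" M A1 "C A1" by (rule conf[OF ni])
    obtain c where c: "c \<in> S" "\<And>z. z \<in> droplet k e (prof k e (k div e + 1) + int k) \<Longrightarrow> c + z \<in> lift n A2"
      using sd unfolding seeded_def by blast
    have tg: "torus_graph n k r Ms (gr Ms)" by unfold_locales (use Ms n2 n in \<open>auto simp: gr_def\<close>)
    have nc: "nice_configuration n k (r + 2 * e + 2) (k * (k div e + 4)) (4 * R) M A1 (C A1)"
      using conf[OF ni] unfolding N_def R .
    have "nice_process n k r e (4 * R) M A1 (C A1) Ms (gr Ms) (A1 \<union> A2) c"
    proof (intro nice_process.intro nice_process_axioms.intro nc tg)
      show "c + z \<in> lift n (A1 \<union> A2)" if "z \<in> droplet k e (prof k e (k div e + 1) + int k)" for z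
        using c(2)[OF that] by (simp add: lift_def)
    qed (use e k r A1 A2 c(1) in auto)
    then have "disseminates (int r) (gr Ms) (A1 \<union> A2) \<or> self_linked islands r Ms"
      by (rule nice_process.disseminates_or_self_linked)
    then show ?thesis by (simp add: dis_def)
  qed
  let ?M = "pair_pmf ?Q (pair_pmf ?P1 ?P2)"
  have dp: "dissemination_prob n k r p = measure_pmf.prob ?M {x. dis (fst x) (snd x)}"
  proof -
    have "pair_pmf (L_star n k r) (random_subset ?V p) = map_pmf (\<lambda>(a, b). (gr a, (\<lambda>(X, Y). X \<union> Y) b)) ?M"
      unfolding L_star_def random_subset_or[OF p1 p2(2,3) pp finite_torus] map_pair gr_def ..
    then show ?thesis unfolding dissemination_prob_def
      by (simp add: vimage_def case_prod_unfold dis_def)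
  qed
  have "1 - dissemination_prob n k r p = measure_pmf.prob ?M {x. \<not> dis (fst x) (snd x)}"
    unfolding dp using measure_pmf.prob_compl[of "{x. dis (fst x) (snd x)}" ?M]
    by (simp add: Compl_eq_Diff_UNIV[symmetric] Collect_neg_eq)
  also have "\<dots> \<le> measure_pmf.prob ?M ({x. \<not> ni (fst (snd x))} \<union> {x. ni (fst (snd x)) \<and> \<not> seeded n k e (?S (fst (snd x))) (snd (snd x))}
      \<union> {x. ni (fst (snd x)) \<and> self_linked (?I (fst (snd x))) r (fst x)})"
  proof (rule measure_pmf.finite_measure_mono_AE)
    show "AE x in ?M. x \<in> {x. \<not> dis (fst x) (snd x)} \<longrightarrow> x \<in> {x. \<not> ni (fst (snd x))} \<union> {x. ni (fst (snd x)) \<and> \<not> seeded n k e (?S (fst (snd x))) (snd (snd x))}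
      \<union> {x. ni (fst (snd x)) \<and> self_linked (?I (fst (snd x))) r (fst x)}"
      unfolding AE_measure_pmf_iff
    proof
      fix x assume "x \<in> set_pmf ?M"
      then have "fst x \<in> set_pmf ?Q \<and> fst (snd x) \<in> set_pmf ?P1 \<and> snd (snd x) \<in> set_pmf ?P2"
        unfolding set_pair_pmf by (simp add: mem_Times_iff)
      then have x: "fst x \<in> matching_tuples n k r" "fst (snd x) \<subseteq> ?V" "snd (snd x) \<subseteq> ?V"
        using setQ set_random_subset[of ?V p1] set_random_subset[of ?V p2] by blast+
      show "x \<in> {x. \<not> dis (fst x) (snd x)} \<longrightarrow> x \<in> {x. \<not> ni (fst (snd x))} \<union> {x. ni (fst (snd x)) \<and> \<not> seeded n k e (?S (fst (snd x))) (snd (snd x))}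
      \<union> {x. ni (fst (snd x)) \<and> self_linked (?I (fst (snd x))) r (fst x)}"
        using main[OF x] by auto
    qed
  qed simp
  also have "\<dots> \<le> measure_pmf.prob ?M {x. \<not> ni (fst (snd x))} + measure_pmf.prob ?M {x. ni (fst (snd x)) \<and> \<not> seeded n k e (?S (fst (snd x))) (snd (snd x))}
      + measure_pmf.prob ?M {x. ni (fst (snd x)) \<and> self_linked (?I (fst (snd x))) r (fst x)}"
    by (intro order_trans[OF measure_Un_le] add_mono order_refl) auto
  also have "\<dots> \<le> (real (n\<^sup>2) * (1 / 512) ^ M + real ((4 * L + 1)\<^sup>2) * B\<^sup>2 / (\<mu>\<^sup>2 * real (n\<^sup>2)))
    + (1 - (p / 2) ^ v) ^ ((n div (2 * \<rho> + 1))\<^sup>2) + root 8 (1 / real (n\<^sup>2))"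
  proof (intro add_mono)
    have "measure_pmf.prob ?M {x. \<not> ni (fst (snd x))} = measure_pmf.prob (map_pmf fst (map_pmf snd ?M)) {A. \<not> ni A}"
      by (simp add: vimage_def)
    also have "map_pmf fst (map_pmf snd ?M) = ?P1" by (simp only: map_snd_pair_pmf map_fst_pair_pmf)
    also have "measure_pmf.prob ?P1 {A. \<not> ni A} \<le> real (n\<^sup>2) * (1 / 512) ^ M + real ((4 * L + 1)\<^sup>2) * B\<^sup>2 / (\<mu>\<^sup>2 * real (n\<^sup>2))"
      unfolding ni_def
    proof (rule not_nice_prob[OF _ _ p1 _ M _ _ _ \<mu>0 L B])
      show "\<delta> = real ((2 * R + 1)\<^sup>2) * (4 * exp (real N - 3 / 5 * p1 * real k))" unfolding \<delta> N_def p1_def ..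
      show "real ((2 * (4 * R) + 3)\<^sup>2) * \<delta> \<le> 1 / 512" using q by simp
      show "2 * (3 * real (4 * R + 1)) ^ 8 * \<delta> \<le> \<mu>" by (rule \<mu>(2))
    qed (use n k kR in auto)
    finally show "measure_pmf.prob ?M {x. \<not> ni (fst (snd x))} \<le> real (n\<^sup>2) * (1 / 512) ^ M + real ((4 * L + 1)\<^sup>2) * B\<^sup>2 / (\<mu>\<^sup>2 * real (n\<^sup>2))" .
  next
    have pv: "(p / 2) ^ v \<le> p2 ^ v" "p2 ^ v \<le> 1" using p p2 by (auto intro: power_mono power_le_one)
    have "measure_pmf.prob ?M {x. ni (fst (snd x)) \<and> \<not> seeded n k e (?S (fst (snd x))) (snd (snd x))} =
        measure_pmf.prob (map_pmf snd ?M) {x. ni (fst x) \<and> \<not> seeded n k e (?S (fst x)) (snd x)}"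
      by (simp add: vimage_def)
    also have "map_pmf snd ?M = pair_pmf ?P1 ?P2" by (simp only: map_snd_pair_pmf)
    also have "measure_pmf.prob (pair_pmf ?P1 ?P2) {x. ni (fst x) \<and> \<not> seeded n k e (?S (fst x)) (snd x)} \<le> (1 - (p / 2) ^ v) ^ ((n div (2 * \<rho> + 1))\<^sup>2)"
    \<comment> \<open>Condition on \<open>A1\<close>: then \<open>S\<close> is fixed and only
      \<open>A2\<close> is random.\<close>
    proof (rule prob_pair_slice)
      fix A1
      show "measure_pmf.prob ?P2 {A2. ni A1 \<and> \<not> seeded n k e (?S A1) A2} \<le> (1 - (p / 2) ^ v) ^ ((n div (2 * \<rho> + 1))\<^sup>2)"
      proof (cases "ni A1")
        case True
        interpret nice_configuration n k N R "4 * R" M A1 "C A1" by (rule conf[OF True])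
        have "measure_pmf.prob ?P2 {A2. \<not> seeded n k e S A2} \<le> (1 - p2 ^ v) ^ ((n div (2 * \<rho> + 1))\<^sup>2)"
          by (rule not_seeded_prob[OF p2(2,3) e k _ v]) (simp only: \<rho> R)
        also have "\<dots> \<le> (1 - (p / 2) ^ v) ^ ((n div (2 * \<rho> + 1))\<^sup>2)" using pv by (intro power_mono) auto
        finally show ?thesis using True by simp
      next
        case False
        then show ?thesis using pv by simp
      qed
    qed (use pv in simp)
    finally show "measure_pmf.prob ?M {x. ni (fst (snd x)) \<and> \<not> seeded n k e (?S (fst (snd x))) (snd (snd x))} \<le> (1 - (p / 2) ^ v) ^ ((n div (2 * \<rho> + 1))\<^sup>2)" .
  next
    show "measure_pmf.prob ?M {x. ni (fst (snd x)) \<and> self_linked (?I (fst (snd x))) r (fst x)} \<le> root 8 (1 / real (n\<^sup>2))"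
    \<comment> \<open>Condition on the initial sets: then the islands are fixed and the tuple of
      matchings is still uniform, so counting suffices.\<close>
    proof (rule prob_pair_slice'[where X = "\<lambda>Ms AA. ni (fst AA) \<and> self_linked (?I (fst AA)) r Ms"])
      fix AA :: "point set \<times> point set"
      show "measure_pmf.prob ?Q {Ms. ni (fst AA) \<and> self_linked (?I (fst AA)) r Ms} \<le> root 8 (1 / real (n\<^sup>2))"
      proof (cases "ni (fst AA)")
        case True
        interpret nice_configuration n k N R "4 * R" M "fst AA" "C (fst AA)" by (rule conf[OF True])
        have large: "8 + 8 * (4 * k + 2 + r) \<le> card (torus n)" using n(4) by (simp add: card_torus)
        have "(\<Sum>T\<in>islands. real (card T) ^ 4) \<le> (\<Sum>v\<in>torus n. chain_weight (4 * R) (C (fst AA)) M v)" by (rule islands_fourth_moment)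
        also have "\<dots> \<le> 2 * \<mu> * real (n\<^sup>2)" using True unfolding ni_def nice_def C_def by simp
        finally have fourth: "(\<Sum>T\<in>islands. real (card T) ^ 4) \<le> 2 * \<mu> * real (card (torus n))" by (simp add: card_torus)
        have \<mu>2: "2 * \<mu> = 1 / (10 ^ 4 * (real r)\<^sup>2)" by (simp add: \<mu>)
        have "real (card {Ms\<in>disjoint_tuples (torus n) (L_edges n k) r. self_linked islands r Ms})
            \<le> root 8 (1 / real (card (torus n))) * real (card (disjoint_tuples (torus n) (L_edges n k) r))"
        proof (rule self_linked_count[OF finite_torus card_L_nbrs r(1) _ _ fourth \<mu>2 large])
          show "T \<noteq> {} \<and> T \<subseteq> torus n" if "T \<in> islands" for T using islands_subset[OF that] by blast
          show "T \<inter> T' = {}" if "T \<in> islands" "T' \<in> islands" "T \<noteq> T'" for T T' using islands_disjoint[OF that(1,2)] that(3) by blast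
        qed
        then have cnt: "real (card {Ms\<in>matching_tuples n k r. self_linked islands r Ms}) \<le> root 8 (1 / real (n\<^sup>2)) * real (card (matching_tuples n k r))"
          unfolding matching_tuples_eq card_torus .
        have cpos: "real (card (matching_tuples n k r)) > 0" using finT neT by (simp add: card_gt_0_iff)
        have "measure_pmf.prob ?Q {Ms. self_linked islands r Ms} = real (card {Ms\<in>matching_tuples n k r. self_linked islands r Ms}) / real (card (matching_tuples n k r))"
          using finT neT by (simp add: measure_pmf_of_set Int_def)
        also have "\<dots> \<le> root 8 (1 / real (n\<^sup>2))" using cnt cpos by (simp add: divide_le_eq)
        finally show ?thesis using True by simp
      next
        case False then show ?thesis by simp
      qed
    qed simp
  qed
  finally show ?thesis by simp
qed

section \<open>Asymptotics\<close>

lemma power_div_fact_le_exp: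
  fixes y :: real assumes "y \<ge> 0" shows "y ^ m / fact m \<le> exp y"
proof -
  have "(\<lambda>i. y ^ i /\<^sub>R fact i) sums exp y" by (rule exp_converges)
  then have "(\<Sum>i\<in>{m}. y ^ i /\<^sub>R fact i) \<le> exp y"
    by (intro sum_le_suminf[THEN order_trans, OF _ _ _ eq_refl] sums_unique[symmetric])
      (use assms in \<open>auto simp: sums_iff\<close>)
  then show ?thesis by (simp add: divide_inverse mult.commute)
qed

text \<open>The decay is divided: a rate of 1/20 compensates the power \<open>t ^ 12\<close>, and
  the remaining 1/10 gives \<open>p ^ 100\<close> because of the lower bound on \<open>t\<close>,
  far more than the twentieth power of 1/p that occurs. What remains of \<open>p\<close> absorbs the
  numerical constants.\<close>

lemma small_density_bound:
  fixes p t :: real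
  assumes p: "0 < p" "p \<le> 1 / 100" and t: "1000 * ln (1 / p) \<le> t" "0 < t"
  shows "10 ^ 29 * (t / p\<^sup>2) ^ 10 * t\<^sup>2 * exp (- (3 / 20) * t) \<le> 1"
proof -
  have e1: "exp (- (1 / 10) * t) \<le> p ^ 100"
  proof -
    have "exp (- (1 / 10) * t) \<le> exp (real 100 * ln p)" using t(1) p by (simp add: ln_div)
    also have "\<dots> = p ^ 100" unfolding exp_of_nat_mult using p by simp
    finally show ?thesis .
  qed
  have e2: "t ^ 12 * exp (- (1 / 20) * t) \<le> fact 12 * 20 ^ 12"
  proof -
    have "(t / 20) ^ 12 / fact 12 \<le> exp (t / 20)" using t by (intro power_div_fact_le_exp) simp
    then have "t ^ 12 \<le> fact 12 * 20 ^ 12 * exp (t / 20)" by (simp add: power_divide field_simps)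
    then have "t ^ 12 * exp (- (1 / 20) * t) \<le> fact 12 * 20 ^ 12 * exp (t / 20) * exp (- (1 / 20) * t)"
      by (rule mult_right_mono) simp
    also have "exp (t / 20) * exp (- (1 / 20) * t) = 1" by (simp add: exp_add[symmetric])
    then have "fact 12 * 20 ^ 12 * exp (t / 20) * exp (- (1 / 20) * t) = fact 12 * 20 ^ 12" by (simp add: mult.assoc)
    finally show ?thesis .
  qed
  have ee: "exp (- (3 / 20) * t) = exp (- (1 / 20) * t) * exp (- (1 / 10) * t)" by (simp add: exp_add[symmetric])
  have "10 ^ 29 * (t / p\<^sup>2) ^ 10 * t\<^sup>2 * exp (- (3 / 20) * t) =
      10 ^ 29 * (t ^ 12 * exp (- (1 / 20) * t)) * (exp (- (1 / 10) * t) / p ^ 20)"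
    unfolding ee using p by (simp add: power_divide power_mult[symmetric] power_add[symmetric] field_simps)
  also have "\<dots> \<le> 10 ^ 29 * (fact 12 * 20 ^ 12) * (p ^ 100 / p ^ 20)"
    by (rule mult_mono[OF mult_left_mono[OF e2] divide_right_mono[OF e1]]) (use p t in auto)
  also have "p ^ 100 / p ^ 20 = p ^ 80" using p by (simp add: power_diff[symmetric])
  also have "10 ^ 29 * (fact 12 * 20 ^ 12) * p ^ 80 \<le> 10 ^ 29 * (fact 12 * 20 ^ 12) * (1 / 100) ^ 80"
    using p by (intro mult_left_mono power_mono) auto
  also have "\<dots> \<le> (1 :: real)" by (simp add: fact_numeral power_one_over)
  finally show ?thesis .
qed

text \<open>One summand for each error term of \<open>dissemination_lower_bound\<close>. The
  exponent 60 is 6 + 50 + 4, from the squares of \<open>L\<close>, \<open>B\<close> and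
  \<open>1 / \<mu>\<close>, which are of order 3, 25 and 2 in \<open>ln n\<close>.\<close>

definition error_term :: "nat \<Rightarrow> real" where
  "error_term n = 1 / real n + (801\<^sup>2 * (2 * 510 ^ 8)\<^sup>2 * (2 * 10 ^ 4)\<^sup>2) * ln (real n) ^ 60 / (real n)\<^sup>2
     + exp (- real n / (770\<^sup>2 * ln (real n) ^ 6)) + (1 / (real n)\<^sup>2) powr (1 / 8)"

lemma error_term_tendsto: "error_term \<longlonglongrightarrow> 0"
  unfolding error_term_def by real_asymp

text \<open>With t = p k, the range of k says that t is at least 1000 log(1/p) and that k / p^2 is
  at most a small multiple of log n / log(1/p). All lengths are then polylogarithmic in n, and
  \<open>1 / x \<le> p\<close> bounds the powers of 1/p and r by powers of log n.\<close>

lemma dissemination_error: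
  fixes n k r :: nat and p :: real
  defines "x \<equiv> ln (real n)"
  assumes n: "even n" and x1: "1 \<le> x" and nx: "770 * x ^ 3 \<le> real n" and px: "1 / x \<le> p" and p0: "p \<le> 1 / 100"
    and k1: "1000 / p * ln (1 / p) \<le> real k" and k2: "real k \<le> p\<^sup>2 * x / (3000 * ln (1 / p))"
    and r1: "1 \<le> r" and r2: "real r \<le> p * real k / 20"
  shows "1 - dissemination_prob n k r p \<le> error_term n"
proof -
  define l where "l = ln (1 / p)"
  define t where "t = p * real k"
  have p: "0 < p" using px x1 by (smt (verit) divide_pos_pos)
  have l4: "4 \<le> l"
  proof -
    have "exp 4 = exp (1 :: real) ^ 4" by (simp add: exp_of_nat_mult[symmetric])
    also have "\<dots> \<le> 3 ^ 4" using exp_le by (intro power_mono) auto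
    also have "\<dots> \<le> 1 / p" using p p0 by (simp add: field_simps)
    finally show ?thesis unfolding l_def using p by (subst ln_ge_iff) auto
  qed
  have t1: "1000 * l \<le> t"
  proof -
    have "p * (1000 / p * l) \<le> p * real k" using k1 p by (intro mult_left_mono) (auto simp: l_def)
    then show ?thesis using p by (simp add: t_def)
  qed
  have t4: "4000 \<le> t" using t1 l4 by linarith
  have kx: "real k / p\<^sup>2 \<le> x / (3000 * l)"
  proof -
    have "real k \<le> p\<^sup>2 * (x / (3000 * l))" using k2 by (simp add: l_def)
    then show ?thesis using p by (simp add: field_simps)
  qed
  have xpos: "0 < x" using x1 by simp
  have npos: "0 < real n" using nx xpos by (smt (verit) zero_less_power mult_pos_pos)
  have expx: "exp x = real n" using npos by (simp add: x_def)
  have ktp: "real k = t / p" using p by (simp add: t_def)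
  have kp: "real k / p = t / p\<^sup>2" using p by (simp add: t_def power2_eq_square)
  have k100: "400000 \<le> real k"
  proof -
    have "4000 * 100 \<le> t * (1 / p)" using t4 p p0 by (intro mult_mono) (auto simp: field_simps)
    then show ?thesis by (simp add: ktp)
  qed
  have ip: "1 / p \<le> x"
    using px p xpos by (simp add: field_simps)
  have kpx: "real k / p \<le> x\<^sup>2"
  proof -
    have "real k / p\<^sup>2 \<le> x / (3000 * l)" by (rule kx)
    also have "\<dots> \<le> x / 1" using l4 xpos by (intro divide_left_mono) auto
    finally have "real k / p\<^sup>2 * p \<le> x * p" using p by (intro mult_right_mono) auto
    then have "real k / p \<le> x * p" using p by (simp add: power2_eq_square)
    also have "\<dots> \<le> x * x" using p0 x1 by (intro mult_left_mono) auto
    finally show ?thesis by (simp add: power2_eq_square)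
  qed
  have kx1: "real k \<le> x"
  proof -
    have "real k / p\<^sup>2 \<le> x / (3000 * l)" by (rule kx)
    also have "\<dots> \<le> x / 1" using l4 xpos by (intro divide_left_mono) auto
    finally have "real k \<le> x * p\<^sup>2" using p by (simp add: field_simps)
    also have "\<dots> \<le> x * 1" using p p0 xpos by (intro mult_left_mono power_le_one) auto
    finally show ?thesis by simp
  qed
  \<comment> \<open>The curvature gets the same budget t/20 as \<open>r\<close>. Then the threshold
    \<open>r + 2 * e + 2\<close> is at most 3t/20 + 2, while the Chernoff exponent is 3t/10, so a
    rate of 3/20 remains.\<close>
  define e where "e = nat \<lfloor>t / 20\<rfloor>"
  have e: "t / 20 - 1 \<le> real e" "real e \<le> t / 20"
    using t4 unfolding e_def by linarith+
  have e199: "199 \<le> real e" using e t4 by linarith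
  have tk: "t \<le> real k" unfolding t_def using p p0 mult_right_mono[of p 1 "real k"] by simp
  have e1: "1 \<le> e" using e199 by linarith
  have ek: "e \<le> k"
  proof -
    have "real e \<le> real k" using e(2) tk t4 by linarith
    then show ?thesis by simp
  qed
  define d where "d = k div e"
  \<comment> \<open>The excess of 20.2 over 20 pays for rounding \<open>e\<close> down, as
    \<open>t\<close> is at least 4000.\<close>
  have d: "real d \<le> 20.2 / p"
  proof -
    have "d * e \<le> k" unfolding d_def by (rule div_times_less_eq_dividend)
    then have "real d * real e \<le> real k" by (metis of_nat_le_iff of_nat_mult)
    then have "real d \<le> real k / real e" using e199 by (simp add: pos_le_divide_eq)
    also have "\<dots> \<le> 20.2 / p"
    proof -
      have "t \<le> 20.2 * real e" using e(1) t4 by linarith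
      then show ?thesis using p e199 by (simp add: t_def field_simps)
    qed
    finally show ?thesis .
  qed
  have ip100: "100 \<le> 1 / p" using p p0 by (simp add: field_simps)
  have d4: "real d + 4 \<le> 21 / p" using d ip100 by simp
  define R where "R = k * (d + 4)"
  have Rb: "real R \<le> 21 * (real k / p)"
  proof -
    have "real k * (real d + 4) \<le> real k * (21 / p)" using d4 by (intro mult_left_mono) auto
    moreover have "real k * (21 / p) = 21 * (real k / p)" by simp
    moreover have "real R = real k * (real d + 4)" by (simp add: R_def)
    ultimately show ?thesis by linarith
  qed
  have kp1: "1 \<le> real k / p" using k100 ip100 p p0 by (simp add: field_simps)
  have Rx: "real R \<le> 21 * x\<^sup>2" using Rb kpx by linarith
  \<comment> \<open>About log n links: long enough for the union bound, as n^2 / 512^M is below 1/n,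
    and short enough for \<open>M * (4 * R + 1)\<close> to be of order (log n)^3.\<close>
  define M where "M = nat \<lceil>x\<rceil>"
  have Mx: "x \<le> real M" "real M \<le> 2 * x" using x1 unfolding M_def by linarith+
  have x3: "x\<^sup>2 \<le> x ^ 3" "x \<le> x ^ 3" "1 \<le> x ^ 3"
    using x1 power_increasing[of 2 3 x] power_increasing[of 1 3 x] by auto
  have R4: "real (4 * R + 1) \<le> 85 * x\<^sup>2"
  proof -
    have "1 \<le> x\<^sup>2" using x1 by simp
    then show ?thesis using Rx by simp
  qed
  have MR: "real (M * (4 * R + 1)) \<le> 170 * x ^ 3"
  proof -
    have "real M * real (4 * R + 1) \<le> (2 * x) * (85 * x\<^sup>2)" using Mx R4 xpos by (intro mult_mono) auto
    also have "\<dots> = 170 * x ^ 3" by (simp add: power2_eq_square power3_eq_cube)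
    finally show ?thesis by (simp only: of_nat_mult)
  qed
  have rk: "real r \<le> t / 20" using r2 by (simp add: t_def)
  have rx: "real r \<le> x" using rk tk kx1 t4 by linarith
  have n1: "2 * k < n" and n2: "2 * r \<le> n" and n3: "8 + 8 * (4 * k + 2 + r) \<le> n\<^sup>2"
  proof -
    have big: "770 * x \<le> real n" using nx x3 by linarith
    then have "real (2 * k) < real n" using kx1 xpos by simp
    then show "2 * k < n" by (simp only: of_nat_less_iff)
    have "real (2 * r) \<le> real n" using rx big xpos by simp
    then show "2 * r \<le> n" by (simp only: of_nat_le_iff)
    have "real (8 + 8 * (4 * k + 2 + r)) \<le> real n" using rx kx1 big x1 by simp
    then have "8 + 8 * (4 * k + 2 + r) \<le> n" by (simp only: of_nat_le_iff)
    also have "n \<le> n\<^sup>2" by (simp add: power2_eq_square)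
    finally show "8 + 8 * (4 * k + 2 + r) \<le> n\<^sup>2" .
  qed
  have M1: "2 * M * (4 * R + 1) + 2 * (R + k) < n"
  proof -
    have "real (2 * (M * (4 * R + 1)) + 2 * (R + k)) < real n"
      using MR Rx kx1 x3 nx by simp
    then have "2 * (M * (4 * R + 1)) + 2 * (R + k) < n" by (simp only: of_nat_less_iff)
    then show ?thesis by (simp add: mult.assoc)
  qed
  define \<delta> where "\<delta> = real ((2 * R + 1)\<^sup>2) * (4 * exp (real (r + 2 * e + 2) - 3 / 5 * (p / 2) * real k))"
  have \<delta>0: "\<delta> \<ge> 0" by (simp add: \<delta>_def)
  have \<delta>b: "\<delta> \<le> (43 * (t / p\<^sup>2))\<^sup>2 * (36 * exp (- (3 / 20) * t))"
  proof -
    have "real (r + 2 * e + 2) - 3 / 5 * (p / 2) * real k \<le> 2 + - (3 / 20) * t"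
      using rk e(2) by (simp add: t_def)
    then have "exp (real (r + 2 * e + 2) - 3 / 5 * (p / 2) * real k) \<le> exp (2 + - (3 / 20) * t)" by simp
    also have "\<dots> = exp 2 * exp (- (3 / 20) * t)" by (rule exp_add)
    also have "\<dots> \<le> 9 * exp (- (3 / 20) * t)"
    proof -
      have "exp 2 = exp (1 :: real) ^ 2" by (simp add: exp_of_nat_mult[symmetric])
      also have "\<dots> \<le> 3 ^ 2" using exp_le by (intro power_mono) auto
      finally show ?thesis by simp
    qed
    finally have ex: "4 * exp (real (r + 2 * e + 2) - 3 / 5 * (p / 2) * real k) \<le> 36 * exp (- (3 / 20) * t)" by simp
    have "real (2 * R + 1) \<le> 43 * (t / p\<^sup>2)" using Rb kp1 unfolding kp by simp
    then have "real (2 * R + 1) ^ 2 \<le> (43 * (t / p\<^sup>2))\<^sup>2" by (intro power_mono) auto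
    then have sq: "real ((2 * R + 1)\<^sup>2) \<le> (43 * (t / p\<^sup>2))\<^sup>2" by (simp only: of_nat_power)
    show ?thesis unfolding \<delta>_def by (rule mult_mono[OF sq ex]) auto
  qed
  define \<mu> where "\<mu> = 1 / (2 * (10 ^ 4 * (real r)\<^sup>2))"
  have \<mu>2: "2 * (3 * real (4 * R + 1)) ^ 8 * \<delta> \<le> \<mu>"
  proof -
    have "3 * real (4 * R + 1) \<le> 255 * (t / p\<^sup>2)" using Rb kp1 unfolding kp by simp
    then have "(3 * real (4 * R + 1)) ^ 8 \<le> (255 * (t / p\<^sup>2)) ^ 8" by (intro power_mono) auto
    then have "2 * (3 * real (4 * R + 1)) ^ 8 * \<delta> \<le> 2 * (255 * (t / p\<^sup>2)) ^ 8 * ((43 * (t / p\<^sup>2))\<^sup>2 * (36 * exp (- (3 / 20) * t)))"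
      using \<delta>b \<delta>0 by (intro mult_mono) auto
    moreover have "2 * (10 ^ 4 * (real r)\<^sup>2) \<le> 2 * (10 ^ 4 * t\<^sup>2)"
      using rk t4 by (intro mult_left_mono power_mono) auto
    ultimately have "(2 * (3 * real (4 * R + 1)) ^ 8 * \<delta>) * (2 * (10 ^ 4 * (real r)\<^sup>2))
        \<le> (2 * (255 * (t / p\<^sup>2)) ^ 8 * ((43 * (t / p\<^sup>2))\<^sup>2 * (36 * exp (- (3 / 20) * t)))) * (2 * (10 ^ 4 * t\<^sup>2))"
      by (rule mult_mono) auto
    also have "\<dots> = (2 * 255 ^ 8 * 43\<^sup>2 * 36 * 2 * 10 ^ 4) * ((t / p\<^sup>2) ^ 10 * t\<^sup>2 * exp (- (3 / 20) * t))"
    proof -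
      have "(t / p\<^sup>2) ^ 10 = (t / p\<^sup>2) ^ 8 * (t / p\<^sup>2)\<^sup>2" by (simp only: power_add[symmetric]) simp
      then show ?thesis by (simp only: power_mult_distrib mult_ac)
    qed
    \<comment> \<open>The product of the numerical constants is about 4.8 times 10^28.\<close>
    also have "\<dots> \<le> 10 ^ 29 * ((t / p\<^sup>2) ^ 10 * t\<^sup>2 * exp (- (3 / 20) * t))"
      using t4 by (intro mult_right_mono) auto
    also have "\<dots> \<le> 1" using small_density_bound[OF p p0, of t] t1 t4 by (simp add: l_def mult.assoc)
    finally show ?thesis unfolding \<mu>_def using r1 by (simp add: pos_le_divide_eq)
  qed
  have \<mu>0: "\<mu> > 0" using r1 by (simp add: \<mu>_def)
  have \<mu>1: "\<mu> \<le> 1 / 512"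
  proof -
    have "1 \<le> (real r)\<^sup>2" using r1 by simp
    then have "512 \<le> 2 * (10 ^ 4 * (real r)\<^sup>2)" by simp
    then show ?thesis unfolding \<mu>_def using r1 by (intro divide_left_mono) auto
  qed
  have q: "real ((8 * R + 3)\<^sup>2) * \<delta> \<le> 1 / 512"
  proof -
    have "real ((8 * R + 3)\<^sup>2) = real (8 * R + 3) ^ 2" by simp
    also have "\<dots> \<le> (3 * real (4 * R + 1)) ^ 2" by (intro power_mono) auto
    also have "\<dots> \<le> (3 * real (4 * R + 1)) ^ 8" by (intro power_increasing) auto
    also have "\<dots> \<le> 2 * (3 * real (4 * R + 1)) ^ 8" by simp
    finally have "real ((8 * R + 3)\<^sup>2) * \<delta> \<le> 2 * (3 * real (4 * R + 1)) ^ 8 * \<delta>" using \<delta>0 by (rule mult_right_mono)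
    then show ?thesis using \<mu>2 \<mu>1 by linarith
  qed
  define L where "L = M * (4 * R + 1) + (R + k)"
  define B where "B = real M * (3 * real M * real (4 * R + 1)) ^ 8"
  define \<rho> where "\<rho> = M * (4 * R + 1) + 1 + R"
  define v where "v = (2 * k * (d + 2) + 1) * (2 * (d + 2) + 1)"
  have "1 - dissemination_prob n k r p \<le> real (n\<^sup>2) * (1 / 512) ^ M + real ((4 * L + 1)\<^sup>2) * B\<^sup>2 / (\<mu>\<^sup>2 * real (n\<^sup>2))
    + (1 - (p / 2) ^ v) ^ ((n div (2 * \<rho> + 1))\<^sup>2) + root 8 (1 / real (n\<^sup>2))"
  proof (rule dissemination_lower_bound[OF n n1 n2 n3 e1 ek _ r1 _ _ _ _ M1 \<delta>_def q \<mu>_def \<mu>2 L_def B_def \<rho>_def])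
    show "2 \<le> k" using k100 by linarith
    have "real (r + 1) \<le> real (2 * k)" using rk tk k100 by simp
    then show "r + 1 \<le> 2 * k" by (simp only: of_nat_le_iff)
    show "R = k * (k div e + 4)" by (simp add: R_def d_def)
    show "v = (2 * k * (k div e + 2) + 1) * (2 * (k div e + 2) + 1)" by (simp add: v_def d_def)
  qed (use p p0 in auto)
  also have "\<dots> \<le> error_term n"
    unfolding error_term_def x_def[symmetric]
  proof (intro add_mono)
    have "exp 5 = exp (1 :: real) ^ 5" by (simp add: exp_of_nat_mult[symmetric])
    also have "\<dots> \<le> 3 ^ 5" using exp_le by (intro power_mono) auto
    finally have "exp 5 \<le> (512 :: real)" by simp
    then have "1 / 512 \<le> exp (- 5 :: real)" by (simp add: exp_minus field_simps)
    then have "(1 / 512) ^ M \<le> exp (- 5 :: real) ^ M" by (intro power_mono) auto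
    also have "\<dots> = exp (- 5 * real M)" by (simp add: exp_of_nat_mult[symmetric] mult.commute)
    also have "\<dots> \<le> exp (- 3 * x)" using Mx xpos by simp
    also have "\<dots> = 1 / real n ^ 3" by (simp add: exp_minus expx[symmetric] exp_of_nat_mult[symmetric] inverse_eq_divide)
    finally have "real (n\<^sup>2) * (1 / 512) ^ M \<le> real (n\<^sup>2) * (1 / real n ^ 3)" by (intro mult_left_mono) auto
    also have "\<dots> = 1 / real n" using npos by (simp add: power2_eq_square power3_eq_cube)
    finally show "real (n\<^sup>2) * (1 / 512) ^ M \<le> 1 / real n" .
  next
    have "real (4 * L + 1) \<le> 801 * x ^ 3" using MR Rx kx1 x3 by (simp add: L_def)
    then have "real (4 * L + 1) ^ 2 \<le> (801 * x ^ 3)\<^sup>2" by (intro power_mono) auto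
    then have Lb: "real ((4 * L + 1)\<^sup>2) \<le> (801 * x ^ 3)\<^sup>2" by (simp only: of_nat_power)
    have "B \<le> (2 * x) * (510 * x ^ 3) ^ 8"
      unfolding B_def
    proof (rule mult_mono[OF _ power_mono])
      show "3 * real M * real (4 * R + 1) \<le> 510 * x ^ 3" using MR by (simp add: algebra_simps)
    qed (use Mx xpos in auto)
    then have Bb: "B\<^sup>2 \<le> ((2 * x) * (510 * x ^ 3) ^ 8)\<^sup>2" by (intro power_mono) (auto simp: B_def)
    have "1 / \<mu> \<le> 2 * 10 ^ 4 * x\<^sup>2"
    proof -
      have "1 / \<mu> = 2 * (10 ^ 4 * (real r)\<^sup>2)" by (simp add: \<mu>_def)
      also have "\<dots> \<le> 2 * (10 ^ 4 * x\<^sup>2)" using rx by (intro mult_left_mono power_mono) auto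
      finally show ?thesis by simp
    qed
    then have mb: "(1 / \<mu>)\<^sup>2 \<le> (2 * 10 ^ 4 * x\<^sup>2)\<^sup>2" using \<mu>0 by (intro power_mono) auto
    have "real ((4 * L + 1)\<^sup>2) * B\<^sup>2 / (\<mu>\<^sup>2 * real (n\<^sup>2)) = real ((4 * L + 1)\<^sup>2) * B\<^sup>2 * (1 / \<mu>)\<^sup>2 / (real n)\<^sup>2"
      by (simp add: power_divide)
    also have "\<dots> \<le> (801 * x ^ 3)\<^sup>2 * ((2 * x) * (510 * x ^ 3) ^ 8)\<^sup>2 * (2 * 10 ^ 4 * x\<^sup>2)\<^sup>2 / (real n)\<^sup>2"
      using Lb Bb mb by (intro divide_right_mono mult_mono) auto
    also have "(801 * x ^ 3)\<^sup>2 * ((2 * x) * (510 * x ^ 3) ^ 8)\<^sup>2 * (2 * 10 ^ 4 * x\<^sup>2)\<^sup>2 = (801\<^sup>2 * (2 * 510 ^ 8)\<^sup>2 * (2 * 10 ^ 4)\<^sup>2) * x ^ 60"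
      by (simp add: power_mult_distrib power_mult[symmetric] power_add[symmetric])
    finally show "real ((4 * L + 1)\<^sup>2) * B\<^sup>2 / (\<mu>\<^sup>2 * real (n\<^sup>2)) \<le> (801\<^sup>2 * (2 * 510 ^ 8)\<^sup>2 * (2 * 10 ^ 4)\<^sup>2) * x ^ 60 / (real n)\<^sup>2" .
  next
    have vb: "real v \<le> 1849 * (real k / p\<^sup>2)"
    proof -
      have "real (2 * k * (d + 2) + 1) \<le> 43 * (real k / p)"
      proof -
        have "2 * k * (d + 2) + 1 \<le> 2 * R + 1" by (simp add: R_def algebra_simps)
        then have "real (2 * k * (d + 2) + 1) \<le> real (2 * R + 1)" by (simp only: of_nat_le_iff)
        moreover have "real (2 * R + 1) = 2 * real R + 1" by simp
        ultimately show ?thesis using kp1 Rb by linarith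
      qed
      moreover have "real (2 * (d + 2) + 1) \<le> 43 * (1 / p)" using d4 ip100 by simp
      ultimately have "real (2 * k * (d + 2) + 1) * real (2 * (d + 2) + 1) \<le> (43 * (real k / p)) * (43 * (1 / p))"
        using p by (intro mult_mono) auto
      also have "\<dots> = 1849 * (real k / p\<^sup>2)" by (simp add: power2_eq_square)
      finally show ?thesis unfolding v_def by (simp only: of_nat_mult)
    qed
    \<comment> \<open>Replacing p by p/2 costs at most a factor 5/4 in the logarithm. Together with
      the 1849 of the droplet volume it stays below the 3000 in the upper bound on \<open>k\<close>,
      so a given seed has probability at least 1/n.\<close>
    have "ln (2 / p) \<le> 5 / 4 * l"
    proof -
      have "ln (2 / p) = ln 2 + l" using p by (simp add: l_def ln_div)
      moreover have "ln 2 \<le> (1 :: real)" using ln_le_minus_one[of 2] by simp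
      ultimately show ?thesis using l4 by simp
    qed
    then have "real v * ln (2 / p) \<le> (1849 * (x / (3000 * l))) * (5 / 4 * l)"
      using vb kx p p0 l4 xpos by (intro mult_mono) auto
    also have "\<dots> = 1849 * 5 / 12000 * x" using l4 by simp
    also have "\<dots> \<le> x" using xpos by simp
    finally have vx: "real v * ln (2 / p) \<le> x" .
    have pv: "1 / real n \<le> (p / 2) ^ v"
    proof -
      have "1 / real n = exp (- x)" by (simp add: exp_minus expx inverse_eq_divide)
      also have "\<dots> \<le> exp (real v * - ln (2 / p))" using vx by simp
      also have "- ln (2 / p) = ln (p / 2)" using p by (simp add: ln_div)
      also have "exp (real v * ln (p / 2)) = (p / 2) ^ v" using p by (simp add: exp_of_nat_mult)
      finally show ?thesis .
    qed
    define s where "s = 2 * \<rho> + 1"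
    define g where "g = n div s"
    have sb: "real s \<le> 385 * x ^ 3" using MR Rx x3 by (simp add: s_def \<rho>_def)
    have "real n / (770 * x ^ 3) \<le> real g"
    proof -
      have "n < (g + 1) * s" unfolding g_def s_def by (metis Suc_eq_plus1 dividend_less_div_times zero_less_Suc mult.commute add.commute mult_Suc)
      then have "real n \<le> (real g + 1) * real s" by (metis less_imp_le of_nat_1 of_nat_add of_nat_le_iff of_nat_mult)
      also have "\<dots> \<le> (real g + 1) * (385 * x ^ 3)" using sb by (intro mult_left_mono) auto
      finally have "real n \<le> real g * (385 * x ^ 3) + 385 * x ^ 3" by (simp add: algebra_simps)
      then have "real n / 2 \<le> real g * (385 * x ^ 3)" using nx by linarith
      then show ?thesis using xpos by (simp add: field_simps)
    qed
    then have "(real n / (770 * x ^ 3))\<^sup>2 \<le> (real g)\<^sup>2" using xpos by (intro power_mono) auto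
    then have gn: "real n / (770\<^sup>2 * x ^ 6) \<le> (real g)\<^sup>2 / real n"
      using npos xpos by (simp add: power_divide power_mult_distrib power_mult[symmetric] field_simps power2_eq_square)
    have pv1: "(p / 2) ^ v \<le> 1" using p p0 by (intro power_le_one) auto
    \<comment> \<open>There are \<open>g ^ 2\<close> independent trials, of order n^2 / (log n)^6,
      each succeeding with probability at least 1/n.\<close>
    have "(1 - (p / 2) ^ v) ^ (g\<^sup>2) \<le> (exp (- 1 / real n)) ^ (g\<^sup>2)"
    proof (rule power_mono)
      have "1 - (p / 2) ^ v \<le> 1 + (- 1 / real n)" using pv by simp
      also have "\<dots> \<le> exp (- 1 / real n)" by (rule exp_ge_add_one_self)
      finally show "1 - (p / 2) ^ v \<le> exp (- 1 / real n)" .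
    qed (use pv1 in simp)
    also have "\<dots> = exp (- ((real g)\<^sup>2 / real n))" by (simp add: exp_of_nat_mult[symmetric])
    also have "\<dots> \<le> exp (- real n / (770\<^sup>2 * x ^ 6))" using gn by simp
    finally show "(1 - (p / 2) ^ v) ^ ((n div (2 * \<rho> + 1))\<^sup>2) \<le> exp (- real n / (770\<^sup>2 * x ^ 6))"
      unfolding g_def s_def .
  next
    show "root 8 (1 / real (n\<^sup>2)) \<le> (1 / (real n)\<^sup>2) powr (1 / 8)"
      using npos by (simp add: root_powr_inverse)
  qed
  finally show ?thesis .
qed

lemma dissemination_prob_le_1: "dissemination_prob n k r p \<le> 1"
  by (simp add: dissemination_prob_def)

theorem theorem1:
  "\<exists>p0>0. \<forall>(p :: nat \<Rightarrow> real) (k :: nat \<Rightarrow> nat) (r :: nat \<Rightarrow> nat).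
     (\<forall>n. p n \<in> {0..1}) \<longrightarrow>
     (\<forall>\<^sub>F n in inf sequentially (principal {n. even n}).
        200 * ln (ln (real n)) powr (2/3) / ln (real n) powr (1/3) \<le> p n \<and> p n \<le> p0 \<and>
        1000 / p n * ln (1 / p n) \<le> real (k n) \<and>
        real (k n) \<le> (p n)\<^sup>2 * ln (real n) / (3000 * ln (1 / p n)) \<and>
        1 \<le> r n \<and> real (r n) \<le> p n * real (k n) / 20) \<longrightarrow>
     ((\<lambda>n. dissemination_prob n (k n) (r n) (p n)) \<longlongrightarrow> 1)
       (inf sequentially (principal {n. even n}))"
proof (intro exI[of _ "1 / 100"] conjI allI impI)
  fix p :: "nat \<Rightarrow> real" and k r :: "nat \<Rightarrow> nat"
  let ?F = "inf sequentially (principal {n. even n})"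
  assume H: "\<forall>\<^sub>F n in ?F. 200 * ln (ln (real n)) powr (2/3) / ln (real n) powr (1/3) \<le> p n \<and> p n \<le> 1 / 100 \<and>
        1000 / p n * ln (1 / p n) \<le> real (k n) \<and>
        real (k n) \<le> (p n)\<^sup>2 * ln (real n) / (3000 * ln (1 / p n)) \<and>
        1 \<le> r n \<and> real (r n) \<le> p n * real (k n) / 20"
  have F: "?F \<le> sequentially" by simp
  \<comment> \<open>The lower bound on \<open>p\<close> is used in the form
    \<open>1 / ln n \<le> p\<close>, which it implies for large n since (log n)^(-1/3) dominates 1 /
    log n.\<close>
  have large: "\<forall>\<^sub>F n in sequentially. 1 \<le> ln (real n) \<and> 770 * ln (real n) ^ 3 \<le> real n \<and>
      1 / ln (real n) \<le> 200 * ln (ln (real n)) powr (2/3) / ln (real n) powr (1/3)"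
    by (intro eventually_conj; real_asymp)
  have ev: "\<forall>\<^sub>F n in ?F. even n" by (simp add: eventually_inf_principal)
  have low: "\<forall>\<^sub>F n in ?F. 1 - error_term n \<le> dissemination_prob n (k n) (r n) (p n)"
    using H ev filter_leD[OF F large]
  proof eventually_elim
    case (elim n)
    have "1 - dissemination_prob n (k n) (r n) (p n) \<le> error_term n"
      by (rule dissemination_error) (use elim in auto)
    then show ?case by simp
  qed
  have "((\<lambda>n. 1 - error_term n) \<longlongrightarrow> 1 - 0) ?F"
    by (intro tendsto_diff tendsto_const tendsto_mono[OF F error_term_tendsto])
  then have lim: "((\<lambda>n. 1 - error_term n) \<longlongrightarrow> 1) ?F" by simp
  show "((\<lambda>n. dissemination_prob n (k n) (r n) (p n)) \<longlongrightarrow> 1) ?F"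
    by (rule tendsto_sandwich[OF low _ lim tendsto_const]) (simp add: dissemination_prob_le_1)
qed simp

end
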